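(* Let $p\geq 2$ be a large prime, and let $a_0\neq a_1$ and $s\geq 2$ be small integers. Then the finite field $\mathbb{F}_p$ contains a pair of consecutive $s$-power free primitive roots $n+a_0$ and $n+a_1$. Furthermore, the number $N_s(2,p)$ of such pairs satisfies $$N_s(2,p)=\prod_{q\geq 2}\left(1-\frac{\rho(q)}{q^s}\right)\left(\frac{\varphi(p-1)}{p-1}\right)^2p+O\left(p^{1-\varepsilon}\right),$$ where the product is over all primes $q$, $\rho(q)=2$ if $q^s\nmid a_1-a_0$ and $\rho(q)=1$ if $q^s\mid a_1-a_0$, and $\varepsilon>0$ is an arbitrarily small number.
   Context: An element $\alpha\in\mathbb{F}_p$ is a primitive root if its multiplicative order $\mathrm{ord}_p(\alpha)$ equals $p-1$. Elements $n\in\mathbb{F}_p$ are identified with their integer representatives $0\leq n\leq p-1$, and $n+a_i$ is regarded as an integer when $s$-power freeness is considered. An integer $n$ is $s$-power free if $r^s\nmid n$ for every prime $r\geq 2$; $\mu_s$ denotes the characteristic function of $s$-power free integers. Then $$N_s(2,p)=\#\{n\in\mathbb{F}_p:\ \mathrm{ord}_p(n+a_i)=p-1 \text{ and } \mu_s(n+a_i)=1 \text{ for } i=0,1\}.$$ $\varphi$ is Euler's totient function. "Large prime" means $p$ sufficiently large, "small integers" means they are fixed, and asymptotics are for $p\to\infty$. *)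

theory Defs
  imports
    "HOL-Analysis.Analysis"
    "HOL-Number_Theory.Number_Theory"
    "HOL-Library.Landau_Symbols"
begin

definition power_free :: "nat \<Rightarrow> int \<Rightarrow> bool" where
  "power_free s n \<longleftrightarrow> (\<forall>r. prime r \<longrightarrow> \<not> r ^ s dvd n)"

definition mu_free :: "nat \<Rightarrow> int \<Rightarrow> nat" where
  "mu_free s n = (if power_free s n then 1 else 0)"

(* The order of the class of x in F_p. Number theory's ord lives on nat, so x is replaced by its
   representative in {0..<p}. If p divides x then the order is 0, so x is not a primitive root. *)
definition ord_Fp :: "nat \<Rightarrow> int \<Rightarrow> nat" where
  "ord_Fp p x = ord p (nat (x mod int p))"

(* Elements of F_p are the representatives n in {0..<p}. The order of n + a is taken in F_p,
   whereas power freeness concerns the integer n + a, which is not reduced modulo p. *)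
definition primroot_pairs :: "nat \<Rightarrow> int \<Rightarrow> int \<Rightarrow> nat \<Rightarrow> nat set" where
  "primroot_pairs s a0 a1 p =
     {n \<in> {0..<p}. \<forall>a\<in>{a0, a1}. ord_Fp p (int n + a) = p - 1 \<and> mu_free s (int n + a) = 1}"

definition N_pairs :: "nat \<Rightarrow> int \<Rightarrow> int \<Rightarrow> nat \<Rightarrow> nat" where
  "N_pairs s a0 a1 p = card (primroot_pairs s a0 a1 p)"

definition rho :: "nat \<Rightarrow> int \<Rightarrow> int \<Rightarrow> nat \<Rightarrow> nat" where
  "rho s a0 a1 q = (if int q ^ s dvd a1 - a0 then 1 else 2)"

(* The product over all primes, written over all naturals with factor 1 at the non-primes. *)
definition singular_factor :: "nat \<Rightarrow> int \<Rightarrow> int \<Rightarrow> nat \<Rightarrow> real" where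
  "singular_factor s a0 a1 q =
     (if prime q then 1 - real (rho s a0 a1 q) / real q ^ s else 1)"

definition singular_product :: "nat \<Rightarrow> int \<Rightarrow> int \<Rightarrow> real" where
  "singular_product s a0 a1 = (\<Prod>q. singular_factor s a0 a1 q)"

lemma abs_convergent_singular_product:
  assumes "s \<ge> 2"
  shows "abs_convergent_prod (singular_factor s a0 a1)"
proof (rule summable_imp_abs_convergent_prod)
  have "summable (\<lambda>n. 2 * (1 / real n ^ 2))"
    using inverse_power_summable[of 2, where ?'a = real]
    by (intro summable_mult) (simp add: inverse_eq_divide)
  moreover have "norm (norm (singular_factor s a0 a1 n - 1)) \<le> 2 * (1 / real n ^ 2)" for n
  proof (cases "prime n")
    case True
    then have n: "n > 0" by (simp add: prime_gt_0_nat)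
    then have "real n ^ 2 \<le> real n ^ s"
      using assms by (intro power_increasing) auto
    then have "real (rho s a0 a1 n) / real n ^ s \<le> 2 / real n ^ 2"
      using n by (intro frac_le) (auto simp: rho_def)
    then show ?thesis
      using True by (simp add: singular_factor_def)
  qed (simp add: singular_factor_def)
  ultimately show "summable (\<lambda>n. norm (singular_factor s a0 a1 n - 1))"
    by (rule summable_comparison_test'[where N = 0])
qed

definition primes_at_top :: "nat filter" where
  "primes_at_top = inf at_top (principal {p. prime p})"

end

theory Submission
  imports Defs
begin

text \<open>
  Primitive roots are detected by multiplicative characters modulo \<open>p\<close>, power-free integers by a
  truncated Moebius sieve, so the error term consists of sums of \<open>\<phi>(n + a\<^sub>0) \<psi>(n + a\<^sub>1)\<close> over
  arithmetic progressions with \<open>\<phi>\<close>, \<open>\<psi>\<close> not both trivial. Completion reduces these to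
  \<open>S(a, b, h) = \<Sum>\<^sub>n \<phi>(n + a) \<psi>(n + b) e(h n / p)\<close>. Instead of the Weil bound, an elementary argument
  in the style of Kloosterman gives \<open>\<bar>S\<bar>\<^sup>4 \<le> 24 p\<^sup>3\<close>: the fourth moment of \<open>S\<close> over all
  \<open>(a, b, h)\<close> is at most \<open>12 p\<^sup>5\<close>, while \<open>\<bar>S\<bar>\<close> is constant on orbits of the affine group, which have
  \<open>p (p - 1)\<close> elements. Any fixed saving over the trivial bound suffices for the theorem.
\<close>

section \<open>Exponential sums over residues modulo a prime\<close>

text \<open>Why the fourth moment: the second moment over the p^3 parameters has size p^4, and
  dividing by an orbit of about p^2 elements returns only the trivial bound p for a single sum. The
  fourth moment, of size p^5, is the first to save; it is within reach because S^2, sorted by n + m,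
  is a Fourier transform in h.

  The resulting factor p^(1/4) has to pay for every progression of the sieve, which forces the cut
  at a small power y of p. The cut also keeps all moduli below p, hence invertible modulo p. It is
  harmless because the truncation can fail only where n + a0 or n + a1 is zero or divisible by the
  square of some e > sqrt y, and such n are few; this is where s \<ge> 2 matters.

  Existence does not follow from a positive density, since the totient ratio of p - 1 has no
  positive lower bound. It is at least 2^(-k), with k the number of distinct primes dividing p - 1,
  and the divisor bound makes this loss smaller than the power saved in the error term.\<close>

lemma cis_eq_1_iff_dvd:
  fixes n :: nat and x :: int
  assumes "n > 0"
  shows "cis (2 * pi * of_int x / of_nat n) = 1 \<longleftrightarrow> int n dvd x"
proof -
  have "cis (2 * pi * of_int x / of_nat n) = 1 \<longleftrightarrow> cos (2 * pi * of_int x / of_nat n) = 1"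
    by (metis cis.sel(1) cos_one_sin_zero cis.code one_complex.code one_complex.simps(1))
  also have "\<dots> \<longleftrightarrow> (\<exists>k::int. 2 * pi * of_int x / of_nat n = k * 2 * pi)"
    by (simp add: cos_one_2pi_int)
  also have "\<dots> \<longleftrightarrow> (\<exists>k::int. (of_int x :: real) = of_int (k * int n))"
    using assms by (intro ex_cong1) (auto simp: field_simps)
  also have "\<dots> \<longleftrightarrow> int n dvd x"
    unfolding of_int_eq_iff dvd_def by (auto simp: mult.commute)
  finally show ?thesis .
qed

locale prime_modulus =
  fixes p :: nat
  assumes prime_p: "prime p"
begin

definition R :: "int set" where "R = {0..<int p}"

text \<open>Functions on F_p are kept as functions on all integers that ignore multiples of
  \<open>p\<close>, so shifts and dilations can be written without reducing the argument.\<close>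

definition periodic :: "(int \<Rightarrow> 'a) \<Rightarrow> bool" where
  "periodic f \<longleftrightarrow> (\<forall>x. f (x mod int p) = f x)"

definition ee :: "int \<Rightarrow> complex" where
  "ee x = cis (2 * pi * of_int x / of_nat p)"

lemma p_pos: "p > 0" and p_gt_1: "p > 1"
  using prime_gt_0_nat[OF prime_p] prime_gt_1_nat[OF prime_p] by auto

lemma prime_int_p: "prime (int p)"
  using prime_p by simp

lemma finite_R [simp]: "finite R" and card_R [simp]: "card R = p"
  by (auto simp: R_def)

lemma mod_in_R [simp]: "x mod int p \<in> R"
  using p_pos by (simp add: R_def)

lemma mod_R_eq: "x \<in> R \<Longrightarrow> x mod int p = x"
  by (simp add: R_def)

lemma R_dvd_iff: "x \<in> R \<Longrightarrow> int p dvd x \<longleftrightarrow> x = 0"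
  by (auto simp: R_def zdvd_not_zless dest: zdvd_imp_le)

lemma R_dvd_diff_iff: "x \<in> R \<Longrightarrow> y \<in> R \<Longrightarrow> int p dvd x - y \<longleftrightarrow> x = y"
  by (metis mod_R_eq mod_eq_dvd_iff)

lemma zero_in_R [simp]: "0 \<in> R"
  using p_gt_1 by (auto simp: R_def)

lemma periodic_cong: "periodic f \<Longrightarrow> x mod int p = y mod int p \<Longrightarrow> f x = f y"
  unfolding periodic_def by metis

lemma periodicI: "(\<And>x y. int p dvd x - y \<Longrightarrow> f x = f y) \<Longrightarrow> periodic f"
  unfolding periodic_def by (metis mod_eq_dvd_iff mod_mod_trivial)

lemma periodic_dvd: "periodic f \<Longrightarrow> int p dvd x - y \<Longrightarrow> f x = f y"
  by (rule periodic_cong) (auto simp: mod_eq_dvd_iff)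

text \<open>The condition on \<open>g\<close> is injectivity modulo \<open>p\<close>, and an
  injective self-map of the finite set \<open>R\<close> is a permutation.\<close>

lemma sum_reindex_R:
  fixes f :: "int \<Rightarrow> 'a::comm_monoid_add"
  assumes f: "periodic f" and g: "\<And>x y. int p dvd g x - g y \<Longrightarrow> int p dvd x - y"
  shows "(\<Sum>x\<in>R. f (g x)) = (\<Sum>x\<in>R. f x)"
proof -
  let ?h = "\<lambda>x. g x mod int p"
  have inj: "inj_on ?h R"
    by (rule inj_onI) (metis g R_dvd_diff_iff mod_eq_dvd_iff)
  have "?h ` R \<subseteq> R" by auto
  then have "?h ` R = R" using inj by (simp add: endo_inj_surj)
  then have "(\<Sum>x\<in>R. f x) = (\<Sum>x\<in>R. f (?h x))"
    using sum.reindex[OF inj, of f] by (simp add: o_def)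
  then show ?thesis using f by (simp add: periodic_def)
qed

lemma sum_shift_R:
  fixes f :: "int \<Rightarrow> 'a::comm_monoid_add"
  shows "periodic f \<Longrightarrow> (\<Sum>x\<in>R. f (x + t)) = (\<Sum>x\<in>R. f x)"
  by (rule sum_reindex_R) auto

lemma sum_scale_R:
  fixes f :: "int \<Rightarrow> 'a::comm_monoid_add"
  assumes "periodic f" "\<not> int p dvd t"
  shows "(\<Sum>x\<in>R. f (t * x)) = (\<Sum>x\<in>R. f x)"
proof (rule sum_reindex_R[OF assms(1)])
  fix x y assume "int p dvd t * x - t * y"
  then have "int p dvd t * (x - y)" by (simp add: algebra_simps)
  then show "int p dvd x - y"
    using assms(2) prime_int_p prime_dvd_mult_iff by blast
qed

lemma ee_add: "ee (x + y) = ee x * ee y"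
  by (simp add: ee_def cis_mult add_divide_distrib distrib_left)

lemma norm_ee [simp]: "norm (ee x) = 1"
  by (simp add: ee_def)

lemma ee_0 [simp]: "ee 0 = 1"
  by (simp add: ee_def)

lemma ee_uminus: "ee (- x) = cnj (ee x)"
  by (simp add: ee_def cis_cnj)

lemma ee_diff: "ee (x - y) = ee x * cnj (ee y)"
  using ee_add[of x "- y"] by (simp add: ee_uminus)

lemma ee_eq_1_iff: "ee x = 1 \<longleftrightarrow> int p dvd x"
  unfolding ee_def using p_pos by (rule cis_eq_1_iff_dvd)

lemma ee_dvd: "int p dvd x - y \<Longrightarrow> ee x = ee y"
  using ee_add[of "x - y" y] ee_eq_1_iff[of "x - y"] by simp

lemma periodic_ee: "periodic (\<lambda>x. ee (h * x))"
  by (rule periodicI) (metis ee_dvd dvd_mult right_diff_distrib)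

lemma sum_ee: "(\<Sum>h\<in>R. ee (h * x)) = (if int p dvd x then of_nat p else 0)"
proof (cases "int p dvd x")
  case True
  then have "ee (h * x) = 1" for h by (simp add: ee_eq_1_iff)
  then show ?thesis using True by simp
next
  case False
  let ?S = "\<Sum>h\<in>R. ee (x * h)"
  have "?S = (\<Sum>h\<in>R. ee (x * (h + 1)))"
    using sum_shift_R[OF periodic_ee, of x 1] by simp
  also have "\<dots> = ee x * ?S"
    by (simp add: distrib_left ee_add sum_distrib_left mult.commute)
  finally have "?S = 0" using False by (simp add: ee_eq_1_iff)
  then show ?thesis using False by (simp add: mult.commute)
qed

lemma parseval:
  fixes F :: "int \<Rightarrow> complex"
  shows "(\<Sum>h\<in>R. (norm (\<Sum>x\<in>R. F x * ee (h * x)))\<^sup>2) = real p * (\<Sum>x\<in>R. (norm (F x))\<^sup>2)"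
proof -
  have "complex_of_real (\<Sum>h\<in>R. (norm (\<Sum>x\<in>R. F x * ee (h * x)))\<^sup>2)
      = (\<Sum>h\<in>R. \<Sum>x\<in>R. \<Sum>y\<in>R. F x * cnj (F y) * ee (h * (x - y)))"
    unfolding of_real_sum complex_norm_square
    by (simp add: sum_product ee_diff right_diff_distrib mult_ac)
  also have "\<dots> = (\<Sum>x\<in>R. \<Sum>y\<in>R. F x * cnj (F y) * (\<Sum>h\<in>R. ee (h * (x - y))))"
    unfolding sum_distrib_left by (subst sum.swap, rule sum.cong[OF refl], rule sum.swap)
  also have "\<dots> = (\<Sum>x\<in>R. \<Sum>y\<in>R. if y = x then of_nat p * (F x * cnj (F x)) else 0)"
    by (intro sum.cong refl) (auto simp: sum_ee R_dvd_diff_iff)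
  also have "\<dots> = (\<Sum>x\<in>R. of_nat p * (F x * cnj (F x)))"
    by (simp add: sum.delta)
  also have "\<dots> = complex_of_real (real p * (\<Sum>x\<in>R. (norm (F x))\<^sup>2))"
    by (simp only: of_real_mult of_real_sum complex_norm_square sum_distrib_left of_real_of_nat_eq)
  finally show ?thesis by (simp only: of_real_eq_iff)
qed

end

text \<open>For the matrix with entries \<open>f i k\<close>, this compares the Frobenius norms of
  its products with its adjoint in the two possible orders; both expand to the same quadruple
  sum.\<close>

lemma norm_sum_duality:
  fixes f :: "'i \<Rightarrow> 'k \<Rightarrow> complex"
  shows "(\<Sum>i\<in>I. \<Sum>j\<in>I. (norm (\<Sum>k\<in>K. f i k * cnj (f j k)))\<^sup>2)
       = (\<Sum>k\<in>K. \<Sum>l\<in>K. (norm (\<Sum>i\<in>I. f i k * cnj (f i l)))\<^sup>2)"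
proof -
  have "complex_of_real (\<Sum>i\<in>I. \<Sum>j\<in>I. (norm (\<Sum>k\<in>K. f i k * cnj (f j k)))\<^sup>2)
      = (\<Sum>i\<in>I. \<Sum>j\<in>I. \<Sum>k\<in>K. \<Sum>l\<in>K. f i k * cnj (f j k) * (cnj (f i l) * f j l))"
    unfolding of_real_sum complex_norm_square by (simp add: sum_product)
  also have "\<dots> = (\<Sum>i\<in>I. \<Sum>k\<in>K. \<Sum>l\<in>K. \<Sum>j\<in>I. f i k * cnj (f j k) * (cnj (f i l) * f j l))"
    by (intro sum.cong refl) (subst sum.swap, intro sum.cong refl, subst sum.swap, rule refl)
  also have "\<dots> = (\<Sum>k\<in>K. \<Sum>l\<in>K. \<Sum>i\<in>I. \<Sum>j\<in>I. f i k * cnj (f j k) * (cnj (f i l) * f j l))"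
    by (subst sum.swap, intro sum.cong refl, subst sum.swap, rule refl)
  also have "\<dots> = complex_of_real (\<Sum>k\<in>K. \<Sum>l\<in>K. (norm (\<Sum>i\<in>I. f i k * cnj (f i l)))\<^sup>2)"
    unfolding of_real_sum complex_norm_square by (simp add: sum_product mult_ac)
  finally show ?thesis by (simp only: of_real_eq_iff)
qed

text \<open>Opening the square separates the variables: the sums over \<open>a\<close> and
  \<open>b\<close> become the kernels \<open>KA n m\<close> and \<open>KB n m\<close>, and 2 x y
  \<le> x^2 + y^2 decouples them. Each factor is left with a mean square of its own, so two
  unrelated characters can be treated one at a time.\<close>

lemma norm_sum_bilinear:
  fixes A :: "'a \<Rightarrow> 'n \<Rightarrow> complex" and B :: "'b \<Rightarrow> 'n \<Rightarrow> complex"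
  shows "(\<Sum>a\<in>I. \<Sum>b\<in>J. (norm (\<Sum>n\<in>K. A a n * B b n))\<^sup>2)
       \<le> ((\<Sum>n\<in>K. \<Sum>m\<in>K. (norm (\<Sum>a\<in>I. A a n * cnj (A a m)))\<^sup>2)
         + (\<Sum>n\<in>K. \<Sum>m\<in>K. (norm (\<Sum>b\<in>J. B b n * cnj (B b m)))\<^sup>2)) / 2" (is "?L \<le> ?U")
proof -
  define KA where "KA n m = (\<Sum>a\<in>I. A a n * cnj (A a m))" for n m
  define KB where "KB n m = (\<Sum>b\<in>J. B b n * cnj (B b m))" for n m
  have "complex_of_real ?L
      = (\<Sum>a\<in>I. \<Sum>b\<in>J. \<Sum>n\<in>K. \<Sum>m\<in>K. (A a n * B b n) * (cnj (A a m) * cnj (B b m)))"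
    unfolding of_real_sum complex_norm_square by (simp add: sum_product)
  also have "\<dots> = (\<Sum>a\<in>I. \<Sum>n\<in>K. \<Sum>m\<in>K. \<Sum>b\<in>J. (A a n * B b n) * (cnj (A a m) * cnj (B b m)))"
    by (intro sum.cong refl) (subst sum.swap, intro sum.cong refl, subst sum.swap, rule refl)
  also have "\<dots> = (\<Sum>n\<in>K. \<Sum>m\<in>K. \<Sum>a\<in>I. \<Sum>b\<in>J. (A a n * B b n) * (cnj (A a m) * cnj (B b m)))"
    by (subst sum.swap, intro sum.cong refl, subst sum.swap, rule refl)
  also have "\<dots> = (\<Sum>n\<in>K. \<Sum>m\<in>K. KA n m * KB n m)"
    by (simp add: KA_def KB_def sum_product mult_ac)
  finally have eq: "complex_of_real ?L = (\<Sum>n\<in>K. \<Sum>m\<in>K. KA n m * KB n m)" .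
  have "?L = norm (complex_of_real ?L)"
    by (subst norm_of_real, rule abs_of_nonneg[symmetric]) (intro sum_nonneg zero_le_power2)
  also have "\<dots> = norm (\<Sum>n\<in>K. \<Sum>m\<in>K. KA n m * KB n m)" by (simp only: eq)
  also have "\<dots> \<le> (\<Sum>n\<in>K. \<Sum>m\<in>K. norm (KA n m) * norm (KB n m))"
    by (rule order_trans[OF norm_sum], rule sum_mono, rule order_trans[OF norm_sum])
       (simp add: norm_mult)
  also have "\<dots> \<le> (\<Sum>n\<in>K. \<Sum>m\<in>K. ((norm (KA n m))\<^sup>2 + (norm (KB n m))\<^sup>2) / 2)"
  proof (intro sum_mono)
    fix n m
    show "norm (KA n m) * norm (KB n m) \<le> ((norm (KA n m))\<^sup>2 + (norm (KB n m))\<^sup>2) / 2"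
      using sum_squares_bound[of "norm (KA n m)" "norm (KB n m)"] by simp
  qed
  also have "\<dots> = ?U"
    by (simp only: KA_def KB_def sum.distrib sum_divide_distrib[symmetric])
  finally show ?thesis .
qed

section \<open>Multiplicative characters and a fourth moment\<close>

context prime_modulus
begin

text \<open>The norm clause does double duty: it forces the extension by zero at multiples of
  \<open>p\<close> and absolute value 1 elsewhere.\<close>

definition mchar :: "(int \<Rightarrow> complex) \<Rightarrow> bool" where
  "mchar \<phi> \<longleftrightarrow> periodic \<phi> \<and> (\<forall>x y. \<phi> (x * y) = \<phi> x * \<phi> y) \<and>
     (\<forall>x. norm (\<phi> x) = (if int p dvd x then 0 else 1))"

definition nontrivial :: "(int \<Rightarrow> complex) \<Rightarrow> bool" where
  "nontrivial \<phi> \<longleftrightarrow> (\<exists>x. \<not> int p dvd x \<and> \<phi> x \<noteq> 1)"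

lemma mchar_periodic: "mchar \<phi> \<Longrightarrow> periodic \<phi>"
  and mchar_mult: "mchar \<phi> \<Longrightarrow> \<phi> (x * y) = \<phi> x * \<phi> y"
  and mchar_norm: "mchar \<phi> \<Longrightarrow> norm (\<phi> x) = (if int p dvd x then 0 else 1)"
  by (auto simp: mchar_def)

lemma mchar_0: "mchar \<phi> \<Longrightarrow> int p dvd x \<Longrightarrow> \<phi> x = 0"
  using mchar_norm[of \<phi> x] by simp

lemma mchar_unit: "mchar \<phi> \<Longrightarrow> \<not> int p dvd x \<Longrightarrow> \<phi> x * cnj (\<phi> x) = 1"
  using mchar_norm[of \<phi> x] by (metis complex_norm_square of_real_1 one_power2)

lemma mchar_dvd: "mchar \<phi> \<Longrightarrow> int p dvd x - y \<Longrightarrow> \<phi> x = \<phi> y"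
  using mchar_periodic periodic_dvd by blast

lemma unit_mult: "\<not> int p dvd s \<Longrightarrow> \<not> int p dvd t \<Longrightarrow> \<not> int p dvd s * t"
  using prime_int_p prime_dvd_mult_iff by blast

lemma sum_mchar:
  assumes "mchar \<phi>" "nontrivial \<phi>"
  shows "(\<Sum>x\<in>R. \<phi> x) = 0"
proof -
  obtain t where t: "\<not> int p dvd t" "\<phi> t \<noteq> 1"
    using assms(2) by (auto simp: nontrivial_def)
  have "(\<Sum>x\<in>R. \<phi> x) = (\<Sum>x\<in>R. \<phi> (t * x))"
    using sum_scale_R[OF mchar_periodic[OF assms(1)] t(1)] by simp
  also have "\<dots> = \<phi> t * (\<Sum>x\<in>R. \<phi> x)"
    by (simp add: mchar_mult[OF assms(1)] sum_distrib_left)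
  finally show ?thesis using t(2) by simp
qed

lemma card_R_nonzero: "card (R - {0}) = p - 1"
  by (simp add: card_Diff_singleton)

lemma sum_mchar_norm: "mchar \<phi> \<Longrightarrow> (\<Sum>x\<in>R. (norm (\<phi> x))\<^sup>2) = real (p - 1)"
proof -
  assume \<phi>: "mchar \<phi>"
  have "(\<Sum>x\<in>R. (norm (\<phi> x))\<^sup>2) = (\<Sum>x\<in>R. if x \<noteq> 0 then 1 else 0)"
    by (intro sum.cong refl) (simp add: mchar_norm[OF \<phi>] R_dvd_iff)
  also have "\<dots> = real (card {x \<in> R. x \<noteq> 0})"
    by (subst sum.inter_filter[symmetric]) auto
  also have "{x \<in> R. x \<noteq> 0} = R - {0}" by auto
  finally show ?thesis by (simp only: card_R_nonzero)
qed

definition corr :: "(int \<Rightarrow> complex) \<Rightarrow> int \<Rightarrow> complex" where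
  "corr \<phi> c = (\<Sum>x\<in>R. \<phi> (x + c) * cnj (\<phi> x))"

lemma periodic_corr_summand: "mchar \<phi> \<Longrightarrow> periodic (\<lambda>x. \<phi> (x + c) * cnj (\<phi> x))"
  by (rule periodicI) (metis mchar_dvd add_diff_cancel_right)

lemma corr_scale:
  assumes "mchar \<phi>" "\<not> int p dvd t"
  shows "corr \<phi> (t * c) = corr \<phi> c"
proof -
  have "corr \<phi> (t * c) = (\<Sum>x\<in>R. \<phi> (t * x + t * c) * cnj (\<phi> (t * x)))"
    unfolding corr_def
    using sum_scale_R[OF periodic_corr_summand[OF assms(1)] assms(2)] by metis
  also have "\<dots> = (\<Sum>x\<in>R. (\<phi> t * cnj (\<phi> t)) * (\<phi> (x + c) * cnj (\<phi> x)))"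
    by (simp add: mchar_mult[OF assms(1)] flip: distrib_left) (simp add: mult_ac)
  finally show ?thesis by (simp add: mchar_unit assms corr_def)
qed

lemma corr_dvd:
  assumes "mchar \<phi>" "int p dvd c"
  shows "corr \<phi> c = of_nat (p - 1)"
proof -
  have "corr \<phi> c = (\<Sum>x\<in>R. \<phi> x * cnj (\<phi> x))"
    unfolding corr_def using assms by (intro sum.cong refl) (metis mchar_dvd add_diff_cancel_left')
  also have "\<dots> = of_real (\<Sum>x\<in>R. (norm (\<phi> x))\<^sup>2)"
    by (simp only: complex_norm_square of_real_sum)
  finally show ?thesis by (simp add: sum_mchar_norm[OF assms(1)])
qed

text \<open>All \<open>corr \<phi> c\<close> with \<open>c\<close> nonzero agree by scaling, and they sum to
  \<open>\<bar>\<Sum> \<phi>\<bar>\<^sup>2 - (p - 1) = - (p - 1)\<close>.\<close>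
lemma corr_not_dvd:
  assumes "mchar \<phi>" "nontrivial \<phi>" "\<not> int p dvd c"
  shows "corr \<phi> c = -1"
proof -
  have one: "corr \<phi> t = corr \<phi> 1" if "\<not> int p dvd t" for t
    using corr_scale[OF assms(1) that, of 1] by simp
  have "(\<Sum>c\<in>R. corr \<phi> c) = (\<Sum>x\<in>R. \<Sum>c\<in>R. \<phi> (c + x) * cnj (\<phi> x))"
    unfolding corr_def by (subst sum.swap) (simp add: add.commute)
  also have "\<dots> = 0"
    by (simp add: sum_shift_R[OF mchar_periodic[OF assms(1)]] sum_mchar[OF assms(1,2)]
        flip: sum_distrib_right)
  finally have "0 = corr \<phi> 0 + (\<Sum>c\<in>R-{0}. corr \<phi> c)"
    by (simp add: sum.remove[of R 0])
  also have "(\<Sum>c\<in>R-{0}. corr \<phi> c) = (\<Sum>c\<in>R-{0}. corr \<phi> 1)"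
    by (intro sum.cong refl one) (auto simp: R_dvd_iff)
  also have "\<dots> = of_nat (p - 1) * corr \<phi> 1" by (simp add: card_R_nonzero)
  also have "corr \<phi> 0 = of_nat (p - 1)" by (simp add: corr_dvd assms(1))
  finally have "of_nat (p - 1) * (1 + corr \<phi> 1) = 0" by (simp add: algebra_simps)
  then have "1 + corr \<phi> 1 = 0" using p_gt_1 by (simp del: of_nat_diff)
  then have "corr \<phi> 1 = -1" by (simp add: add_eq_0_iff)
  then show ?thesis using one[OF assms(3)] by simp
qed

lemma sum_corr_shift:
  assumes "mchar \<phi>"
  shows "(\<Sum>u\<in>R. \<phi> (v + u) * cnj (\<phi> (w + u))) = corr \<phi> (v - w)"
proof -
  have "(\<Sum>u\<in>R. \<phi> (v + u) * cnj (\<phi> (w + u)))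
      = (\<Sum>u\<in>R. (\<lambda>x. \<phi> (x + (v - w)) * cnj (\<phi> x)) (u + w))"
    by (simp add: algebra_simps)
  then show ?thesis
    unfolding corr_def using sum_shift_R[OF periodic_corr_summand[OF assms]] by metis
qed

lemma norm_corr_le:
  assumes "mchar \<phi>" "nontrivial \<phi>"
  shows "(norm (corr \<phi> c))\<^sup>2 \<le> (if int p dvd c then (real p)\<^sup>2 else 1)"
proof (cases "int p dvd c")
  case True
  have "(real (p - 1))\<^sup>2 \<le> (real p)\<^sup>2" by (intro power_mono) auto
  then show ?thesis using True by (simp add: corr_dvd[OF assms(1)] del: of_nat_diff)
qed (simp add: corr_not_dvd[OF assms])

text \<open>Modulo a prime, a vanishing product leaves only \<open>y\<close> and its mirror image
  \<open>- y - s\<close> in the fibre of \<open>y\<close>. The parameter \<open>s\<close> lets one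
  statement cover \<open>a * (a + s)\<close> and, with \<open>- s\<close> in its place,
  \<open>n * (s - n)\<close>.\<close>

lemma card_quadratic_fiber:
  assumes c: "\<And>x y. int p dvd g x - g y \<Longrightarrow> int p dvd (x - y) * (x + y + s)"
  shows "card {x\<in>R. int p dvd g x - v} \<le> 2"
proof (cases "\<exists>y\<in>R. int p dvd g y - v")
  case True
  then obtain y where y: "y \<in> R" "int p dvd g y - v" by auto
  have "{x\<in>R. int p dvd g x - v} \<subseteq> {y, (- y - s) mod int p}"
  proof
    fix x assume "x \<in> {x\<in>R. int p dvd g x - v}"
    then have x: "x \<in> R" "int p dvd g x - v" by auto
    have "int p dvd (g x - v) - (g y - v)" by (rule dvd_diff[OF x(2) y(2)])
    then have "int p dvd (x - y) * (x + y + s)" using c[of x y] by simp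
    then have "int p dvd x - y \<or> int p dvd x + y + s"
      using prime_int_p prime_dvd_mult_iff by blast
    then consider "int p dvd x - y" | "int p dvd x - (- y - s)" by (auto simp: algebra_simps)
    then show "x \<in> {y, (- y - s) mod int p}"
    proof cases
      case 1 then show ?thesis using R_dvd_diff_iff x y by auto
    next
      case 2 then show ?thesis using x mod_R_eq by (auto simp: mod_eq_dvd_iff[symmetric])
    qed
  qed
  then have "card {x\<in>R. int p dvd g x - v} \<le> card {y, (- y - s) mod int p}"
    by (intro card_mono) auto
  also have "\<dots> \<le> 2" by (simp add: card_insert_if)
  finally show ?thesis .
next
  case False
  then have "{x\<in>R. int p dvd g x - v} = {}" by auto
  then show ?thesis by (simp only: card.empty)
qed

lemma sum_quadratic_le:
  fixes f :: "int \<Rightarrow> real"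
  assumes c: "\<And>x y. int p dvd g x - g y \<Longrightarrow> int p dvd (x - y) * (x + y + s)"
    and f: "periodic f" "\<And>x. f x \<ge> 0"
  shows "(\<Sum>x\<in>R. f (g x)) \<le> 2 * (\<Sum>u\<in>R. f u)"
proof -
  have "(\<Sum>x\<in>R. f (g x)) = (\<Sum>x\<in>R. \<Sum>u\<in>R. if u = g x mod int p then f u else 0)"
    using f(1) by (simp add: periodic_def)
  also have "\<dots> = (\<Sum>u\<in>R. \<Sum>x\<in>R. if int p dvd g x - u then f u else 0)"
    by (subst sum.swap, intro sum.cong refl if_cong)
       (metis mod_R_eq mod_eq_dvd_iff)
  also have "\<dots> = (\<Sum>u\<in>R. real (card {x\<in>R. int p dvd g x - u}) * f u)"
    by (simp flip: sum.inter_filter)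
  also have "\<dots> \<le> (\<Sum>u\<in>R. 2 * f u)"
    using card_quadratic_fiber[of g s, OF c] by (intro sum_mono mult_right_mono f) auto
  finally show ?thesis by (simp add: sum_distrib_left)
qed

text \<open>Both \<open>n \<mapsto> n (s - n)\<close> and \<open>a \<mapsto> a (a + s)\<close> are at most two-to-one, and duality turns the
  mean square over \<open>n, m\<close> of the quartic sums into correlations of \<open>\<phi>\<close>.\<close>
lemma quartic_mean_square:
  assumes \<phi>: "mchar \<phi>" "nontrivial \<phi>"
  shows "(\<Sum>n\<in>R. \<Sum>m\<in>R. (norm (\<Sum>a\<in>R. \<phi> ((n + a) * (s - n + a)) *
            cnj (\<phi> ((m + a) * (s - m + a)))))\<^sup>2) \<le> 12 * real p ^ 3"
proof -
  define w where "w a = a * a + s * a" for a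
  define k where "k u v = (norm (\<Sum>a\<in>R. \<phi> (w a + u) * cnj (\<phi> (w a + v))))\<^sup>2" for u v
  define g where "g n = n * (s - n)" for n
  have per: "periodic (\<lambda>u. k u v)" "periodic (\<lambda>v. k u v)" for u v
    unfolding k_def
    by (intro periodicI arg_cong[where f = "\<lambda>z. (norm z)\<^sup>2"] sum.cong refl arg_cong2[where f = "(*)"]
        arg_cong[where f = cnj] mchar_dvd[OF \<phi>(1)]; simp)+
  have g: "int p dvd (x - y) * (x + y + (- s))" if "int p dvd g x - g y" for x y
  proof -
    have "g x - g y = - ((x - y) * (x + y + (- s)))" by (simp add: g_def algebra_simps)
    then show ?thesis using that by (metis dvd_minus_iff)
  qed
  have w: "int p dvd (x - y) * (x + y + s)" if "int p dvd w x - w y" for x y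
  proof -
    have "w x - w y = (x - y) * (x + y + s)" by (simp add: w_def algebra_simps)
    then show ?thesis using that by metis
  qed
  have k0: "k u v \<ge> 0" for u v by (simp add: k_def)
  \<comment> \<open>The variables separate: the argument of \<phi> is a function of \<open>a\<close>
    plus a function of \<open>n\<close>. Hence \<open>g n\<close> and \<open>g m\<close> can be
    replaced by free residues \<open>u\<close> and \<open>v\<close>, at the cost of a factor 2
    each.\<close>
  have fac: "(n + a) * (s - n + a) = w a + g n" for n a
    by (simp add: w_def g_def algebra_simps)
  have "(\<Sum>n\<in>R. \<Sum>m\<in>R. k (g n) (g m)) \<le> (\<Sum>n\<in>R. 2 * (\<Sum>v\<in>R. k (g n) v))"
    by (intro sum_mono sum_quadratic_le[of g "- s"] g per k0)
  also have "\<dots> = 2 * (\<Sum>v\<in>R. \<Sum>n\<in>R. k (g n) v)"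
    unfolding sum_distrib_left[symmetric] by (subst sum.swap) simp
  also have "\<dots> \<le> 2 * (\<Sum>v\<in>R. 2 * (\<Sum>u\<in>R. k u v))"
    by (intro mult_left_mono sum_mono sum_quadratic_le[of g "- s"] g per k0) auto
  also have "\<dots> = 4 * (\<Sum>u\<in>R. \<Sum>v\<in>R. k u v)"
    unfolding sum_distrib_left[symmetric] by (subst sum.swap) simp
  also have "(\<Sum>u\<in>R. \<Sum>v\<in>R. k u v)
      = (\<Sum>a\<in>R. \<Sum>b\<in>R. (norm (\<Sum>u\<in>R. \<phi> (w a + u) * cnj (\<phi> (w b + u))))\<^sup>2)"
    unfolding k_def by (rule norm_sum_duality[of "\<lambda>u a. \<phi> (w a + u)"])
  also have "\<dots> = (\<Sum>a\<in>R. \<Sum>b\<in>R. (norm (corr \<phi> (w a - w b)))\<^sup>2)"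
    by (simp add: sum_corr_shift[OF \<phi>(1)])
  \<comment> \<open>For fixed \<open>a\<close>, at most two \<open>b\<close> have \<open>w b\<close>
    congruent to \<open>w a\<close> and contribute at most \<open>p^2\<close> each; all others
    contribute 1 each, so at most \<open>p^2\<close> in total. With the factor 4 above this makes
    12.\<close>
  also have "\<dots> \<le> (\<Sum>a\<in>R. 3 * (real p)\<^sup>2)"
  proof (intro sum_mono)
    fix a assume "a \<in> R"
    have "(\<Sum>b\<in>R. (norm (corr \<phi> (w a - w b)))\<^sup>2)
        \<le> (\<Sum>b\<in>R. (if int p dvd w b - w a then (real p)\<^sup>2 else 0) + 1)"
    proof (rule sum_mono)
      fix b
      show "(norm (corr \<phi> (w a - w b)))\<^sup>2 \<le> (if int p dvd w b - w a then (real p)\<^sup>2 else 0) + 1"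
        using norm_corr_le[OF \<phi>, of "w a - w b"] dvd_diff_commute[of "int p" "w a" "w b"]
        by (auto split: if_splits intro: add_increasing2)
    qed
    also have "\<dots> = real (card {b\<in>R. int p dvd w b - w a}) * (real p)\<^sup>2 + real p"
      by (simp add: sum.distrib flip: sum.inter_filter)
    also have "\<dots> \<le> 2 * (real p)\<^sup>2 + (real p)\<^sup>2"
    proof (rule add_mono)
      show "real (card {b\<in>R. int p dvd w b - w a}) * (real p)\<^sup>2 \<le> 2 * (real p)\<^sup>2"
        using card_quadratic_fiber[of w s, OF w] by (intro mult_right_mono) auto
      show "real p \<le> (real p)\<^sup>2"
        using p_pos by (simp add: power2_eq_square)
    qed
    finally show "(\<Sum>b\<in>R. (norm (corr \<phi> (w a - w b)))\<^sup>2) \<le> 3 * (real p)\<^sup>2" by simp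
  qed
  finally show ?thesis
    by (simp add: k_def fac power2_eq_square power3_eq_cube mult_ac)
qed

section \<open>Mixed character sums and their fourth moment\<close>

definition mixed :: "(int \<Rightarrow> complex) \<Rightarrow> (int \<Rightarrow> complex) \<Rightarrow> int \<Rightarrow> int \<Rightarrow> int \<Rightarrow> complex" where
  "mixed \<phi> \<psi> a b h = (\<Sum>n\<in>R. \<phi> (n + a) * \<psi> (n + b) * ee (h * n))"

text \<open>Collecting the pairs n, m by their sum \<open>s\<close> turns the square into a Fourier
  transform in \<open>h\<close>, ready for \<open>parseval\<close>; multiplicativity merges the two
  values of each character.\<close>

lemma mixed_sq:
  assumes "mchar \<phi>" "mchar \<psi>"
  shows "(mixed \<phi> \<psi> a b h)\<^sup>2 = (\<Sum>s\<in>R. (\<Sum>n\<in>R. \<phi> ((n + a) * (s - n + a)) * \<psi> ((n + b) * (s - n + b))) * ee (h * s))"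
proof -
  define F where "F n = \<phi> (n + a) * \<psi> (n + b)" for n
  have per: "periodic F"
    unfolding F_def by (intro periodicI arg_cong2[where f = "(*)"] mchar_dvd assms) auto
  have per2: "periodic (\<lambda>m. F m * ee (h * m))"
    using per periodic_ee unfolding periodic_def by metis
  have "(mixed \<phi> \<psi> a b h)\<^sup>2 = (\<Sum>n\<in>R. F n * ee (h * n) * (\<Sum>m\<in>R. F m * ee (h * m)))"
    by (simp add: mixed_def F_def power2_eq_square sum_distrib_right)
  also have "\<dots> = (\<Sum>n\<in>R. F n * ee (h * n) * (\<Sum>s\<in>R. F (s - n) * ee (h * (s - n))))"
    using sum_shift_R[OF per2, of "- _"] by simp
  also have "\<dots> = (\<Sum>n\<in>R. \<Sum>s\<in>R. F n * F (s - n) * ee (h * s))"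
    unfolding sum_distrib_left
    by (intro sum.cong refl) (simp add: algebra_simps flip: ee_add)
  also have "\<dots> = (\<Sum>s\<in>R. (\<Sum>n\<in>R. F n * F (s - n)) * ee (h * s))"
    by (subst sum.swap) (simp add: sum_distrib_right)
  finally show ?thesis
    by (simp add: F_def mchar_mult[OF assms(1)] mchar_mult[OF assms(2)] mult_ac)
qed

text \<open>\<open>parseval\<close> removes \<open>h\<close>, and for each fixed \<open>s\<close>
  the bilinear inequality in \<open>a\<close> and \<open>b\<close> splits \<phi> from \<psi>,
  leaving two instances of \<open>quartic_mean_square\<close>. The order p^5 is what square-root
  cancellation in each of the p^3 sums would give.\<close>

lemma mixed_fourth_moment:
  assumes \<phi>: "mchar \<phi>" "nontrivial \<phi>" and \<psi>: "mchar \<psi>" "nontrivial \<psi>"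
  shows "(\<Sum>a\<in>R. \<Sum>b\<in>R. \<Sum>h\<in>R. (norm (mixed \<phi> \<psi> a b h)) ^ 4) \<le> 12 * real p ^ 5"
proof -
  define V where "V a b s = (norm (\<Sum>n\<in>R. \<phi> ((n + a) * (s - n + a)) * \<psi> ((n + b) * (s - n + b))))\<^sup>2" for a b s
  have "(\<Sum>a\<in>R. \<Sum>b\<in>R. \<Sum>h\<in>R. (norm (mixed \<phi> \<psi> a b h)) ^ 4)
      = (\<Sum>a\<in>R. \<Sum>b\<in>R. \<Sum>h\<in>R. (norm ((mixed \<phi> \<psi> a b h)\<^sup>2))\<^sup>2)"
    by (simp add: norm_power flip: power_mult)
  also have "\<dots> = (\<Sum>a\<in>R. \<Sum>b\<in>R. real p * (\<Sum>s\<in>R. V a b s))"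
    unfolding mixed_sq[OF \<phi>(1) \<psi>(1)] parseval V_def ..
  also have "\<dots> = real p * (\<Sum>a\<in>R. \<Sum>s\<in>R. \<Sum>b\<in>R. V a b s)"
    unfolding sum_distrib_left[symmetric]
    by (rule arg_cong2[where f = "(*)"], rule refl, rule sum.cong[OF refl], rule sum.swap)
  also have "\<dots> = real p * (\<Sum>s\<in>R. \<Sum>a\<in>R. \<Sum>b\<in>R. V a b s)"
    by (rule arg_cong2[where f = "(*)"], rule refl, rule sum.swap)
  also have "\<dots> \<le> real p * (\<Sum>s\<in>R. (12 * real p ^ 3 + 12 * real p ^ 3) / 2)"
    unfolding V_def
    by (intro mult_left_mono sum_mono order_trans[OF norm_sum_bilinear] divide_right_mono
        add_mono quartic_mean_square assms) auto
  also have "\<dots> = 12 * real p ^ 5" by (simp add: numeral_eq_Suc)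
  finally show ?thesis .
qed


text \<open>Substituting \<open>t * n\<close> for \<open>n\<close> moves the dilation from the two
  shifts to the frequency, leaving only the unimodular factor
  \<open>\<phi> t * \<psi> t\<close>.\<close>

lemma mixed_scale:
  assumes "mchar \<phi>" "mchar \<psi>" "\<not> int p dvd t"
  shows "norm (mixed \<phi> \<psi> (t * a) (t * b) h) = norm (mixed \<phi> \<psi> a b (t * h))"
proof -
  let ?F = "\<lambda>n. \<phi> (n + t * a) * \<psi> (n + t * b) * ee (h * n)"
  have "periodic ?F"
    by (intro periodicI arg_cong2[where f = "(*)"] mchar_dvd assms ee_dvd)
       (auto simp flip: right_diff_distrib)
  from sum_scale_R[OF this assms(3)]
  have "mixed \<phi> \<psi> (t * a) (t * b) h = (\<Sum>n\<in>R. \<phi> (t * n + t * a) * \<psi> (t * n + t * b) * ee (h * (t * n)))"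
    by (simp add: mixed_def)
  also have "\<dots> = (\<phi> t * \<psi> t) * mixed \<phi> \<psi> a b (t * h)"
    unfolding mixed_def sum_distrib_left
    by (intro sum.cong refl, simp only: distrib_left[symmetric] mchar_mult[OF assms(1)] mchar_mult[OF assms(2)])
       (simp add: mult_ac)
  finally show ?thesis
    using assms by (simp add: norm_mult mchar_norm)
qed

lemma mixed_shift:
  assumes "mchar \<phi>" "mchar \<psi>"
  shows "norm (mixed \<phi> \<psi> (a + u) (b + u) h) = norm (mixed \<phi> \<psi> a b h)"
proof -
  let ?F = "\<lambda>n. \<phi> (n + a) * \<psi> (n + b) * ee (h * n)"
  have "periodic ?F"
    by (intro periodicI arg_cong2[where f = "(*)"] mchar_dvd assms ee_dvd)
       (auto simp flip: right_diff_distrib)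
  from sum_shift_R[OF this, of u]
  have "mixed \<phi> \<psi> a b h = ee (h * u) * (\<Sum>n\<in>R. \<phi> (n + u + a) * \<psi> (n + u + b) * ee (h * n))"
    by (simp add: mixed_def distrib_left ee_add sum_distrib_left mult_ac)
  then show ?thesis
    by (simp add: norm_mult mixed_def add_ac)
qed

lemma mixed_dvd:
  assumes "mchar \<phi>" "mchar \<psi>" "int p dvd a - a'" "int p dvd b - b'" "int p dvd h - h'"
  shows "mixed \<phi> \<psi> a b h = mixed \<phi> \<psi> a' b' h'"
  unfolding mixed_def
  by (intro sum.cong refl arg_cong2[where f = "(*)"] mchar_dvd assms(1,2) ee_dvd)
     (use assms in \<open>auto simp flip: left_diff_distrib\<close>)

lemma ex_inverse_mod_p: "\<not> int p dvd t \<Longrightarrow> \<exists>u. int p dvd t * u - 1"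
  using cong_solve_coprime_int[of t "int p"] prime_int_p
  by (metis cong_iff_dvd_diff coprime_commute prime_imp_coprime)

text \<open>The affine group acts on the parameters without changing the absolute value; as
  \<open>a \<noteq> b\<close> modulo \<open>p\<close>, each orbit has \<open>p (p - 1)\<close> elements.\<close>
lemma mixed_bound4:
  assumes \<phi>: "mchar \<phi>" "nontrivial \<phi>" and \<psi>: "mchar \<psi>" "nontrivial \<psi>"
    and ab: "\<not> int p dvd a - b"
  shows "(norm (mixed \<phi> \<psi> a b h)) ^ 4 \<le> 24 * real p ^ 3"
proof -
  let ?N = "\<lambda>(a, b, h). (norm (mixed \<phi> \<psi> a b h)) ^ 4"
  obtain r where r: "int p dvd t * r t - 1" if "\<not> int p dvd t" for t
    using ex_inverse_mod_p by metis
  \<comment> \<open>Here \<open>r t\<close> is the inverse of \<open>t\<close> modulo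
    \<open>p\<close>: dilating \<open>a\<close> and \<open>b\<close> by \<open>t\<close> is
    compensated by dividing the frequency by \<open>t\<close>.\<close>
  define g where "g = (\<lambda>(t, u). ((t * a + u) mod int p, (t * b + u) mod int p, (r t * h) mod int p))"
  let ?D = "(R - {0}) \<times> R"
  have inj: "inj_on g ?D"
  proof (rule inj_onI)
    fix x y assume xy: "x \<in> ?D" "y \<in> ?D" "g x = g y"
    obtain t u t' u' where [simp]: "x = (t, u)" "y = (t', u')" by (cases x, cases y) auto
    have 1: "int p dvd (t * a + u) - (t' * a + u')" and 2: "int p dvd (t * b + u) - (t' * b + u')"
      using xy(3) by (simp_all add: g_def mod_eq_dvd_iff)
    \<comment> \<open>Subtracting the two congruences eliminates the translation; since
      \<open>a - b\<close> is a unit, the dilation is then determined.\<close>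
    have "int p dvd ((t * a + u) - (t' * a + u')) - ((t * b + u) - (t' * b + u'))"
      by (rule dvd_diff[OF 1 2])
    also have "((t * a + u) - (t' * a + u')) - ((t * b + u) - (t' * b + u')) = (t - t') * (a - b)"
      by (simp add: algebra_simps)
    finally have "int p dvd t - t'"
      using ab prime_int_p prime_dvd_mult_iff by blast
    then have t: "t = t'" using xy by (simp add: R_dvd_diff_iff)
    then show "x = y" using 1 xy by (simp add: R_dvd_diff_iff)
  qed
  have val: "?N (g x) = (norm (mixed \<phi> \<psi> a b h)) ^ 4" if "x \<in> ?D" for x
  proof -
    obtain t u where [simp]: "x = (t, u)" by (cases x) auto
    have t: "\<not> int p dvd t" using that by (auto simp: R_dvd_iff)
    have "mixed \<phi> \<psi> ((t * a + u) mod int p) ((t * b + u) mod int p) ((r t * h) mod int p)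
        = mixed \<phi> \<psi> (t * a + u) (t * b + u) (r t * h)"
      by (intro mixed_dvd \<phi> \<psi>) (simp_all flip: mod_eq_dvd_iff)
    also have "norm \<dots> = norm (mixed \<phi> \<psi> a b (t * (r t * h)))"
      using mixed_shift[OF \<phi>(1) \<psi>(1), of "t * a" u "t * b"] mixed_scale[OF \<phi>(1) \<psi>(1) t] by simp
    also have "mixed \<phi> \<psi> a b (t * (r t * h)) = mixed \<phi> \<psi> a b h"
    proof (intro mixed_dvd \<phi> \<psi>)
      have "int p dvd (t * r t - 1) * h"
        by (rule dvd_mult2[OF r[OF t]])
      then show "int p dvd t * (r t * h) - h" by (simp add: algebra_simps)
    qed auto
    finally show ?thesis by (simp add: g_def)
  qed
  have "real (p * (p - 1)) * (norm (mixed \<phi> \<psi> a b h)) ^ 4 = (\<Sum>x\<in>?D. ?N (g x))"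
    by (simp add: val card_cartesian_product card_R_nonzero del: of_nat_diff)
  also have "\<dots> = (\<Sum>x\<in>g ` ?D. ?N x)" by (simp only: sum.reindex[OF inj] o_def)
  also have "\<dots> \<le> (\<Sum>x\<in>R \<times> R \<times> R. ?N x)"
    by (intro sum_mono2) (auto simp: g_def)
  also have "\<dots> = (\<Sum>a\<in>R. \<Sum>b\<in>R. \<Sum>h\<in>R. (norm (mixed \<phi> \<psi> a b h)) ^ 4)"
    by (simp add: sum.cartesian_product)
  also have "\<dots> \<le> 12 * real p ^ 5" by (rule mixed_fourth_moment[OF \<phi> \<psi>])
  \<comment> \<open>The constant doubles from 12 to 24 because
    \<open>p \<le> 2 * (p - 1)\<close>.\<close>
  also have "\<dots> \<le> real (p * (p - 1)) * (24 * real p ^ 3)"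
  proof -
    have "real p \<le> 2 * (real p - 1)" using p_gt_1 by simp
    then have "12 * real p ^ 4 * real p \<le> 12 * real p ^ 4 * (2 * (real p - 1))"
      by (intro mult_left_mono) auto
    then show ?thesis using p_pos by (simp add: of_nat_diff numeral_eq_Suc algebra_simps)
  qed
  finally show ?thesis
    using p_gt_1 by (subst (asm) mult_le_cancel_left_pos) auto
qed

lemma mixed_bound:
  assumes "mchar \<phi>" "nontrivial \<phi>" "mchar \<psi>" "nontrivial \<psi>" "\<not> int p dvd a - b"
  shows "norm (mixed \<phi> \<psi> a b h) \<le> 3 * real p powr (3/4)"
proof -
  have "(norm (mixed \<phi> \<psi> a b h)) ^ 4 \<le> 24 * real p ^ 3" by (rule mixed_bound4[OF assms])
  \<comment> \<open>The factor 3 absorbs 24, as 3^4 = 81.\<close>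
  also have "\<dots> \<le> (3 * real p powr (3/4)) ^ 4"
  proof -
    have "(real p powr (3/4)) ^ 4 = real p powr 3"
      using p_pos by (simp add: powr_power)
    also have "\<dots> = real p ^ 3" using p_pos powr_realpow[of "real p" 3] by simp
    finally show ?thesis by (simp add: power_mult_distrib)
  qed
  finally show ?thesis by (subst (asm) power_mono_iff) auto
qed

section \<open>Gauss sums and pairs with one trivial character\<close>

definition gauss :: "(int \<Rightarrow> complex) \<Rightarrow> int \<Rightarrow> complex" where
  "gauss \<phi> h = (\<Sum>n\<in>R. \<phi> n * ee (h * n))"

text \<open>For \<open>h\<close> prime to \<open>p\<close> the absolute value is the same at all
  multiples \<open>t * h\<close>, so \<open>p - 1\<close> times its square is at most the Parseval
  total \<open>(p - 1) * p\<close>. At multiples of \<open>p\<close> the sum vanishes.\<close>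

lemma gauss_bound:
  assumes "mchar \<phi>" "nontrivial \<phi>"
  shows "(norm (gauss \<phi> h))\<^sup>2 \<le> real p"
proof (cases "int p dvd h")
  case True
  then have "ee (h * n) = 1" for n by (simp add: ee_eq_1_iff)
  then show ?thesis using sum_mchar[OF assms] by (simp add: gauss_def)
next
  case False
  have scale: "norm (gauss \<phi> (t * h)) = norm (gauss \<phi> h)" if "\<not> int p dvd t" for t h
  proof -
    have "periodic (\<lambda>n. \<phi> n * ee (h * n))"
      by (intro periodicI arg_cong2[where f = "(*)"] mchar_dvd assms ee_dvd)
         (auto simp flip: right_diff_distrib)
    from sum_scale_R[OF this that]
    have "gauss \<phi> h = \<phi> t * gauss \<phi> (t * h)"
      by (simp add: gauss_def mchar_mult[OF assms(1)] sum_distrib_left mult_ac)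
    then show ?thesis using that by (simp add: norm_mult mchar_norm[OF assms(1)])
  qed
  have "real (p - 1) * (norm (gauss \<phi> h))\<^sup>2 = (\<Sum>t\<in>R-{0}. (norm (gauss \<phi> (t * h)))\<^sup>2)"
    using scale by (simp add: R_dvd_iff card_R_nonzero del: of_nat_diff)
  also have "\<dots> \<le> (\<Sum>t\<in>R. (norm (gauss \<phi> (t * h)))\<^sup>2)"
    by (intro sum_mono2) auto
  also have "\<dots> = (\<Sum>t\<in>R. (norm (gauss \<phi> (h * t)))\<^sup>2)" by (simp add: mult.commute)
  also have "\<dots> = (\<Sum>t\<in>R. (norm (gauss \<phi> t))\<^sup>2)"
  proof (rule sum_scale_R[OF periodicI False])
    fix x y assume "int p dvd x - y"
    then have "gauss \<phi> x = gauss \<phi> y"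
      unfolding gauss_def by (intro sum.cong refl arg_cong2[where f = "(*)"] ee_dvd)
        (auto simp flip: left_diff_distrib)
    then show "(norm (gauss \<phi> x))\<^sup>2 = (norm (gauss \<phi> y))\<^sup>2" by simp
  qed
  also have "\<dots> = real (p - 1) * real p"
    unfolding gauss_def parseval sum_mchar_norm[OF assms(1)] by simp
  finally show ?thesis
    using p_gt_1 by (subst (asm) mult_le_cancel_left_pos) auto
qed

text \<open>The square-root size is weakened to the exponent of \<open>mixed_bound\<close>, so that
  all pairs that are not both trivial share one bound.\<close>

lemma gauss_bound_powr:
  assumes "mchar \<phi>" "nontrivial \<phi>"
  shows "norm (gauss \<phi> h) \<le> real p powr (3/4)"
proof -
  have "norm (gauss \<phi> h) \<le> sqrt (real p)"
    using gauss_bound[OF assms] by (simp add: real_le_rsqrt)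
  also have "\<dots> \<le> real p powr (3/4)"
    using p_gt_1 powr_half_sqrt[of "real p"] powr_mono[of "1/2" "3/4" "real p"] by simp
  finally show ?thesis .
qed

lemma gauss_shift:
  assumes "mchar \<phi>"
  shows "norm (\<Sum>n\<in>R. \<phi> (n + a) * ee (h * n)) = norm (gauss \<phi> h)"
proof -
  have "periodic (\<lambda>n. \<phi> n * ee (h * n))"
    by (intro periodicI arg_cong2[where f = "(*)"] mchar_dvd assms ee_dvd)
       (auto simp flip: right_diff_distrib)
  from sum_shift_R[OF this, of a]
  have "gauss \<phi> h = ee (h * a) * (\<Sum>n\<in>R. \<phi> (n + a) * ee (h * n))"
    by (simp add: gauss_def distrib_left ee_add sum_distrib_left mult_ac)
  then show ?thesis by (simp add: norm_mult)
qed

lemma trivial_mchar: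
  assumes "mchar \<phi>" "\<not> nontrivial \<phi>"
  shows "\<phi> x = (if int p dvd x then 0 else 1)"
  using assms by (auto simp: nontrivial_def mchar_0)

text \<open>A trivial factor only removes one term from a Gauss sum.\<close>
lemma half_trivial_bound:
  assumes \<phi>: "mchar \<phi>" "nontrivial \<phi>" and \<psi>: "mchar \<psi>" "\<not> nontrivial \<psi>"
  shows "norm (\<Sum>n\<in>R. \<phi> (n + a) * \<psi> (n + b) * ee (h * n)) \<le> 3 * real p powr (3/4)"
proof -
  let ?r = "(- b) mod int p"
  have zero: "\<psi> (n + b) = (if n = ?r then 0 else 1)" if "n \<in> R" for n
    using trivial_mchar[OF \<psi>] R_dvd_diff_iff[OF that mod_in_R, of "- b"]
    by (metis diff_minus_eq_add dvd_minus_mod mod_eq_dvd_iff mod_mod_trivial)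
  have "(\<Sum>n\<in>R. \<phi> (n + a) * ee (h * n))
      = \<phi> (?r + a) * ee (h * ?r) + (\<Sum>n\<in>R-{?r}. \<phi> (n + a) * ee (h * n))"
    by (rule sum.remove) auto
  also have "(\<Sum>n\<in>R-{?r}. \<phi> (n + a) * ee (h * n)) = (\<Sum>n\<in>R. \<phi> (n + a) * \<psi> (n + b) * ee (h * n))"
    by (rule sum.mono_neutral_cong_left) (auto simp: zero)
  finally have eq: "(\<Sum>n\<in>R. \<phi> (n + a) * \<psi> (n + b) * ee (h * n))
     = (\<Sum>n\<in>R. \<phi> (n + a) * ee (h * n)) - \<phi> (?r + a) * ee (h * ?r)" by simp
  have "norm (\<Sum>n\<in>R. \<phi> (n + a) * \<psi> (n + b) * ee (h * n))
      \<le> norm (gauss \<phi> h) + norm (\<phi> (?r + a) * ee (h * ?r))"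
    unfolding eq gauss_shift[OF \<phi>(1), of a h, symmetric] by (rule norm_triangle_ineq4)
  also have "\<dots> \<le> real p powr (3/4) + 1"
    using gauss_bound_powr[OF \<phi>] by (intro add_mono) (auto simp: norm_mult mchar_norm[OF \<phi>(1)])
  also have "\<dots> \<le> 3 * real p powr (3/4)"
    using ge_one_powr_ge_zero[of "real p" "3/4"] p_gt_1 by simp
  finally show ?thesis .
qed

lemma mixed_bound_general:
  assumes \<phi>: "mchar \<phi>" and \<psi>: "mchar \<psi>" and nt: "nontrivial \<phi> \<or> nontrivial \<psi>"
    and ab: "\<not> int p dvd a - b"
  shows "norm (mixed \<phi> \<psi> a b h) \<le> 3 * real p powr (3/4)"
proof (cases "nontrivial \<phi> \<and> nontrivial \<psi>")
  case True
  then show ?thesis using mixed_bound[OF \<phi> _ \<psi> _ ab] by simp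
next
  case False
  then consider "nontrivial \<phi>" "\<not> nontrivial \<psi>" | "nontrivial \<psi>" "\<not> nontrivial \<phi>"
    using nt by auto
  then show ?thesis
  proof cases
    case 1 then show ?thesis using half_trivial_bound[OF \<phi> _ \<psi>] by (simp add: mixed_def)
  next
    case 2
    then show ?thesis using half_trivial_bound[OF \<psi> _ \<phi>, of b a h]
      by (simp add: mixed_def mult.commute[of "\<phi> _"])
  qed
qed

end

section \<open>Incomplete sums by completion\<close>

text \<open>A weak form of Jordan's inequality: \<open>sin x\<close> is 2 sin(x/2) cos(x/2), where
  sin(x/2) is at least (x/2) cos(x/2) by the tangent bound, and cos(x/2)^2 is at least 1/2 on this
  range.\<close>

lemma sin_ge_half: "sin x \<ge> x / 2" if "0 \<le> x" "x \<le> pi / 2" for x :: real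
proof -
  have "x / 2 * cos (x / 2) \<le> sin (x / 2)"
  proof -
    have c: "cos (x / 2) > 0" using that pi_gt_zero by (intro cos_gt_zero_pi) linarith+
    have "x / 2 \<le> tan (x / 2)"
      using abs_tan_ge[of "x / 2"] tan_pos_pi2_le[of "x / 2"] that pi_gt_zero by simp
    then show ?thesis using c by (simp add: tan_def field_simps)
  qed
  moreover have "cos (x / 2) ^ 2 \<ge> 1 / 2"
    using cos_double_cos[of "x / 2"] cos_ge_zero[of x] that by simp
  moreover have "sin x = 2 * sin (x / 2) * cos (x / 2)"
    using sin_double[of "x / 2"] by simp
  moreover have "cos (x / 2) \<ge> 0" using that by (intro cos_ge_zero) auto
  ultimately have "sin x \<ge> 2 * (x / 2 * cos (x / 2)) * cos (x / 2)"
    by (metis mult_left_mono mult_right_mono zero_le_numeral)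
  also have "2 * (x / 2 * cos (x / 2)) * cos (x / 2) = x * cos (x / 2) ^ 2"
    by (simp add: power2_eq_square)
  finally show ?thesis
    using mult_left_mono[OF \<open>cos (x / 2) ^ 2 \<ge> 1 / 2\<close> that(1)] by linarith
qed

context prime_modulus
begin

text \<open>The minimum is the distance from \<open>h\<close> to the nearest multiple of
  \<open>p\<close>. The left side is 2 |sin(pi h / p)|, so the sine bound applies directly or after
  reflection at pi/2, and pi \<ge> 2 clears the constant.\<close>

lemma norm_one_minus_ee:
  assumes "0 < h" "h < int p"
  shows "norm (ee h - 1) \<ge> 2 * of_int (min h (int p - h)) / real p"
proof -
  let ?x = "pi * of_int h / real p"
  let ?m = "min h (int p - h)"
  have p: "real p > 0" using p_pos by simp
  have h: "real_of_int h < real p" using assms(2) by linarith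
  have half: "pi * r / real p / 2 \<ge> r / real p" if "r \<ge> 0" for r
    using mult_right_mono[of 2 pi r] pi_gt3 that p by (simp add: field_simps)
  have "norm (ee h - 1) = 2 * \<bar>sin ?x\<bar>"
    using dist_exp_i_1[of "2 * ?x"] by (simp add: ee_def cis_conv_exp mult_ac)
  moreover have "\<bar>sin ?x\<bar> \<ge> of_int ?m / real p"
  proof (cases "2 * h \<le> int p")
    case True
    then have m: "?m = h" by simp
    have "real_of_int (2 * h) \<le> real p" using True by linarith
    then have "?x \<le> pi / 2" using p pi_gt_zero by (simp add: field_simps)
    then have "sin ?x \<ge> ?x / 2" using assms p by (intro sin_ge_half) auto
    moreover have "?x / 2 \<ge> of_int h / real p"
      using half[of "of_int h"] assms(1) by simp
    ultimately show ?thesis using m by linarith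
  next
    case False
    then have m: "?m = int p - h" by simp
    let ?y = "pi * of_int (int p - h) / real p"
    have "sin ?x = sin ?y"
      using sin_pi_minus[of ?x] p by (simp add: field_simps)
    have "real p \<le> real_of_int (2 * h)" using False by linarith
    then have "?y \<le> pi / 2" using p pi_gt_zero by (simp add: field_simps)
    then have "sin ?y \<ge> ?y / 2" using assms p h by (intro sin_ge_half) auto
    moreover have "?y / 2 \<ge> of_int (int p - h) / real p"
      using half[of "of_int (int p - h)"] assms(2) by simp
    ultimately have "of_int (int p - h) / real p \<le> sin ?x"
      using \<open>sin ?x = sin ?y\<close> by linarith
    then show ?thesis using m by simp
  qed
  ultimately show "norm (ee h - 1) \<ge> 2 * of_int ?m / real p" by (simp add: field_simps)
qed


lemma norm_sum_ee_le:
  assumes "0 < h" "h < int p"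
  shows "norm (\<Sum>m<M. ee (h * int m)) \<le> real p * (1 / of_int h + 1 / of_int (int p - h))"
proof -
  have pow: "ee (h * int m) = ee h ^ m" for m
    by (induction m) (simp_all add: distrib_left ee_add)
  define r where "r = real_of_int (min h (int p - h))"
  have r: "r > 0" "2 * r / real p \<le> norm (ee h - 1)"
    using assms norm_one_minus_ee[OF assms] by (auto simp: r_def)
  have "0 < 2 * r / real p" using r p_pos by simp
  then have ne: "norm (ee h - 1) > 0" using r(2) by linarith
  then have "ee h \<noteq> 1" by auto
  then have "norm (\<Sum>m<M. ee (h * int m)) = norm (ee h ^ M - 1) / norm (ee h - 1)"
    by (simp add: pow geometric_sum norm_divide)
  also have "\<dots> \<le> 2 / norm (ee h - 1)"
    using norm_triangle_ineq4[of "ee h ^ M" 1] ne by (intro divide_right_mono) (auto simp: norm_power)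
  also have "\<dots> \<le> 2 / (2 * r / real p)"
    using r p_pos by (intro divide_left_mono mult_pos_pos ne) auto
  also have "\<dots> = real p * (1 / r)" using r p_pos by simp
  \<comment> \<open>Bounding the reciprocal of the minimum by the sum of both reciprocals avoids
    splitting the range of \<open>h\<close> at p/2 later.\<close>
  also have "1 / r \<le> 1 / of_int h + 1 / of_int (int p - h)"
    using assms by (auto simp: r_def min_def)
  finally show ?thesis by (simp add: mult_left_mono)
qed

lemma harm_le_ln: "n > 0 \<Longrightarrow> harm n \<le> 1 + ln (real n)"
  using decseqD[OF decseq_harm_diff_ln, of 0 "n - 1"] by (simp add: harm_def)

text \<open>This is the L1 norm of the Dirichlet kernel modulo \<open>p\<close>: frequency 0
  contributes \<open>M\<close>, at most \<open>p\<close>, and the remaining frequencies two harmonic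
  sums.\<close>

lemma sum_norm_kernel_le:
  assumes "M \<le> p"
  shows "(\<Sum>h\<in>R. norm (\<Sum>m<M. ee (h * int m))) \<le> real p * (3 + 2 * ln (real p))"
proof -
  have R0: "R - {0} = int ` {1..<p}"
  proof (intro equalityI subsetI)
    fix x assume "x \<in> R - {0}"
    then show "x \<in> int ` {1..<p}" by (intro image_eqI[of _ _ "nat x"]) (auto simp: R_def)
  qed (auto simp: R_def)
  have "(\<Sum>k\<in>{1..<p}. 1 / real k) \<le> harm p"
    unfolding harm_def inverse_eq_divide by (rule sum_mono2) auto
  then have H: "(\<Sum>k\<in>{1..<p}. 1 / real k) \<le> 1 + ln (real p)"
    using harm_le_ln[OF p_pos] by linarith
  have "(\<Sum>h\<in>R. norm (\<Sum>m<M. ee (h * int m)))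
      = real M + (\<Sum>h\<in>R-{0}. norm (\<Sum>m<M. ee (h * int m)))"
    by (simp add: sum.remove[of R 0])
  also have "\<dots> \<le> real p + (\<Sum>h\<in>R-{0}. real p * (1 / of_int h + 1 / of_int (int p - h)))"
    using assms by (intro add_mono sum_mono norm_sum_ee_le) (auto simp: R_def)
  also have "(\<Sum>h\<in>R-{0}. real p * (1 / of_int h + 1 / of_int (int p - h)))
      = real p * ((\<Sum>k\<in>{1..<p}. 1 / real k) + (\<Sum>k\<in>{1..<p}. 1 / real (p - k)))"
    unfolding R0 by (subst sum.reindex) (auto simp: sum_distrib_left sum.distrib of_nat_diff distrib_left intro!: sum.cong)
  also have "(\<Sum>k\<in>{1..<p}. 1 / real (p - k)) = (\<Sum>k\<in>{1..<p}. 1 / real k)"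
    by (rule sum.reindex_bij_witness[of _ "\<lambda>k. p - k" "\<lambda>k. p - k"]) auto
  also have "real p + real p * ((\<Sum>k\<in>{1..<p}. 1 / real k) + (\<Sum>k\<in>{1..<p}. 1 / real k))
      \<le> real p + real p * ((1 + ln (real p)) + (1 + ln (real p)))"
    using H by (intro add_mono mult_left_mono) auto
  also have "\<dots> = real p * (3 + 2 * ln (real p))" by (simp add: algebra_simps)
  finally show ?thesis .
qed

text \<open>Fourier inversion expresses \<open>F\<close> on the progression through its complete
  sums, each at most \<open>B\<close>, weighted by a geometric sum. As \<open>q\<close> is a unit,
  multiplying the frequencies by \<open>- q\<close> only permutes them, so the step of the
  progression leaves no trace in the bound.\<close>

lemma completion_bound:
  assumes F: "periodic F" and B: "\<And>h. norm (\<Sum>x\<in>R. F x * ee (h * x)) \<le> B"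
    and q: "\<not> int p dvd q" and M: "M \<le> p"
  shows "norm (\<Sum>m<M. F (c + q * int m)) \<le> B * (3 + 2 * ln (real p))"
proof -
  have B0: "B \<ge> 0" using B[of 0] norm_ge_zero by (rule order_trans[rotated])
  have inv: "of_nat p * F y = (\<Sum>h\<in>R. (\<Sum>x\<in>R. F x * ee (h * x)) * ee (h * (- y)))" for y
  proof -
    have "(\<Sum>h\<in>R. (\<Sum>x\<in>R. F x * ee (h * x)) * ee (h * (- y)))
        = (\<Sum>h\<in>R. \<Sum>x\<in>R. F x * ee (h * (x - y)))"
      unfolding sum_distrib_right
      by (intro sum.cong refl) (simp add: right_diff_distrib mult.assoc ee_diff ee_uminus)
    also have "\<dots> = (\<Sum>x\<in>R. F x * (\<Sum>h\<in>R. ee (h * (x - y))))"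
      by (subst sum.swap) (simp add: sum_distrib_left)
    also have "\<dots> = (\<Sum>x\<in>R. if x = y mod int p then F x * of_nat p else 0)"
      by (intro sum.cong refl) (simp add: sum_ee mod_R_eq flip: mod_eq_dvd_iff)
    also have "\<dots> = F (y mod int p) * of_nat p" by simp
    finally show ?thesis using F by (simp add: periodic_def mult.commute)
  qed
  let ?F = "\<lambda>h. \<Sum>x\<in>R. F x * ee (h * x)"
  have "of_nat p * (\<Sum>m<M. F (c + q * int m)) = (\<Sum>m<M. \<Sum>h\<in>R. ?F h * ee (h * - (c + q * int m)))"
    by (simp only: sum_distrib_left inv)
  also have "\<dots> = (\<Sum>h\<in>R. ?F h * (ee (- (h * c)) * (\<Sum>m<M. ee ((- q * h) * int m))))"
  proof -
    have "ee (h * - (c + q * int m)) = ee (- (h * c)) * ee (- q * h * int m)" for h m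
      unfolding ee_add[symmetric] by (simp add: algebra_simps)
    then show ?thesis by (subst sum.swap) (simp only: sum_distrib_left)
  qed
  finally have "norm (of_nat p * (\<Sum>m<M. F (c + q * int m)))
      = norm (\<Sum>h\<in>R. ?F h * (ee (- (h * c)) * (\<Sum>m<M. ee ((- q * h) * int m))))"
    by (rule arg_cong)
  then have "real p * norm (\<Sum>m<M. F (c + q * int m))
      = norm (\<Sum>h\<in>R. ?F h * (ee (- (h * c)) * (\<Sum>m<M. ee ((- q * h) * int m))))"
    unfolding norm_mult norm_of_nat .
  also have "\<dots> \<le> (\<Sum>h\<in>R. B * norm (\<Sum>m<M. ee ((- q * h) * int m)))"
    by (rule order_trans[OF norm_sum]) (auto simp: norm_mult intro!: sum_mono mult_right_mono B)
  also have "\<dots> = B * (\<Sum>h\<in>R. norm (\<Sum>m<M. ee (h * int m)))"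
  proof -
    have "periodic (\<lambda>h. norm (\<Sum>m<M. ee (h * int m)))"
      by (intro periodicI arg_cong[where f = norm] sum.cong refl ee_dvd)
         (auto simp flip: left_diff_distrib)
    moreover have "\<not> int p dvd - q" using q by simp
    ultimately have "(\<Sum>h\<in>R. norm (\<Sum>m<M. ee (- q * h * int m))) = (\<Sum>h\<in>R. norm (\<Sum>m<M. ee (h * int m)))"
      by (rule sum_scale_R)
    then show ?thesis by (simp only: sum_distrib_left[symmetric])
  qed
  also have "\<dots> \<le> B * (real p * (3 + 2 * ln (real p)))"
    by (intro mult_left_mono sum_norm_kernel_le M B0)
  finally have "real p * norm (\<Sum>m<M. F (c + q * int m)) \<le> real p * (B * (3 + 2 * ln (real p)))"
    by (simp add: mult_ac)
  then show ?thesis using p_pos by simp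
qed

text \<open>The condition \<open>q < p\<close> makes the step invertible modulo \<open>p\<close>, as
  completion requires. The number \<open>c\<close> is arbitrary, because the progression is empty
  unless \<open>c\<close> lies below both \<open>q\<close> and \<open>p\<close>.\<close>

lemma progression_sum_bound:
  assumes \<phi>: "mchar \<phi>" and \<psi>: "mchar \<psi>" and nt: "nontrivial \<phi> \<or> nontrivial \<psi>"
    and ab: "\<not> int p dvd a - b" and q: "q > 0" "q < p"
  shows "norm (\<Sum>n\<in>{n\<in>{0..<p}. n mod q = c}. \<phi> (int n + a) * \<psi> (int n + b))
       \<le> 3 * real p powr (3/4) * (3 + 2 * ln (real p))"
proof (cases "c < q \<and> c < p")
  case False
  have "n mod q \<noteq> c" if "n < p" for n
  proof
    assume c: "n mod q = c"
    then have "c < q" using mod_less_divisor[OF q(1), of n] by simp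
    moreover have "c \<le> n" using mod_less_eq_dividend[of n q] c by simp
    ultimately show False using False that by simp
  qed
  then have "{n\<in>{0..<p}. n mod q = c} = {}" by auto
  moreover have "0 \<le> ln (real p)" using p_gt_1 by simp
  ultimately show ?thesis by (simp only: sum.empty norm_zero) (intro mult_nonneg_nonneg add_nonneg_nonneg; simp)
next
  case True
  \<comment> \<open>The ceiling of \<open>(p - c) / q\<close>, which counts the terms c, c + q, c +
    2q, ... below \<open>p\<close>.\<close>
  define M where "M = (p - c + q - 1) div q"
  let ?F = "\<lambda>n. \<phi> (n + a) * \<psi> (n + b)"
  have lt: "m < M \<longleftrightarrow> c + q * m < p" for m
  proof -
    have "m < M \<longleftrightarrow> Suc m * q \<le> p - c + q - 1"
      unfolding M_def Suc_le_eq[symmetric] using q by (simp only: less_eq_div_iff_mult_less_eq)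
    also have "\<dots> \<longleftrightarrow> q * m + q \<le> p - c + q - 1" by (simp add: algebra_simps)
    also have "\<dots> \<longleftrightarrow> c + q * m < p" using True q by (intro iffI) linarith+
    finally show ?thesis .
  qed
  have "{n\<in>{0..<p}. n mod q = c} = (\<lambda>m. c + q * m) ` {..<M}"
  proof (intro equalityI subsetI)
    fix n assume n: "n \<in> {n\<in>{0..<p}. n mod q = c}"
    then have eq: "c + q * (n div q) = n" using mod_mult_div_eq[of n q] by simp
    then have "n div q < M" using n lt[of "n div q"] by simp
    then show "n \<in> (\<lambda>m. c + q * m) ` {..<M}"
      using eq by (intro image_eqI[of _ _ "n div q"]) auto
  next
    fix n assume "n \<in> (\<lambda>m. c + q * m) ` {..<M}"
    then obtain m where "n = c + q * m" "m < M" by auto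
    then show "n \<in> {n\<in>{0..<p}. n mod q = c}" using True lt[of m] by simp
  qed
  moreover have "inj_on (\<lambda>m. c + q * m) {..<M}" using q by (auto simp: inj_on_def)
  ultimately have "(\<Sum>n\<in>{n\<in>{0..<p}. n mod q = c}. ?F (int n)) = (\<Sum>m<M. ?F (int c + int q * int m))"
    by (simp add: sum.reindex)
  also have "norm \<dots> \<le> 3 * real p powr (3/4) * (3 + 2 * ln (real p))"
  proof (rule completion_bound[of ?F "3 * real p powr (3/4)" "int q" M "int c"])
    show "periodic ?F"
      by (intro periodicI arg_cong2[where f = "(*)"] mchar_dvd \<phi> \<psi>) auto
    show "norm (\<Sum>x\<in>R. ?F x * ee (h * x)) \<le> 3 * real p powr (3/4)" for h
      using mixed_bound_general[OF \<phi> \<psi> nt ab] by (simp add: mixed_def)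
    show "\<not> int p dvd int q" using q by (auto dest: dvd_imp_le)
    show "M \<le> p"
    proof (rule ccontr)
      assume "\<not> M \<le> p"
      then have "c + q * p < p" using lt[of p] by auto
      moreover have "p \<le> q * p" using q by simp
      ultimately show False by linarith
    qed
  qed
  finally show ?thesis .
qed

end

section \<open>Detecting primitive roots\<close>

lemma prod_primes_dvd_iff:
  fixes n :: "'a::factorial_semiring_gcd"
  assumes "finite T" "\<And>q. q \<in> T \<Longrightarrow> prime q"
  shows "\<Prod>T dvd n \<longleftrightarrow> (\<forall>q\<in>T. q dvd n)"
  using assms
proof (induction T)
  case (insert q T)
  have "coprime q (\<Prod>T)"
    using insert by (intro prod_coprime_right) (metis insertCI primes_coprime)
  then have "q * \<Prod>T dvd n \<longleftrightarrow> q dvd n \<and> \<Prod>T dvd n"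
    by (meson divides_mult dvd_mult_left dvd_mult_right)
  then show ?case using insert by simp
qed simp

text \<open>The single inclusion-exclusion behind the indicator of primitive roots, the totient
  ratio, the indicator of power-free pairs and the Euler product.\<close>

lemma prod_diff_subsets:
  fixes f :: "'a \<Rightarrow> 'b::comm_ring_1"
  assumes "finite A"
  shows "(\<Prod>x\<in>A. 1 - f x) = (\<Sum>T\<in>Pow A. (-1) ^ card T * (\<Prod>x\<in>T. f x))"
  using prod_diff_conv_sum[OF assms, of "\<lambda>_. 1" f] by simp

lemma sum_cis_multiples:
  assumes "d > 0"
  shows "(\<Sum>j<d. cis (2 * pi * real j * real k / real d)) = (if d dvd k then of_nat d else 0)"
proof -
  let ?z = "cis (2 * pi * real k / real d)"
  have one: "?z = 1 \<longleftrightarrow> d dvd k"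
    using cis_eq_1_iff_dvd[OF assms, of "int k"] by simp
  have "cis (2 * pi * real j * real k / real d) = ?z ^ j" for j
    by (subst Complex.DeMoivre) (simp add: mult_ac)
  then have S: "(\<Sum>j<d. cis (2 * pi * real j * real k / real d)) = (\<Sum>j<d. ?z ^ j)" by simp
  have "?z ^ d = cis (2 * pi * of_int (int k) / of_nat 1)"
    using assms by (simp add: Complex.DeMoivre)
  also have "\<dots> = 1" by (subst cis_eq_1_iff_dvd) auto
  finally have "?z ^ d = 1" .
  show ?thesis
  proof (cases "d dvd k")
    case True
    then have "?z = 1" using one by simp
    then show ?thesis unfolding S using True by (simp only: power_one sum_constant) simp
  next
    case False
    then show ?thesis unfolding S using one \<open>?z ^ d = 1\<close> by (simp add: geometric_sum)
  qed
qed

lemma cis_cong: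
  assumes "d > 0" "[k = l] (mod d)"
  shows "cis (2 * pi * real j * real k / real d) = cis (2 * pi * real j * real l / real d)"
proof -
  have "int d dvd int j * (int k - int l)"
    using assms(2) by (simp add: cong_iff_dvd_diff flip: cong_int_iff)
  then have "cis (2 * pi * of_int (int j * (int k - int l)) / of_nat d) = 1"
    by (subst cis_eq_1_iff_dvd) (use assms in auto)
  moreover have "2 * pi * real j * real k / real d
      = 2 * pi * of_int (int j * (int k - int l)) / of_nat d + 2 * pi * real j * real l / real d"
    using assms(1) by (simp add: field_simps)
  ultimately show ?thesis by (metis cis_mult mult_1)
qed

context prime_modulus
begin

section \<open>Discrete logarithms and power residue characters\<close>

definition gen :: nat where "gen = (SOME g. residue_primroot p g)"

text \<open>The choice is determined only modulo \<open>p - 1\<close>, so everything about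
  \<open>ind\<close> is stated as a congruence, and only its residue modulo divisors of
  \<open>p - 1\<close> carries meaning.\<close>

definition ind :: "int \<Rightarrow> nat" where "ind x = (SOME k. [int gen ^ k = x] (mod int p))"

lemma gen: "residue_primroot p gen"
  unfolding gen_def by (rule someI_ex) (rule prime_primitive_root_exists[OF p_gt_1 prime_p])

lemma coprime_gen: "coprime p gen" and ord_gen: "ord p gen = p - 1"
  using gen prime_p by (auto simp: residue_primroot_def totient_prime)

lemma ind_cong:
  assumes "\<not> int p dvd x"
  shows "[int gen ^ ind x = x] (mod int p)"
proof -
  let ?y = "nat (x mod int p)"
  have y: "int ?y = x mod int p" using p_pos by simp
  have "\<not> p dvd ?y" using assms y by (metis int_dvd_int_iff dvd_mod_iff dvd_refl)
  moreover from this have "?y > 0" by (metis dvd_0_right gr0I)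
  moreover have "?y < p" using p_pos by (simp add: nat_less_iff)
  ultimately have "?y \<in> totatives p"
    using prime_p by (simp add: totatives_def prime_imp_coprime coprime_commute)
  then obtain k where "?y = gen ^ k mod p"
    using residue_primroot_is_generator[OF p_gt_1 gen] by (auto simp: bij_betw_def)
  then have "x mod int p = int (gen ^ k mod p)" using y by simp
  then have "[int gen ^ k = x] (mod int p)" by (simp add: cong_def zmod_int)
  then show ?thesis unfolding ind_def by (rule someI)
qed

lemma gen_power_cong_iff: "[int gen ^ k = int gen ^ l] (mod int p) \<longleftrightarrow> [k = l] (mod (p - 1))"
  using order_divides_expdiff[OF coprime_gen, of k l] by (simp add: ord_gen flip: cong_int_iff)

lemma ind_unique:
  assumes "\<not> int p dvd x" "[int gen ^ k = x] (mod int p)"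
  shows "[ind x = k] (mod (p - 1))"
  using ind_cong[OF assms(1)] assms(2) gen_power_cong_iff by (meson cong_sym cong_trans)

lemma ind_mult:
  assumes "\<not> int p dvd x" "\<not> int p dvd y"
  shows "[ind (x * y) = ind x + ind y] (mod (p - 1))"
  by (rule ind_unique[OF unit_mult[OF assms]])
     (simp add: power_add cong_mult ind_cong assms)

lemma ind_dvd_diff:
  assumes "\<not> int p dvd x" "int p dvd x - y"
  shows "[ind x = ind y] (mod (p - 1))"
proof (rule ind_unique[OF assms(1)])
  have xy: "[x = y] (mod int p)" using assms(2) by (simp add: cong_iff_dvd_diff)
  then have "\<not> int p dvd y" using assms(1) cong_dvd_iff by blast
  then show "[int gen ^ ind y = x] (mod int p)"
    using ind_cong xy cong_sym cong_trans by blast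
qed

text \<open>For \<open>d\<close> dividing \<open>p - 1\<close>, these are the characters whose
  \<open>d\<close>-th power is trivial, read off from the discrete logarithm; \<open>j = 0\<close>
  is the trivial one.\<close>

definition power_char :: "nat \<Rightarrow> nat \<Rightarrow> int \<Rightarrow> complex" where
  "power_char d j x = (if int p dvd x then 0 else cis (2 * pi * real j * real (ind x) / real d))"

lemma divisor_pos: "d dvd p - 1 \<Longrightarrow> d > 0"
  using p_gt_1 by (auto intro!: Nat.gr0I)

lemma mchar_power_char:
  assumes d: "d dvd p - 1"
  shows "mchar (power_char d j)"
  unfolding mchar_def
proof (intro conjI allI)
  show "periodic (power_char d j)"
  proof (rule periodicI)
    fix x y assume xy: "int p dvd x - y"
    then have "int p dvd x \<longleftrightarrow> int p dvd y" by (metis cong_dvd_iff cong_iff_dvd_diff)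
    then show "power_char d j x = power_char d j y"
      using cis_cong[OF divisor_pos[OF d]] cong_dvd_modulus_nat[OF ind_dvd_diff[OF _ xy] d]
      by (simp add: power_char_def)
  qed
  show "power_char d j (x * y) = power_char d j x * power_char d j y" for x y
  proof (cases "int p dvd x \<or> int p dvd y")
    case False
    then have "[ind (x * y) = ind x + ind y] (mod d)"
      using cong_dvd_modulus_nat[OF ind_mult d] by simp
    from cis_cong[OF divisor_pos[OF d] this, of j] show ?thesis
      using False unit_mult by (simp add: power_char_def cis_mult distrib_left add_divide_distrib)
  qed (auto simp: power_char_def)
qed (simp add: power_char_def)

text \<open>The generator is the witness: its discrete logarithm is 1, so the value there is a root
  of unity with exponent \<open>j / d\<close> strictly between 0 and 1.\<close>

lemma nontrivial_power_char:
  assumes d: "d dvd p - 1" and j: "0 < j" "j < d"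
  shows "nontrivial (power_char d j)"
proof -
  have g: "\<not> int p dvd int gen"
    using coprime_gen prime_p by (metis coprime_absorb_left int_dvd_int_iff not_prime_unit)
  have "[ind (int gen) = 1] (mod (p - 1))" by (rule ind_unique[OF g]) simp
  from cis_cong[OF divisor_pos[OF d] cong_dvd_modulus_nat[OF this d], of j]
  have "power_char d j (int gen) = cis (2 * pi * of_int (int j) / of_nat d)"
    using g by (simp add: power_char_def)
  also have "\<dots> \<noteq> 1"
    using j by (subst cis_eq_1_iff_dvd) (auto dest: nat_dvd_not_less)
  finally show ?thesis using g unfolding nontrivial_def by blast
qed

lemma power_char_0: "power_char d 0 x = (if int p dvd x then 0 else 1)"
  by (simp add: power_char_def)

text \<open>For \<open>d\<close> dividing \<open>p - 1\<close>, this is the indicator of the nonzero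
  \<open>d\<close>-th powers modulo \<open>p\<close>.\<close>

definition power_residue :: "nat \<Rightarrow> int \<Rightarrow> real" where
  "power_residue d x = of_bool (\<not> int p dvd x \<and> d dvd ind x)"

lemma power_residue_eq:
  assumes "d dvd p - 1"
  shows "of_real (power_residue d x) = (\<Sum>j<d. power_char d j x) / of_nat d"
proof (cases "int p dvd x")
  case False
  then show ?thesis
    using sum_cis_multiples[OF divisor_pos[OF assms], of "ind x"] divisor_pos[OF assms]
    by (simp add: power_residue_def power_char_def)
qed (simp add: power_residue_def power_char_def)

definition primroot :: "int \<Rightarrow> real" where
  "primroot x = of_bool (ord_Fp p x = p - 1)"

text \<open>The order of \<open>gen ^ k\<close> is \<open>(p - 1) div gcd k (p - 1)\<close>, which
  is full exactly when the gcd is 1.\<close>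

lemma ord_Fp_eq_iff: "ord_Fp p x = p - 1 \<longleftrightarrow> \<not> int p dvd x \<and> coprime (ind x) (p - 1)"
proof (cases "int p dvd x")
  case True
  then have "ord_Fp p x = ord p 0" by (simp add: ord_Fp_def)
  also have "\<dots> = 0" using p_gt_1 by (subst ord_eq_0) simp
  finally show ?thesis using True p_gt_1 by simp
next
  case False
  have "[int gen ^ ind x = x mod int p] (mod int p)"
    using ind_cong[OF False] by (simp add: cong_def)
  then have "[int (gen ^ ind x) = int (nat (x mod int p))] (mod int p)"
    using p_pos by simp
  then have "[gen ^ ind x = nat (x mod int p)] (mod p)"
    by (simp only: cong_int_iff)
  then have "ord_Fp p x = ord p (gen ^ ind x)"
    unfolding ord_Fp_def by (intro ord_cong) (rule cong_sym)
  also have "\<dots> = (p - 1) div gcd (ind x) (p - 1)"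
    using ord_power[OF coprime_gen] by (simp add: ord_gen)
  finally have o: "ord_Fp p x = (p - 1) div gcd (ind x) (p - 1)" .
  show ?thesis
  proof
    assume a: "ord_Fp p x = p - 1"
    have "(p - 1) div gcd (ind x) (p - 1) = p - 1" by (rule trans[OF o[symmetric] a])
    then have "gcd (ind x) (p - 1) * (p - 1) = 1 * (p - 1)"
      using dvd_mult_div_cancel[OF gcd_dvd2, of "ind x" "p - 1"] by (simp only: mult_1)
    then have "gcd (ind x) (p - 1) = 1" using p_gt_1 by (simp only: mult_cancel2) simp
    then have "coprime (ind x) (p - 1)" by (simp only: coprime_iff_gcd_eq_1)
    then show "\<not> int p dvd x \<and> coprime (ind x) (p - 1)" using False by simp
  next
    assume "\<not> int p dvd x \<and> coprime (ind x) (p - 1)"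
    then have "gcd (ind x) (p - 1) = 1" by (simp only: coprime_iff_gcd_eq_1)
    then show "ord_Fp p x = p - 1" unfolding o by (simp only: div_by_1)
  qed
qed

text \<open>A unit is a primitive root exactly when it is a \<open>q\<close>-th power for no prime
  \<open>q\<close> dividing \<open>p - 1\<close>. In the expanded product over these primes, sets
  \<open>D\<close> take the place of squarefree divisors and \<open>(-1) ^ card D\<close> that of
  the Moebius function.\<close>

lemma primroot_eq:
  "primroot x = (\<Sum>D\<in>Pow (prime_factors (p - 1)). (-1) ^ card D * power_residue (\<Prod>D) x)"
proof (cases "int p dvd x")
  case True
  then show ?thesis unfolding primroot_def ord_Fp_eq_iff by (simp add: power_residue_def)
next
  case False
  let ?P = "prime_factors (p - 1)"
  have cop: "coprime (ind x) (p - 1) \<longleftrightarrow> (\<forall>q\<in>?P. \<not> q dvd ind x)"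
  proof
    assume "coprime (ind x) (p - 1)"
    then show "\<forall>q\<in>?P. \<not> q dvd ind x"
      by (metis coprime_common_divisor in_prime_factors_iff not_prime_unit)
  next
    assume *: "\<forall>q\<in>?P. \<not> q dvd ind x"
    show "coprime (ind x) (p - 1)"
    proof (rule ccontr)
      assume "\<not> coprime (ind x) (p - 1)"
      then have "gcd (ind x) (p - 1) \<noteq> 1" using coprime_iff_gcd_eq_1 by blast
      then obtain q where "prime q" "q dvd gcd (ind x) (p - 1)" using prime_factor_nat by blast
      then show False using * p_gt_1 by (auto simp: in_prime_factors_iff)
    qed
  qed
  have "primroot x = (\<Prod>q\<in>?P. 1 - of_bool (q dvd ind x))"
    using False unfolding primroot_def ord_Fp_eq_iff cop by (auto simp: prod_zero_iff)
  also have "\<dots> = (\<Sum>D\<in>Pow ?P. (-1) ^ card D * (\<Prod>q\<in>D. of_bool (q dvd ind x)))"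
    by (rule prod_diff_subsets) simp
  also have "\<dots> = (\<Sum>D\<in>Pow ?P. (-1) ^ card D * power_residue (\<Prod>D) x)"
  proof (intro sum.cong refl arg_cong2[where f = "(*)"])
    fix D assume "D \<in> Pow ?P"
    then have D: "finite D" "\<And>q. q \<in> D \<Longrightarrow> prime q"
      by (auto intro: finite_subset)
    have "(\<Prod>q\<in>D. of_bool (q dvd ind x)) = (of_bool (\<forall>q\<in>D. q dvd ind x) :: real)"
      using D(1) by (auto simp: prod_zero_iff)
    then show "(\<Prod>q\<in>D. of_bool (q dvd ind x)) = power_residue (\<Prod>D) x"
      using False prod_primes_dvd_iff[OF D] by (simp add: power_residue_def)
  qed
  finally show ?thesis .
qed

lemma prod_prime_factors_dvd: "D \<subseteq> prime_factors n \<Longrightarrow> \<Prod>D dvd (n::nat)"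
  by (subst prod_primes_dvd_iff) (auto intro: finite_subset)

lemma card_shifted_multiples_le: "card {n\<in>{0..<p}. int p dvd int n + a} \<le> 1"
proof (rule card_le_Suc0_iff_eq[THEN iffD2, unfolded One_nat_def[symmetric]])
  show "\<forall>x\<in>{n\<in>{0..<p}. int p dvd int n + a}. \<forall>y\<in>{n\<in>{0..<p}. int p dvd int n + a}. x = y"
  proof (intro ballI)
    fix x y assume xy: "x \<in> {n\<in>{0..<p}. int p dvd int n + a}" "y \<in> {n\<in>{0..<p}. int p dvd int n + a}"
    have "int p dvd (int x + a) - (int y + a)" using xy by (intro dvd_diff) auto
    then show "x = y" using xy R_dvd_diff_iff[of "int x" "int y"] by (simp add: R_def)
  qed
qed simp

text \<open>Both indicators expand into characters. The pair of trivial ones gives the main term,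
  except for at most one \<open>n\<close> per shift where a character vanishes, whence the 2. The
  other pairs cost \<open>Err\<close> each, and the normalisation 1 / (d e) outweighs the number of
  pairs, so the bound is free of \<open>d\<close> and \<open>e\<close>.\<close>

lemma power_residue_correlation:
  fixes f :: "nat \<Rightarrow> real"
  assumes f: "\<And>n. \<bar>f n\<bar> \<le> 1" and Err0: "0 \<le> Err"
    and err: "\<And>\<phi> \<psi>. mchar \<phi> \<Longrightarrow> mchar \<psi> \<Longrightarrow> nontrivial \<phi> \<or> nontrivial \<psi> \<Longrightarrow>
      norm (\<Sum>n\<in>{0..<p}. of_real (f n) * (\<phi> (int n + a) * \<psi> (int n + b))) \<le> Err"
    and d: "d dvd p - 1" "e dvd p - 1"
  shows "\<bar>(\<Sum>n\<in>{0..<p}. f n * (power_residue d (int n + a) * power_residue e (int n + b)))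
           - (\<Sum>n\<in>{0..<p}. f n) / (real d * real e)\<bar> \<le> Err + 2"
proof -
  define A where "A = (\<Sum>n\<in>{0..<p}. f n * (power_residue d (int n + a) * power_residue e (int n + b)))"
  define F where "F = (\<Sum>n\<in>{0..<p}. f n)"
  define T where "T j k = (\<Sum>n\<in>{0..<p}. of_real (f n) * (power_char d j (int n + a) * power_char e k (int n + b)))" for j k
  have pos: "d > 0" "e > 0" using divisor_pos d by auto
  have triv: "norm (T 0 0 - of_real F) \<le> 2"
  proof -
    have "norm (T 0 0 - of_real F) = norm (\<Sum>n\<in>{0..<p}. of_real (f n) * (power_char d 0 (int n + a) * power_char e 0 (int n + b) - 1))"
      by (simp add: T_def F_def sum_subtractf right_diff_distrib)
    also have "\<dots> \<le> (\<Sum>n\<in>{0..<p}. of_bool (int p dvd int n + a) + of_bool (int p dvd int n + b))"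
    proof (intro sum_norm_le)
      fix n
      have "\<bar>f n\<bar> \<le> 1" "\<bar>f n\<bar> \<le> 2" using f[of n] by auto
      then show "norm (of_real (f n) * (power_char d 0 (int n + a) * power_char e 0 (int n + b) - 1))
          \<le> of_bool (int p dvd int n + a) + of_bool (int p dvd int n + b)"
        by (simp add: power_char_0 norm_mult)
    qed
    also have "\<dots> = real (card {n\<in>{0..<p}. int p dvd int n + a}) + real (card {n\<in>{0..<p}. int p dvd int n + b})"
      by (simp add: sum.distrib of_bool_def flip: sum.inter_filter)
    also have "\<dots> \<le> 1 + 1"
      unfolding of_nat_le_1_iff by (intro add_mono; unfold of_nat_le_1_iff; rule card_shifted_multiples_le)
    finally show ?thesis by simp
  qed
  have expand: "of_nat c * of_real (power_residue c x) = (\<Sum>j<c. power_char c j x)" if "c dvd p - 1" for c x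
    using power_residue_eq[OF that] divisor_pos[OF that] by simp
  have "of_real (real d * real e * A) = (\<Sum>j<d. \<Sum>k<e. T j k)"
  proof -
    have "of_real (real d * real e * A) = (\<Sum>n\<in>{0..<p}. of_real (f n) *
        ((of_nat d * of_real (power_residue d (int n + a))) * (of_nat e * of_real (power_residue e (int n + b)))) :: complex)"
      unfolding A_def sum_distrib_left of_real_sum by (intro sum.cong refl) simp
    also have "\<dots> = (\<Sum>n\<in>{0..<p}. \<Sum>j<d. \<Sum>k<e. of_real (f n) * (power_char d j (int n + a) * power_char e k (int n + b)))"
      unfolding expand[OF d(1)] expand[OF d(2)] sum_product unfolding sum_distrib_left ..
    also have "\<dots> = (\<Sum>j<d. \<Sum>k<e. T j k)"
      unfolding T_def by (subst sum.swap, rule sum.cong[OF refl], rule sum.swap)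
    finally show ?thesis .
  qed
  moreover have "of_real F = (\<Sum>j<d. \<Sum>k<e. (if k = 0 then if j = 0 then of_real F else 0 else 0 :: complex))"
    using pos by (simp add: sum.delta)
  ultimately have "of_real (real d * real e * A - F)
      = (\<Sum>j<d. \<Sum>k<e. T j k - (if k = 0 then if j = 0 then of_real F else 0 else 0))"
    unfolding sum_subtractf of_real_diff by (rule arg_cong2[where f = minus])
  then have "\<bar>real d * real e * A - F\<bar>
      = norm (\<Sum>j<d. \<Sum>k<e. T j k - (if k = 0 then if j = 0 then of_real F else 0 else 0))"
    unfolding norm_of_real[symmetric, where ?'a = complex] by (rule arg_cong)
  also have "\<dots> \<le> (\<Sum>j<d. \<Sum>k<e. Err + 2)"
  proof (intro sum_norm_le)
    fix j k assume jk: "j \<in> {..<d}" "k \<in> {..<e}"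
    show "norm (T j k - (if k = 0 then if j = 0 then of_real F else 0 else 0)) \<le> Err + 2"
    proof (cases "j = 0 \<and> k = 0")
      case True
      then show ?thesis using triv Err0 by simp
    next
      case False
      then have "nontrivial (power_char d j) \<or> nontrivial (power_char e k)"
        using nontrivial_power_char d jk by auto
      from err[OF mchar_power_char[OF d(1)] mchar_power_char[OF d(2)] this]
      show ?thesis using False by (auto simp: T_def)
    qed
  qed
  also have "\<dots> = real d * real e * (Err + 2)" by simp
  finally have "\<bar>real d * real e * A - F\<bar> \<le> real d * real e * (Err + 2)" .
  moreover have "real d * real e * A - F = real d * real e * (A - F / (real d * real e))"
    using pos by (simp add: right_diff_distrib)
  ultimately have "real d * real e * \<bar>A - F / (real d * real e)\<bar> \<le> real d * real e * (Err + 2)"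
    by (simp add: abs_mult)
  moreover have "real d * real e > 0" using pos by simp
  ultimately show ?thesis unfolding A_def F_def by (rule mult_left_le_imp_le)
qed


text \<open>Summing the expansion of the primitive-root indicators over pairs of squarefree divisors of
  \<open>p - 1\<close> reproduces \<open>\<phi>(p - 1) / (p - 1)\<close> in the main term.\<close>
lemma primroot_correlation:
  fixes f :: "nat \<Rightarrow> real"
  assumes f: "\<And>n. \<bar>f n\<bar> \<le> 1" and Err0: "0 \<le> Err"
    and err: "\<And>\<phi> \<psi>. mchar \<phi> \<Longrightarrow> mchar \<psi> \<Longrightarrow> nontrivial \<phi> \<or> nontrivial \<psi> \<Longrightarrow>
      norm (\<Sum>n\<in>{0..<p}. of_real (f n) * (\<phi> (int n + a) * \<psi> (int n + b))) \<le> Err"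
  shows "\<bar>(\<Sum>n\<in>{0..<p}. f n * (primroot (int n + a) * primroot (int n + b)))
           - (real (totient (p - 1)) / real (p - 1))\<^sup>2 * (\<Sum>n\<in>{0..<p}. f n)\<bar>
       \<le> 4 ^ card (prime_factors (p - 1)) * (Err + 2)"
proof -
  let ?P = "Pow (prime_factors (p - 1))"
  define F where "F = (\<Sum>n\<in>{0..<p}. f n)"
  define A where "A D E = (\<Sum>n\<in>{0..<p}. f n * (power_residue (\<Prod>D) (int n + a) * power_residue (\<Prod>E) (int n + b)))" for D E
  define sg :: "nat set \<Rightarrow> real" where "sg D = (-1) ^ card D" for D
  have tot: "real (totient (p - 1)) / real (p - 1) = (\<Sum>D\<in>?P. sg D / real (\<Prod>D))"
  proof -
    have "real (totient (p - 1)) / real (p - 1) = (\<Prod>q\<in>prime_factors (p - 1). 1 - 1 / real q)"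
      using p_gt_1 totient_formula2[of "p - 1"] by (simp add: field_simps)
    also have "\<dots> = (\<Sum>D\<in>?P. (-1) ^ card D * (\<Prod>q\<in>D. 1 / real q))"
      by (rule prod_diff_subsets) simp
    also have "\<dots> = (\<Sum>D\<in>?P. sg D / real (\<Prod>D))"
      by (intro sum.cong refl) (simp add: sg_def prod_dividef)
    finally show ?thesis .
  qed
  have "(\<Sum>n\<in>{0..<p}. f n * (primroot (int n + a) * primroot (int n + b)))
      = (\<Sum>n\<in>{0..<p}. \<Sum>D\<in>?P. \<Sum>E\<in>?P. sg D * sg E *
          (f n * (power_residue (\<Prod>D) (int n + a) * power_residue (\<Prod>E) (int n + b))))"
    unfolding primroot_eq sum_product unfolding sum_distrib_left
    by (intro sum.cong refl) (simp add: sg_def mult_ac)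
  also have "\<dots> = (\<Sum>D\<in>?P. \<Sum>E\<in>?P. sg D * sg E * A D E)"
    unfolding A_def sum_distrib_left by (subst sum.swap, rule sum.cong[OF refl], rule sum.swap)
  finally have N: "(\<Sum>n\<in>{0..<p}. f n * (primroot (int n + a) * primroot (int n + b)))
      = (\<Sum>D\<in>?P. \<Sum>E\<in>?P. sg D * sg E * A D E)" .
  have M: "(real (totient (p - 1)) / real (p - 1))\<^sup>2 * F
      = (\<Sum>D\<in>?P. \<Sum>E\<in>?P. sg D * sg E * (F / (real (\<Prod>D) * real (\<Prod>E))))"
    unfolding tot power2_eq_square sum_product unfolding sum_distrib_right
    by (intro sum.cong refl) simp
  have "\<bar>(\<Sum>D\<in>?P. \<Sum>E\<in>?P. sg D * sg E * A D E)
      - (\<Sum>D\<in>?P. \<Sum>E\<in>?P. sg D * sg E * (F / (real (\<Prod>D) * real (\<Prod>E))))\<bar>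
      = \<bar>\<Sum>D\<in>?P. \<Sum>E\<in>?P. sg D * sg E * (A D E - F / (real (\<Prod>D) * real (\<Prod>E)))\<bar>"
    by (simp only: sum_subtractf right_diff_distrib)
  also have "\<dots> \<le> (\<Sum>D\<in>?P. \<Sum>E\<in>?P. Err + 2)"
  proof (rule order_trans[OF sum_abs], rule sum_mono, rule order_trans[OF sum_abs], rule sum_mono)
    fix D E assume DE: "D \<in> ?P" "E \<in> ?P"
    have "\<bar>A D E - F / (real (\<Prod>D) * real (\<Prod>E))\<bar> \<le> Err + 2"
      unfolding A_def F_def using DE
      by (intro power_residue_correlation[OF f Err0 err] prod_prime_factors_dvd) auto
    then show "\<bar>sg D * sg E * (A D E - F / (real (\<Prod>D) * real (\<Prod>E)))\<bar> \<le> Err + 2"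
      by (simp add: abs_mult sg_def power_abs)
  qed
  \<comment> \<open>There are \<open>2 ^ card\<close> choices for \<open>D\<close> and as many for
    \<open>E\<close>.\<close>
  also have "\<dots> = 4 ^ card (prime_factors (p - 1)) * (Err + 2)"
    by (simp add: card_Pow flip: power_mult_distrib)
  finally show ?thesis unfolding N M F_def[symmetric] .
qed

end

section \<open>Sets of primes and residue classes\<close>

lemma prime_dvd_prod_primes_iff:
  fixes T :: "nat set"
  assumes "finite T" "\<And>q. q \<in> T \<Longrightarrow> prime q" "prime r"
  shows "r dvd \<Prod>T \<longleftrightarrow> r \<in> T"
  using assms by (metis prime_dvd_prod_iff primes_dvd_imp_eq dvd_refl)

text \<open>Unique factorisation. Sets of primes stand in for squarefree integers throughout, and
  this injection turns sums over such sets into sums over distinct integers.\<close>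

lemma inj_on_prod_primes: "inj_on (\<lambda>T. \<Prod>T) {T :: nat set. finite T \<and> (\<forall>q\<in>T. prime q)}"
proof (rule inj_onI)
  fix S T :: "nat set"
  assume S: "S \<in> {T. finite T \<and> (\<forall>q\<in>T. prime q)}" and T: "T \<in> {T. finite T \<and> (\<forall>q\<in>T. prime q)}"
    and eq: "\<Prod>S = \<Prod>T"
  have "r \<in> S \<longleftrightarrow> r \<in> T" if "prime r" for r
    using prime_dvd_prod_primes_iff[of S r] prime_dvd_prod_primes_iff[of T r] S T eq that by auto
  then show "S = T" using S T by blast
qed

lemma prod_primes_ge_1:
  fixes T :: "nat set"
  assumes "\<forall>q\<in>T. prime q"
  shows "\<Prod>T \<ge> 1"
  using assms by (intro prod_ge_1) (use prime_ge_1_nat in blast)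

text \<open>The divisor bound for squarefree numbers: a prime \<open>q\<close> with
  \<open>q powr \<epsilon> \<ge> 2\<close> pays for its own factor 2, and the finitely many smaller
  primes lose at most a factor 2 each.\<close>

lemma two_power_card_primes_le:
  fixes \<epsilon> :: real
  assumes "\<epsilon> > 0"
  obtains K where "K \<ge> 1"
    "\<And>T :: nat set. finite T \<Longrightarrow> \<forall>q\<in>T. prime q \<Longrightarrow> 2 ^ card T \<le> K * real (\<Prod>T) powr \<epsilon>"
proof
  define M where "M = nat \<lceil>2 powr (1 / \<epsilon>)\<rceil>"
  show "(2::real) ^ M \<ge> 1" by simp
  fix T :: "nat set" assume T: "finite T" "\<forall>q\<in>T. prime q"
  have "(2::real) ^ card T = (\<Prod>q\<in>T. 2)" by simp
  also have "\<dots> \<le> (\<Prod>q\<in>T. (if q < M then 2 else 1) * real q powr \<epsilon>)"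
  proof (intro prod_mono conjI)
    fix q assume "q \<in> T"
    then have q1: "real q \<ge> 1" using T(2) prime_ge_1_nat by auto
    show "2 \<le> (if q < M then 2 else 1) * real q powr \<epsilon>"
    proof (cases "q < M")
      case True
      then show ?thesis using ge_one_powr_ge_zero[OF q1, of \<epsilon>] assms by simp
    next
      case False
      then have "2 powr (1 / \<epsilon>) \<le> real q" unfolding M_def by linarith
      then have "(2 powr (1 / \<epsilon>)) powr \<epsilon> \<le> real q powr \<epsilon>"
        using assms by (intro powr_mono2) auto
      then show ?thesis using False assms by (simp add: powr_powr)
    qed
  qed simp
  also have "\<dots> = (\<Prod>q\<in>T. (if q < M then 2 else 1)) * (\<Prod>q\<in>T. real q powr \<epsilon>)"
    by (rule prod.distrib)
  also have "(\<Prod>q\<in>T. real q powr \<epsilon>) = real (\<Prod>T) powr \<epsilon>"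
    by (simp add: prod_powr_distrib)
  also have "(\<Prod>q\<in>T. (if q < M then 2 else 1)) = (2::real) ^ card (T \<inter> {q. q < M})"
    using T(1) by (simp add: prod.If_cases)
  also have "\<dots> \<le> 2 ^ M"
    using card_mono[of "{..<M}" "T \<inter> {q. q < M}"] by (intro power_increasing) auto
  finally show "2 ^ card T \<le> 2 ^ M * real (\<Prod>T) powr \<epsilon>"
    by (simp add: mult_right_mono)
qed

section \<open>Counting in residue classes and by square divisors\<close>

lemma card_crt:
  fixes m n :: nat
  assumes "coprime m n" "m > 0" "n > 0"
  shows "card {c\<in>{..<m * n}. P (c mod m) \<and> Q (c mod n)} = card {c\<in>{..<m}. P c} * card {c\<in>{..<n}. Q c}"
proof -
  let ?h = "\<lambda>c. (c mod m, c mod n)"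
  have inj: "inj_on ?h {..<m * n}"
  proof (rule inj_onI)
    fix x y assume xy: "x \<in> {..<m * n}" "y \<in> {..<m * n}" "?h x = ?h y"
    then have "[x = y] (mod m)" "[x = y] (mod n)" by (simp_all add: cong_def)
    then have "[x = y] (mod m * n)" using assms(1) by (rule coprime_cong_mult_nat)
    then show "x = y" using xy by (simp add: cong_def)
  qed
  have "?h ` {..<m * n} = {..<m} \<times> {..<n}"
  proof (rule card_subset_eq)
    show "card (?h ` {..<m * n}) = card ({..<m} \<times> {..<n})"
      by (simp add: card_image[OF inj])
    show "?h ` {..<m * n} \<subseteq> {..<m} \<times> {..<n}" using assms(2,3) by auto
  qed simp
  then have surj: "z \<in> ?h ` {..<m * n}" if "z \<in> {..<m} \<times> {..<n}" for z using that by simp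
  have "?h ` {c\<in>{..<m * n}. P (c mod m) \<and> Q (c mod n)} = {c\<in>{..<m}. P c} \<times> {c\<in>{..<n}. Q c}"
  proof (intro equalityI subsetI)
    fix z assume z: "z \<in> {c\<in>{..<m}. P c} \<times> {c\<in>{..<n}. Q c}"
    then obtain c where "c < m * n" "z = ?h c" using surj[of z] by auto
    then show "z \<in> ?h ` {c\<in>{..<m * n}. P (c mod m) \<and> Q (c mod n)}"
      using z by (intro image_eqI[of _ _ c]) auto
  qed (use assms in auto)
  moreover have "card (?h ` {c\<in>{..<m * n}. P (c mod m) \<and> Q (c mod n)})
      = card {c\<in>{..<m * n}. P (c mod m) \<and> Q (c mod n)}"
    by (intro card_image inj_on_subset[OF inj]) auto
  ultimately show ?thesis by (simp only: card_cartesian_product)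
qed

lemma card_residue_class: "m > 0 \<Longrightarrow> {c\<in>{..<m}. int m dvd int c + a} = {nat ((- a) mod int m)}"
proof (intro equalityI subsetI)
  assume m: "m > 0"
  fix c assume c: "c \<in> {c\<in>{..<m}. int m dvd int c + a}"
  then have "int c mod int m = (- a) mod int m" by (subst mod_eq_dvd_iff) simp
  moreover have "int c mod int m = int c" using c by simp
  ultimately have "int c = (- a) mod int m" by (rule trans[OF sym, rotated])
  then show "c \<in> {nat ((- a) mod int m)}" by (metis nat_int singletonI)
next
  assume m: "m > 0"
  fix c assume "c \<in> {nat ((- a) mod int m)}"
  then have c: "int c = (- a) mod int m" using m by simp
  then have "int c < int m" using m by simp
  moreover have "int m dvd int c - (- a)"
    by (subst mod_eq_dvd_iff[symmetric]) (simp add: c)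
  ultimately show "c \<in> {c\<in>{..<m}. int m dvd int c + a}" by simp
qed

text \<open>Full periods are counted exactly. For the remainder \<open>r < q\<close>, both the true
  count and the expected one lie between 0 and \<open>r\<close>.\<close>

lemma card_periodic_predicate:
  fixes P :: "nat \<Rightarrow> bool"
  assumes P: "\<And>n. P (n + q) = P n" and q: "q > 0"
  shows "\<bar>real (card {n\<in>{..<N}. P n}) - real N / real q * real (card {n\<in>{..<q}. P n})\<bar> \<le> real q"
proof -
  define c where "c N = real (card {n\<in>{..<N}. P n})" for N
  have add: "c (N + q) = c N + c q" for N
  proof -
    have "{n\<in>{..<N + q}. P n} = {n\<in>{..<q}. P n} \<union> (\<lambda>n. n + q) ` {n\<in>{..<N}. P n}" (is "_ = ?A \<union> ?B")
    proof (intro equalityI subsetI)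
      fix n assume n: "n \<in> {n\<in>{..<N + q}. P n}"
      show "n \<in> ?A \<union> ?B"
      proof (cases "n < q")
        case False
        then have "P (n - q)" using P[of "n - q"] n by simp
        then have "n - q \<in> {n\<in>{..<N}. P n}" using n False by auto
        then show ?thesis using False by (intro UnI2 image_eqI[of _ _ "n - q"]) auto
      qed (use n in auto)
    qed (auto simp: P)
    moreover have "?A \<inter> ?B = {}" by auto
    ultimately have "card {n\<in>{..<N + q}. P n} = card ?A + card ?B"
      by (simp add: card_Un_disjoint)
    also have "card ?B = card {n\<in>{..<N}. P n}" by (rule card_image) auto
    finally show ?thesis by (simp add: c_def)
  qed
  have mult: "c (k * q + r) = real k * c q + c r" for k r
  proof (induction k)
    case (Suc k)
    have "c (Suc k * q + r) = c (k * q + r + q)" by (simp add: algebra_simps)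
    then show ?case by (simp only: add Suc) (simp add: algebra_simps)
  qed simp
  have le: "0 \<le> c N" "c N \<le> real N" for N
    using card_mono[of "{..<N}" "{n\<in>{..<N}. P n}"] by (auto simp: c_def)
  define k r where "k = N div q" and "r = N mod q"
  have N: "N = k * q + r" and r: "r < q" using q by (auto simp: k_def r_def)
  have "c N - real N / real q * c q = c r - real r / real q * c q"
    unfolding N mult using q by (simp add: field_simps)
  moreover have "0 \<le> real r / real q * c q" "real r / real q * c q \<le> real r"
    using le[of q] q mult_left_mono[of "c q" "real q" "real r / real q"] by auto
  ultimately show ?thesis using le[of r] r unfolding c_def[symmetric] by auto
qed

text \<open>The error 1 is essential: \<open>card_periodic_predicate\<close> would give an error
  \<open>m\<close>, which is too large when \<open>m\<close> is a square comparable to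
  \<open>N\<close>.\<close>

lemma card_multiples_le:
  assumes "m > 0"
  shows "real (card {n\<in>{..<N}. int m dvd int n + a}) \<le> real N / real m + 1"
proof -
  have *: "card {n\<in>{..<m * k}. int m dvd int n + a} = k" for k
  proof (induction k)
    case (Suc k)
    have "{n\<in>{..<m * Suc k}. int m dvd int n + a}
        = {n\<in>{..<m * k}. int m dvd int n + a} \<union> (\<lambda>n. m * k + n) ` {n\<in>{..<m}. int m dvd int n + a}" (is "?A = ?B \<union> ?C")
    proof (intro equalityI subsetI)
      fix n assume n: "n \<in> ?A"
      show "n \<in> ?B \<union> ?C"
      proof (cases "n < m * k")
        case False
        then obtain d where d: "n = m * k + d" by (metis le_Suc_ex not_less)
        then have "int m dvd int d + a" using n dvd_add_right_iff[of "int m" "int m * int k" "int d + a"] by (simp add: add.assoc)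
        then show ?thesis using d n by auto
      qed (use n in auto)
    next
      fix n assume "n \<in> ?B \<union> ?C"
      then show "n \<in> ?A" by (auto simp: add.assoc)
    qed
    moreover have "?B \<inter> ?C = {}" by auto
    ultimately have "card ?A = card ?B + card ?C" by (simp add: card_Un_disjoint)
    also have "card ?C = card {n\<in>{..<m}. int m dvd int n + a}" by (rule card_image) auto
    also have "\<dots> = 1" using card_residue_class[OF assms, of a] by simp
    finally show ?case using Suc by simp
  qed simp
  have "N \<le> m * (N div m + 1)"
    using dividend_less_div_times[OF assms, of N] by (simp add: mult.commute)
  then have "card {n\<in>{..<N}. int m dvd int n + a} \<le> card {n\<in>{..<m * (N div m + 1)}. int m dvd int n + a}"
    by (intro card_mono) auto
  also have "\<dots> = N div m + 1" by (rule *)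
  finally have "real (card {n\<in>{..<N}. int m dvd int n + a}) \<le> real (N div m) + 1" by linarith
  moreover have "real (N div m) \<le> real N / real m"
    using div_times_less_eq_dividend[of N m] assms by (simp add: field_simps flip: of_nat_mult)
  ultimately show ?thesis by linarith
qed

text \<open>The zeta value at 5/4; the term at 0 vanishes because \<open>0 powr _\<close> is 0. The
  exponent exceeds 1 for convergence, yet stays below 3/2, what remains of a square after a divisor
  bound of exponent 1/2, so that a decay of exponent 1/4 is left over.\<close>

definition zeta54 :: real where "zeta54 = (\<Sum>n. real n powr (-5/4))"

lemma sum_powr_le_zeta54:
  assumes "finite A"
  shows "(\<Sum>e\<in>A. real e powr (-5/4)) \<le> zeta54"
  unfolding zeta54_def using assms by (intro sum_le_suminf) (auto simp: summable_real_powr_iff)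

lemma zeta54_nonneg: "zeta54 \<ge> 0"
  using sum_powr_le_zeta54[of "{}"] by simp

text \<open>Rankin's trick: a factor \<open>(e / w) powr (1/2) \<ge> 1\<close> makes the tail of a convergent series small.\<close>
lemma card_square_divisor_le:
  assumes w: "w \<ge> 1" and X0: "X \<ge> 0" and X: "\<And>n. n < N \<Longrightarrow> \<bar>int n + a\<bar> \<le> X"
  shows "real (card {n\<in>{..<N}. int n + a \<noteq> 0 \<and> (\<exists>e. real e > w \<and> int (e ^ 2) dvd int n + a)})
     \<le> real N * zeta54 * w powr (-1/2) + sqrt (of_int X)" (is "real (card ?S) \<le> _")
proof -
  \<comment> \<open>A nonzero \<open>n + a\<close> is at most \<open>X\<close> in absolute value and
    so admits only square divisors up to \<open>X\<close>. Hence at most \<open>sqrt X\<close>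
    values of \<open>e\<close> occur, and the rounding errors 1 add up to that.\<close>
  define E where "E = {e. real e > w \<and> int (e ^ 2) \<le> X}"
  have Esub: "E \<subseteq> {1..nat \<lfloor>sqrt (of_int X)\<rfloor>}"
  proof
    fix e assume e: "e \<in> E"
    then have "(real e)\<^sup>2 \<le> of_int X" by (simp add: E_def) (metis of_int_le_iff of_int_of_nat_eq of_nat_power)
    then have "real e \<le> sqrt (of_int X)" by (rule real_le_rsqrt)
    then show "e \<in> {1..nat \<lfloor>sqrt (of_int X)\<rfloor>}" using e w X0 by (auto simp: E_def le_nat_floor)
  qed
  have finE: "finite E" by (rule finite_subset[OF Esub]) simp
  have "?S \<subseteq> (\<Union>e\<in>E. {n\<in>{..<N}. int (e ^ 2) dvd int n + a})"
  proof
    fix n assume n: "n \<in> ?S"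
    then obtain e where e: "real e > w" "int (e ^ 2) dvd int n + a" by auto
    have "int (e ^ 2) \<le> \<bar>int n + a\<bar>"
      using e(2) n by (intro zdvd_imp_le) (auto simp: dvd_abs_iff)
    then have "int (e ^ 2) \<le> X" using X[of n] n by auto
    then show "n \<in> (\<Union>e\<in>E. {n\<in>{..<N}. int (e ^ 2) dvd int n + a})"
      using e n by (auto simp: E_def)
  qed
  then have "card ?S \<le> card (\<Union>e\<in>E. {n\<in>{..<N}. int (e ^ 2) dvd int n + a})"
    by (intro card_mono) (auto simp: finE)
  also have "\<dots> \<le> (\<Sum>e\<in>E. card {n\<in>{..<N}. int (e ^ 2) dvd int n + a})"
    by (rule card_UN_le[OF finE])
  finally have "real (card ?S) \<le> (\<Sum>e\<in>E. real (card {n\<in>{..<N}. int (e ^ 2) dvd int n + a}))"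
    by (simp flip: of_nat_sum)
  also have "\<dots> \<le> (\<Sum>e\<in>E. real N * (w powr (-1/2) * real e powr (-5/4)) + 1)"
  proof (rule sum_mono)
    fix e assume e: "e \<in> E"
    then have e1: "real e > w" "real e > 0" using w by (auto simp: E_def)
    \<comment> \<open>The exponent 2 splits into 5/4 for convergence and 3/4, of which 1/2 is spent
      on the decay in \<open>w\<close>.\<close>
    have "1 / real (e ^ 2) = real e powr (-2)"
      using e1 by (simp add: powr_minus powr_numeral inverse_eq_divide)
    also have "\<dots> = real e powr (-3/4) * real e powr (-5/4)"
      by (simp flip: powr_add)
    also have "real e powr (-3/4) \<le> real e powr (-1/2)"
      using e1 w by (intro powr_mono) auto
    also have "real e powr (-1/2) \<le> w powr (-1/2)"
      using e1 w by (intro powr_mono2') auto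
    finally have "1 / real (e ^ 2) \<le> w powr (-1/2) * real e powr (-5/4)"
      by (simp add: mult_right_mono)
    then have "real N * (1 / real (e ^ 2)) \<le> real N * (w powr (-1/2) * real e powr (-5/4))"
      by (rule mult_left_mono) simp
    moreover have "real (card {n\<in>{..<N}. int (e ^ 2) dvd int n + a}) \<le> real N / real (e ^ 2) + 1"
      using e1 by (intro card_multiples_le) auto
    ultimately show "real (card {n\<in>{..<N}. int (e ^ 2) dvd int n + a})
        \<le> real N * (w powr (-1/2) * real e powr (-5/4)) + 1" by simp
  qed
  also have "\<dots> = real N * w powr (-1/2) * (\<Sum>e\<in>E. real e powr (-5/4)) + real (card E)"
    by (simp add: sum.distrib sum_distrib_left mult_ac)
  also have "\<dots> \<le> real N * w powr (-1/2) * zeta54 + sqrt (of_int X)"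
  proof (intro add_mono mult_left_mono sum_powr_le_zeta54 finE)
    have "card E \<le> nat \<lfloor>sqrt (of_int X)\<rfloor>" using card_mono[OF _ Esub] by simp
    also have "real \<dots> \<le> sqrt (of_int X)" using X0 by simp
    finally show "real (card E) \<le> sqrt (of_int X)" by simp
  qed auto
  finally show ?thesis by (simp add: mult_ac)
qed

section \<open>The sieve for power-free pairs\<close>

text \<open>Power-freeness quantifies over integer primes, the sieve over natural ones; integer
  primes are positive.\<close>

lemma prime_int_exists_iff: "(\<exists>r::int. prime r \<and> P r) \<longleftrightarrow> (\<exists>q::nat. prime q \<and> P (int q))"
  by (metis prime_int_nat_transfer nat_0_le prime_ge_0_int prime_nat_int_transfer)

locale power_pair =
  fixes s :: nat and a0 a1 :: int
  assumes s: "s \<ge> 2" and neq: "a0 \<noteq> a1"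
begin

text \<open>Both members of the pair are sieved at once: a prime \<open>q\<close> removes the
  classes of \<open>- a0\<close> and \<open>- a1\<close> modulo \<open>q ^ s\<close>.\<close>

definition hit :: "nat \<Rightarrow> nat \<Rightarrow> bool" where
  "hit q n \<longleftrightarrow> int (q ^ s) dvd int n + a0 \<or> int (q ^ s) dvd int n + a1"

definition bad_primes :: "nat \<Rightarrow> nat set" where
  "bad_primes n = {q. prime q \<and> hit q n}"

definition both_free :: "nat \<Rightarrow> real" where
  "both_free n = of_bool (bad_primes n = {})"

text \<open>A set \<open>T\<close> represents the squarefree number \<open>\<Prod>T\<close>, with
  Moebius value \<open>(-1) ^ card T\<close>.\<close>

definition sieve_sets :: "real \<Rightarrow> nat set set" where
  "sieve_sets y = {T. finite T \<and> (\<forall>q\<in>T. prime q) \<and> real (\<Prod>T) \<le> y}"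

definition all_hit :: "nat set \<Rightarrow> nat \<Rightarrow> bool" where
  "all_hit T n \<longleftrightarrow> (\<forall>q\<in>T. hit q n)"

definition truncated_sieve :: "real \<Rightarrow> nat \<Rightarrow> real" where
  "truncated_sieve y n = (\<Sum>T\<in>sieve_sets y. (-1) ^ card T * of_bool (all_hit T n))"

lemma mu_free_eq: "of_bool (mu_free s (int n + a0) = 1 \<and> mu_free s (int n + a1) = 1) = both_free n"
proof -
  have "mu_free s m = 1 \<longleftrightarrow> \<not> (\<exists>q::nat. prime q \<and> int (q ^ s) dvd m)" for m
    using prime_int_exists_iff[of "\<lambda>r. r ^ s dvd m"]
    by (auto simp: mu_free_def power_free_def)
  then show ?thesis by (auto simp: both_free_def bad_primes_def hit_def)
qed

lemma sieve_sets_bij: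
  "inj_on (\<lambda>T. \<Prod>T) (sieve_sets y)" "(\<lambda>T. \<Prod>T) ` sieve_sets y \<subseteq> {1..nat \<lfloor>y\<rfloor>}"
proof -
  show "inj_on (\<lambda>T. \<Prod>T) (sieve_sets y)"
    by (rule inj_on_subset[OF inj_on_prod_primes]) (auto simp: sieve_sets_def)
  show "(\<lambda>T. \<Prod>T) ` sieve_sets y \<subseteq> {1..nat \<lfloor>y\<rfloor>}"
  proof
    fix e assume "e \<in> (\<lambda>T. \<Prod>T) ` sieve_sets y"
    then obtain T where T: "T \<in> sieve_sets y" "e = \<Prod>T" by auto
    then have "e \<ge> 1" "real e \<le> y" using prod_primes_ge_1[of T] by (auto simp: sieve_sets_def)
    then show "e \<in> {1..nat \<lfloor>y\<rfloor>}" by (simp add: le_nat_floor)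
  qed
qed

lemma finite_sieve_sets [simp]: "finite (sieve_sets y)"
  by (rule inj_on_finite[OF sieve_sets_bij]) simp

lemma card_sieve_sets: "y \<ge> 0 \<Longrightarrow> real (card (sieve_sets y)) \<le> y"
proof -
  assume y: "y \<ge> 0"
  have "card (sieve_sets y) \<le> card {1..nat \<lfloor>y\<rfloor>}"
    by (rule card_inj_on_le[OF sieve_sets_bij]) simp
  then have "card (sieve_sets y) \<le> nat \<lfloor>y\<rfloor>" by simp
  then show ?thesis using y by (simp add: le_nat_iff le_floor_iff)
qed

lemma hit_add: "q ^ s dvd m \<Longrightarrow> hit q (n + m) = hit q n"
proof -
  assume "q ^ s dvd m"
  then have d: "int (q ^ s) dvd int m" by (simp only: int_dvd_int_iff)
  have "int (q ^ s) dvd int (n + m) + a \<longleftrightarrow> int (q ^ s) dvd int n + a" for a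
  proof -
    have "int (n + m) + a = (int n + a) + int m" by simp
    then show ?thesis using dvd_add_left_iff[OF d] by metis
  qed
  then show ?thesis unfolding hit_def by blast
qed

lemma all_hit_add: "finite T \<Longrightarrow> (\<Prod>T) ^ s dvd m \<Longrightarrow> all_hit T (n + m) = all_hit T n"
  unfolding all_hit_def
  by (intro ball_cong refl hit_add) (meson dvd_power_same dvd_prodI dvd_trans)

lemma all_hit_mod: "finite T \<Longrightarrow> all_hit T n = all_hit T (n mod (\<Prod>T) ^ s)"
  using all_hit_add[of T "(\<Prod>T) ^ s * (n div (\<Prod>T) ^ s)" "n mod (\<Prod>T) ^ s"] by simp

text \<open>The origin of \<open>rho\<close>: the two removed classes coincide exactly when
  \<open>q ^ s\<close> divides \<open>a1 - a0\<close>.\<close>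

lemma card_hit:
  assumes "prime q"
  shows "card {c\<in>{..<q ^ s}. hit q c} = rho s a0 a1 q"
proof -
  have pos: "q ^ s > 0" using assms prime_gt_0_nat by simp
  let ?r = "\<lambda>a. nat ((- a) mod int (q ^ s))"
  have "{c\<in>{..<q ^ s}. hit q c} = {c\<in>{..<q ^ s}. int (q ^ s) dvd int c + a0} \<union> {c\<in>{..<q ^ s}. int (q ^ s) dvd int c + a1}"
    by (auto simp: hit_def)
  also have "\<dots> = {?r a0, ?r a1}"
    unfolding card_residue_class[OF pos] by auto
  finally have "{c\<in>{..<q ^ s}. hit q c} = {?r a0, ?r a1}" .
  moreover have "?r a0 = ?r a1 \<longleftrightarrow> int q ^ s dvd a1 - a0"
  proof -
    have "?r a0 = ?r a1 \<longleftrightarrow> (- a0) mod int (q ^ s) = (- a1) mod int (q ^ s)"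
      using pos by (intro eq_nat_nat_iff) (simp_all del: of_nat_power)
    also have "\<dots> \<longleftrightarrow> int (q ^ s) dvd a1 - a0" unfolding mod_eq_dvd_iff by simp
    finally show ?thesis by simp
  qed
  ultimately show ?thesis by (auto simp: rho_def card_insert_if)
qed

lemma card_all_hit:
  assumes "finite T" "\<forall>q\<in>T. prime q"
  shows "card {c\<in>{..<(\<Prod>T) ^ s}. all_hit T c} = (\<Prod>q\<in>T. rho s a0 a1 q)"
  using assms
proof (induction T)
  case empty
  have "{c\<in>{..<1::nat}. True} = {0}" by auto
  then show ?case by (simp add: all_hit_def)
next
  case (insert q T)
  let ?m = "q ^ s" and ?n = "(\<Prod>T) ^ s"
  have q: "prime q" and T: "finite T" "\<forall>q\<in>T. prime q" using insert by auto
  have "coprime q (\<Prod>T)"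
    using insert by (intro prod_coprime_right) (metis insertCI primes_coprime)
  then have cop: "coprime ?m ?n" by simp
  have pos: "?m > 0" "?n > 0"
    using q prime_gt_0_nat prod_primes_ge_1[OF T(2)] by auto
  have h: "hit q c = hit q (c mod ?m)" for c
    using hit_add[of q "?m * (c div ?m)" "c mod ?m"] by simp
  have "{c\<in>{..<(\<Prod>(insert q T)) ^ s}. all_hit (insert q T) c}
      = {c\<in>{..<?m * ?n}. hit q (c mod ?m) \<and> all_hit T (c mod ?n)}"
    using insert(1,2) h all_hit_mod[OF T(1)] by (auto simp: all_hit_def power_mult_distrib)
  then show ?case
    using insert card_crt[OF cop pos, of "hit q" "all_hit T"] card_hit[OF q] by simp
qed

lemma rho_le: "real (rho s a0 a1 q) \<le> 2"
  by (simp add: rho_def)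

definition sieve_term :: "nat set \<Rightarrow> real" where
  "sieve_term T = (-1) ^ card T * (\<Prod>q\<in>T. real (rho s a0 a1 q) / real q ^ s)"

text \<open>Each \<open>T\<close> contributes its exact density with an error of at most one period
  \<open>(\<Prod>T) ^ s \<le> y ^ s\<close>, and there are at most \<open>y\<close> sets
  \<open>T\<close>.\<close>

lemma sum_truncated_sieve:
  assumes y: "y \<ge> 1"
  shows "\<bar>(\<Sum>n<N. truncated_sieve y n) - real N * (\<Sum>T\<in>sieve_sets y. sieve_term T)\<bar> \<le> y * y ^ s"
proof -
  have "(\<Sum>n<N. truncated_sieve y n) = (\<Sum>T\<in>sieve_sets y. (-1) ^ card T * real (card {n\<in>{..<N}. all_hit T n}))"
    unfolding truncated_sieve_def
    by (subst sum.swap) (simp add: of_bool_def flip: sum_distrib_left sum.inter_filter)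
  then have "\<bar>(\<Sum>n<N. truncated_sieve y n) - real N * (\<Sum>T\<in>sieve_sets y. sieve_term T)\<bar>
      = \<bar>\<Sum>T\<in>sieve_sets y. (-1) ^ card T * real (card {n\<in>{..<N}. all_hit T n}) - real N * sieve_term T\<bar>"
    by (simp only: sum_subtractf sum_distrib_left)
  also have "\<dots> \<le> (\<Sum>T\<in>sieve_sets y. y ^ s)"
  proof (rule order_trans[OF sum_abs], rule sum_mono)
    fix T assume "T \<in> sieve_sets y"
    then have T: "finite T" "\<forall>q\<in>T. prime q" "real (\<Prod>T) \<le> y" by (auto simp: sieve_sets_def)
    let ?Q = "(\<Prod>T) ^ s"
    have Q: "?Q > 0" using prod_primes_ge_1[OF T(2)] by simp
    have "(-1) ^ card T * real (card {n\<in>{..<N}. all_hit T n}) - real N * sieve_term T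
        = (-1) ^ card T * (real (card {n\<in>{..<N}. all_hit T n}) - real N / real ?Q * real (card {n\<in>{..<?Q}. all_hit T n}))"
    proof -
      have "real (card {n\<in>{..<?Q}. all_hit T n}) = (\<Prod>q\<in>T. real (rho s a0 a1 q))"
        by (simp only: card_all_hit[OF T(1,2)] of_nat_prod)
      moreover have "real ?Q = (\<Prod>q\<in>T. real q ^ s)"
        by (simp add: prod_power_distrib)
      ultimately show ?thesis by (simp only: sieve_term_def prod_dividef right_diff_distrib) simp
    qed
    then have "\<bar>(-1) ^ card T * real (card {n\<in>{..<N}. all_hit T n}) - real N * sieve_term T\<bar>
        = \<bar>real (card {n\<in>{..<N}. all_hit T n}) - real N / real ?Q * real (card {n\<in>{..<?Q}. all_hit T n})\<bar>"
      by (simp only: abs_mult power_abs abs_minus_cancel abs_one power_one mult_1)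
    also have "\<dots> \<le> real ?Q"
      by (rule card_periodic_predicate[where P = "all_hit T", OF all_hit_add[OF T(1) dvd_refl] Q])
    also have "\<dots> \<le> y ^ s" using T(3) by (simp add: power_mono flip: of_nat_prod)
    finally show "\<bar>(-1) ^ card T * real (card {n\<in>{..<N}. all_hit T n}) - real N * sieve_term T\<bar> \<le> y ^ s" .
  qed
  also have "\<dots> \<le> y * y ^ s"
    using card_sieve_sets[of y] y by (simp add: mult_right_mono)
  finally show ?thesis .
qed

text \<open>The condition for \<open>T\<close> is constant on residue classes modulo
  \<open>(\<Prod>T) ^ s\<close>, so the twisted sum breaks into at most \<open>y ^ s\<close>
  progressions for each of at most \<open>y\<close> sets. The hypothesis \<open>y ^ s < N\<close>
  keeps the moduli in the range where \<open>G\<close> applies. Counting every class, hit or not,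
  costs only a power of \<open>y\<close>.\<close>

lemma sum_truncated_sieve_twisted:
  fixes F :: "nat \<Rightarrow> complex"
  assumes y: "y \<ge> 1" and yN: "y ^ s < real N"
    and G: "\<And>q c. 0 < q \<Longrightarrow> q < N \<Longrightarrow> norm (\<Sum>n\<in>{n\<in>{..<N}. n mod q = c}. F n) \<le> G"
  shows "norm (\<Sum>n<N. of_real (truncated_sieve y n) * F n) \<le> y * y ^ s * G"
proof -
  have N1: "1 < N" using yN one_le_power[OF y, of s] by linarith
  have G0: "0 \<le> G" by (rule order_trans[OF norm_ge_zero G[of 1 0]]) (use N1 in auto)
  have "(\<Sum>n<N. of_real (truncated_sieve y n) * F n)
      = (\<Sum>n<N. \<Sum>T\<in>sieve_sets y. (-1) ^ card T * (of_bool (all_hit T n) * F n))"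
    unfolding truncated_sieve_def of_real_sum sum_distrib_right by (intro sum.cong refl) simp
  also have "\<dots> = (\<Sum>T\<in>sieve_sets y. (-1) ^ card T * (\<Sum>n<N. of_bool (all_hit T n) * F n))"
    unfolding sum_distrib_left by (rule sum.swap)
  also have "norm \<dots> \<le> (\<Sum>T\<in>sieve_sets y. y ^ s * G)"
  proof (intro sum_norm_le)
    fix T assume "T \<in> sieve_sets y"
    then have T: "finite T" "\<forall>q\<in>T. prime q" "real (\<Prod>T) \<le> y" by (auto simp: sieve_sets_def)
    let ?Q = "(\<Prod>T) ^ s"
    have Q: "?Q > 0" using prod_primes_ge_1[OF T(2)] by simp
    have Qy: "real ?Q \<le> y ^ s" using T(3) by (simp add: power_mono flip: of_nat_prod)
    have QN: "?Q < N" using Qy yN by linarith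
    have "(\<Sum>n<N. of_bool (all_hit T n) * F n) = (\<Sum>n\<in>{..<N}. \<Sum>c<?Q. if n mod ?Q = c then of_bool (all_hit T c) * F n else 0)"
      using Q by (intro sum.cong refl) (simp add: sum.delta' all_hit_mod[OF T(1), symmetric])
    also have "\<dots> = (\<Sum>c<?Q. of_bool (all_hit T c) * (\<Sum>n\<in>{n\<in>{..<N}. n mod ?Q = c}. F n))"
      unfolding sum_distrib_left unfolding sum.inter_filter[OF finite_lessThan] by (rule sum.swap)
    also have "norm \<dots> \<le> (\<Sum>c<?Q. G)"
    proof (intro sum_norm_le)
      fix c
      show "norm (of_bool (all_hit T c) * (\<Sum>n\<in>{n\<in>{..<N}. n mod ?Q = c}. F n)) \<le> G"
        using G[OF Q QN, of c] G0 by (cases "all_hit T c") auto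
    qed
    also have "\<dots> \<le> y ^ s * G" using mult_right_mono[OF Qy G0] by simp
    finally show "norm ((-1) ^ card T * (\<Sum>n<N. of_bool (all_hit T n) * F n)) \<le> y ^ s * G"
      by (simp add: norm_mult norm_power)
  qed
  also have "\<dots> \<le> y * y ^ s * G"
    using card_sieve_sets[of y] y G0 by (simp add: mult_right_mono mult.assoc)
  finally show ?thesis .
qed


section \<open>Pointwise and total error of the truncation\<close>

definition power_primes :: "int \<Rightarrow> nat set" where
  "power_primes m = {q. prime q \<and> int (q ^ s) dvd m}"

lemma power_primes_facts:
  assumes m: "m \<noteq> 0"
  shows "finite (power_primes m)" "int ((\<Prod>(power_primes m)) ^ s) dvd m"
    "int (\<Prod>(power_primes m)) \<le> \<bar>m\<bar>"
proof -
  have le: "int q \<le> \<bar>m\<bar>" if "int (q ^ s) dvd m" "q \<ge> 1" for q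
  proof -
    have "int (q ^ s) \<le> \<bar>m\<bar>" using that m by (intro zdvd_imp_le) (auto simp: dvd_abs_iff)
    moreover have "q ^ 1 \<le> q ^ s" using that s by (intro power_increasing) auto
    then have "int q \<le> int (q ^ s)" by (simp only: power_one_right of_nat_le_iff)
    ultimately show ?thesis by linarith
  qed
  have "power_primes m \<subseteq> {..nat \<bar>m\<bar>}"
  proof
    fix q assume q: "q \<in> power_primes m"
    then have "int q \<le> \<bar>m\<bar>" using le[of q] prime_ge_1_nat by (auto simp: power_primes_def)
    then show "q \<in> {..nat \<bar>m\<bar>}" by simp
  qed
  then show fin: "finite (power_primes m)" by (rule finite_subset) simp
  have "int ((\<Prod>T) ^ s) dvd m" if "finite T" "T \<subseteq> power_primes m" for T
    using that
  proof (induction T)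
    case (insert q T)
    have "coprime q (\<Prod>T)"
      using insert by (intro prod_coprime_right) (auto simp: power_primes_def intro!: primes_coprime)
    then have "coprime (int (q ^ s)) (int ((\<Prod>T) ^ s))" by (simp only: coprime_int_iff coprime_power_left_iff coprime_power_right_iff simp_thms)
    then have "int (q ^ s) * int ((\<Prod>T) ^ s) dvd m"
      using insert by (intro divides_mult) (auto simp: power_primes_def)
    then show ?case using insert by (simp add: power_mult_distrib)
  qed simp
  from this[OF fin order_refl] show dvd: "int ((\<Prod>(power_primes m)) ^ s) dvd m" .
  have "\<Prod>(power_primes m) \<ge> 1" by (rule prod_primes_ge_1) (simp add: power_primes_def)
  from le[OF dvd this] show "int (\<Prod>(power_primes m)) \<le> \<bar>m\<bar>" .
qed

text \<open>Only a square is retained from the \<open>s\<close>-th powers, which is possible as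
  \<open>s \<ge> 2\<close>. Zero is excluded because every square divides it.\<close>

definition big_square :: "real \<Rightarrow> int \<Rightarrow> bool" where
  "big_square w m \<longleftrightarrow> m \<noteq> 0 \<and> (\<exists>e::nat. real e > w \<and> int (e ^ 2) dvd m)"

lemma big_squareI:
  assumes "m \<noteq> 0" "real (\<Prod>(power_primes m)) > w"
  shows "big_square w m"
proof -
  have "int ((\<Prod>(power_primes m)) ^ 2) dvd int ((\<Prod>(power_primes m)) ^ s)"
    using s by (simp only: int_dvd_int_iff le_imp_power_dvd)
  then have "int ((\<Prod>(power_primes m)) ^ 2) dvd m"
    using power_primes_facts(2)[OF assms(1)] dvd_trans by blast
  then show ?thesis using assms unfolding big_square_def by blast
qed

lemma two_power_card_power_primes:
  assumes K: "K \<ge> 1" "\<And>T :: nat set. finite T \<Longrightarrow> \<forall>q\<in>T. prime q \<Longrightarrow> 2 ^ card T \<le> K * real (\<Prod>T) powr \<epsilon>"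
    and m: "m \<noteq> 0" "\<bar>m\<bar> \<le> X" and \<epsilon>: "\<epsilon> > 0"
  shows "2 ^ card (power_primes m) \<le> K * of_int X powr \<epsilon>"
proof -
  have "2 ^ card (power_primes m) \<le> K * real (\<Prod>(power_primes m)) powr \<epsilon>"
    using power_primes_facts(1)[OF m(1)] by (intro K(2)) (auto simp: power_primes_def)
  also have "\<dots> \<le> K * of_int X powr \<epsilon>"
  proof (intro mult_left_mono powr_mono2)
    have "int (\<Prod>(power_primes m)) \<le> X" using power_primes_facts(3)[OF m(1)] m(2) by linarith
    then show "real (\<Prod>(power_primes m)) \<le> of_int X"
      by (metis of_int_le_iff of_int_of_nat_eq)
  qed (use K(1) \<epsilon> in \<open>auto intro!: prod_nonneg\<close>)
  finally show ?thesis .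
qed

lemma truncated_sieve_bound: "y \<ge> 0 \<Longrightarrow> \<bar>truncated_sieve y n\<bar> \<le> y"
proof -
  assume y: "y \<ge> 0"
  have "\<bar>truncated_sieve y n\<bar> \<le> (\<Sum>T\<in>sieve_sets y. 1)"
    unfolding truncated_sieve_def by (rule order_trans[OF sum_abs], rule sum_mono) (simp add: abs_mult power_abs)
  then show ?thesis using card_sieve_sets[OF y] by simp
qed

text \<open>The alternating sum over all subsets of the bad primes is exactly
  \<open>both_free n\<close>, so the difference consists of subsets with product above
  \<open>y\<close>. If one exists, the primes of \<open>n + a0\<close> or those of
  \<open>n + a1\<close> have product above \<open>sqrt y\<close>. The number of subsets is
  controlled by the divisor bound. Nonvanishing of both shifts makes the set of bad primes
  finite.\<close>

lemma sieve_pointwise_error: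
  assumes K: "K \<ge> 1" "\<And>T :: nat set. finite T \<Longrightarrow> \<forall>q\<in>T. prime q \<Longrightarrow> 2 ^ card T \<le> K * real (\<Prod>T) powr \<epsilon>"
    and \<epsilon>: "\<epsilon> > 0" and y: "y \<ge> 1"
    and m0: "int n + a0 \<noteq> 0" "\<bar>int n + a0\<bar> \<le> X" and m1: "int n + a1 \<noteq> 0" "\<bar>int n + a1\<bar> \<le> X"
  shows "\<bar>both_free n - truncated_sieve y n\<bar>
    \<le> (K * of_int X powr \<epsilon>)\<^sup>2 * of_bool (big_square (sqrt y) (int n + a0) \<or> big_square (sqrt y) (int n + a1))"
proof -
  define C where "C = bad_primes n"
  define C0 where "C0 = power_primes (int n + a0)"
  define C1 where "C1 = power_primes (int n + a1)"
  have C: "C = C0 \<union> C1"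
    by (auto simp: C_def C0_def C1_def bad_primes_def hit_def power_primes_def)
  have fin: "finite C0" "finite C1" "finite C"
    using power_primes_facts(1)[OF m0(1)] power_primes_facts(1)[OF m1(1)] by (auto simp: C C0_def C1_def)
  have pr: "\<forall>q\<in>C. prime q" "\<forall>q\<in>C0. prime q" "\<forall>q\<in>C1. prime q"
    by (auto simp: C_def C0_def C1_def bad_primes_def power_primes_def)
  have "both_free n = (\<Prod>q\<in>C. 1 - 1)"
    using fin(3) by (auto simp: both_free_def C_def[symmetric] prod_zero_iff)
  also have "\<dots> = (\<Sum>T\<in>Pow C. (-1) ^ card T)"
    using prod_diff_subsets[OF fin(3), of "\<lambda>_. 1::real"] by simp
  finally have free: "both_free n = (\<Sum>T\<in>Pow C. (-1) ^ card T)" .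
  have "truncated_sieve y n = (\<Sum>T\<in>{T\<in>sieve_sets y. all_hit T n}. (-1) ^ card T)"
    unfolding truncated_sieve_def by (simp add: sum.inter_filter of_bool_def if_distrib cong: if_cong)
  also have "{T\<in>sieve_sets y. all_hit T n} = {T\<in>Pow C. real (\<Prod>T) \<le> y}"
    using fin(3) by (auto simp: sieve_sets_def all_hit_def C_def bad_primes_def intro: finite_subset)
  finally have trunc: "truncated_sieve y n = (\<Sum>T\<in>{T\<in>Pow C. real (\<Prod>T) \<le> y}. (-1) ^ card T)" .
  have "Pow C - {T\<in>Pow C. real (\<Prod>T) \<le> y} = {T\<in>Pow C. real (\<Prod>T) > y}" by auto
  then have "both_free n - truncated_sieve y n = (\<Sum>T\<in>{T\<in>Pow C. real (\<Prod>T) > y}. (-1) ^ card T)"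
    unfolding free trunc using fin(3) by (subst sum_diff[symmetric]) auto
  then have diff: "\<bar>both_free n - truncated_sieve y n\<bar> \<le> real (card {T\<in>Pow C. real (\<Prod>T) > y})"
    using sum_abs[of "\<lambda>T. (-1::real) ^ card T" "{T\<in>Pow C. real (\<Prod>T) > y}"]
    by (simp only: power_abs abs_minus_cancel abs_one power_one sum_constant mult_1_right)
  show ?thesis
  proof (cases "{T\<in>Pow C. real (\<Prod>T) > y} = {}")
    case True
    have "\<bar>both_free n - truncated_sieve y n\<bar> \<le> 0" using diff unfolding True by simp
    then show ?thesis by (rule order_trans) simp
  next
    case False
    then obtain T where T: "T \<subseteq> C" "y < real (\<Prod>T)" by auto
    have "\<Prod>T \<le> \<Prod>C"
    proof (rule dvd_imp_le)
      show "\<Prod>T dvd \<Prod>C" by (rule prod_dvd_prod_subset[OF fin(3) T(1)])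
      show "0 < \<Prod>C" using prod_primes_ge_1[OF pr(1)] by linarith
    qed
    \<comment> \<open>A prime bad for both shifts is counted twice in the product of
      \<open>C0\<close> and \<open>C1\<close>, which only helps.\<close>
    also have "\<Prod>C \<le> \<Prod>C * \<Prod>(C0 \<inter> C1)"
      using prod_primes_ge_1[of "C0 \<inter> C1"] pr by simp
    also have "\<dots> = \<Prod>C0 * \<Prod>C1"
      unfolding C by (rule prod.union_inter[OF fin(1,2)])
    finally have "y < real (\<Prod>C0) * real (\<Prod>C1)"
      using T(2) by (metis of_nat_mult of_nat_le_iff order_less_le_trans)
    have "real (\<Prod>C0) > sqrt y \<or> real (\<Prod>C1) > sqrt y"
    proof (rule ccontr)
      assume "\<not> ?thesis"
      then have "real (\<Prod>C0) * real (\<Prod>C1) \<le> sqrt y * sqrt y"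
        using y by (intro mult_mono) (auto intro!: prod_nonneg)
      also have "\<dots> = y" using y by simp
      finally show False using \<open>y < real (\<Prod>C0) * real (\<Prod>C1)\<close> by linarith
    qed
    then have big: "big_square (sqrt y) (int n + a0) \<or> big_square (sqrt y) (int n + a1)"
      using big_squareI m0(1) m1(1) unfolding C0_def C1_def by blast
    have "card {T\<in>Pow C. real (\<Prod>T) > y} \<le> card (Pow C)"
      using fin(3) by (intro card_mono) auto
    also have "\<dots> = 2 ^ card C" using fin(3) by (simp add: card_Pow)
    also have "\<dots> \<le> 2 ^ (card C0 + card C1)"
      unfolding C by (intro power_increasing card_Un_le) simp
    finally have "real (card {T\<in>Pow C. real (\<Prod>T) > y}) \<le> real (2 ^ (card C0 + card C1))"
      by (simp only: of_nat_le_iff)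
    also have "\<dots> = 2 ^ card C0 * 2 ^ card C1" by (simp add: power_add)
    also have "\<dots> \<le> (K * of_int X powr \<epsilon>) * (K * of_int X powr \<epsilon>)"
      unfolding C0_def C1_def using K(1)
      by (intro mult_mono two_power_card_power_primes K(2) m0 m1 \<epsilon>) auto
    finally show ?thesis using diff big by (simp add: power2_eq_square)
  qed
qed

text \<open>At most two \<open>n\<close> make a shift vanish, and there the trivial bound
  \<open>1 + y\<close> suffices. Elsewhere the pointwise bound reduces the sum to counting shifts
  with a large square divisor.\<close>

lemma sieve_total_error:
  assumes K: "K \<ge> 1" "\<And>T :: nat set. finite T \<Longrightarrow> \<forall>q\<in>T. prime q \<Longrightarrow> 2 ^ card T \<le> K * real (\<Prod>T) powr \<epsilon>"
    and \<epsilon>: "\<epsilon> > 0" and y: "y \<ge> 1" and X0: "X \<ge> 0"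
    and X: "\<And>n. n < N \<Longrightarrow> \<bar>int n + a0\<bar> \<le> X \<and> \<bar>int n + a1\<bar> \<le> X"
  shows "(\<Sum>n<N. \<bar>both_free n - truncated_sieve y n\<bar>)
    \<le> 2 * (1 + y) + 2 * (K * of_int X powr \<epsilon>)\<^sup>2 * (real N * zeta54 * y powr (-1/4) + sqrt (of_int X))"
proof -
  let ?B = "\<lambda>a n. of_bool (big_square (sqrt y) (int n + a)) :: real"
  let ?Z = "\<lambda>a n. of_bool (int n + a = 0) :: real"
  let ?M = "(K * of_int X powr \<epsilon>)\<^sup>2"
  have pt: "\<bar>both_free n - truncated_sieve y n\<bar> \<le> (1 + y) * ?Z a0 n + (1 + y) * ?Z a1 n + (?M * ?B a0 n + ?M * ?B a1 n)"
    if n: "n < N" for n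
  proof (cases "int n + a0 = 0 \<or> int n + a1 = 0")
    case True
    have "\<bar>both_free n - truncated_sieve y n\<bar> \<le> \<bar>both_free n\<bar> + \<bar>truncated_sieve y n\<bar>" by (rule abs_triangle_ineq4)
    also have "\<dots> \<le> 1 + y" using truncated_sieve_bound[of y n] y by (intro add_mono) (auto simp: both_free_def)
    also have "\<dots> \<le> (1 + y) * ?Z a0 n + (1 + y) * ?Z a1 n" using True y by auto
    also have "\<dots> \<le> (1 + y) * ?Z a0 n + (1 + y) * ?Z a1 n + (?M * ?B a0 n + ?M * ?B a1 n)"
      by simp
    finally show ?thesis .
  next
    case False
    then have "\<bar>both_free n - truncated_sieve y n\<bar>
      \<le> ?M * of_bool (big_square (sqrt y) (int n + a0) \<or> big_square (sqrt y) (int n + a1))"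
      using X[OF n] by (intro sieve_pointwise_error K \<epsilon> y) auto
    also have "\<dots> \<le> ?M * ?B a0 n + ?M * ?B a1 n" by auto
    also have "\<dots> \<le> (1 + y) * ?Z a0 n + (1 + y) * ?Z a1 n + (?M * ?B a0 n + ?M * ?B a1 n)"
      using y by simp
    finally show ?thesis .
  qed
  have zero: "(\<Sum>n<N. ?Z a n) \<le> 1" for a
  proof -
    have "{n\<in>{..<N}. int n + a = 0} \<subseteq> {nat (- a)}" by auto
    then have "card {n\<in>{..<N}. int n + a = 0} \<le> card {nat (- a)}" by (rule card_mono[rotated]) simp
    moreover have "(\<Sum>n<N. ?Z a n) = real (card {n\<in>{..<N}. int n + a = 0})"
      by (simp add: of_bool_def flip: sum.inter_filter)
    ultimately show ?thesis by simp
  qed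
  have sq: "(\<Sum>n<N. ?B a n) \<le> real N * zeta54 * y powr (-1/4) + sqrt (of_int X)"
    if a: "\<And>n. n < N \<Longrightarrow> \<bar>int n + a\<bar> \<le> X" for a
  proof -
    have "(\<Sum>n<N. ?B a n) = real (card {n\<in>{..<N}. big_square (sqrt y) (int n + a)})"
      by (simp add: of_bool_def flip: sum.inter_filter)
    also have "\<dots> \<le> real N * zeta54 * sqrt y powr (-1/2) + sqrt (of_int X)"
      unfolding big_square_def using y by (intro card_square_divisor_le X0 a) auto
    \<comment> \<open>The decay \<open>w powr (-1/2)\<close> is taken at \<open>w = sqrt y\<close>;
      this is the source of the exponent 1/4 in every later truncation error.\<close>
    also have "sqrt y powr (-1/2) = y powr (-1/4)"
      using y by (simp add: powr_half_sqrt[symmetric] powr_powr)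
    finally show ?thesis .
  qed
  have "(\<Sum>n<N. \<bar>both_free n - truncated_sieve y n\<bar>)
      \<le> (\<Sum>n<N. (1 + y) * ?Z a0 n + (1 + y) * ?Z a1 n + (?M * ?B a0 n + ?M * ?B a1 n))"
    using pt by (intro sum_mono) auto
  also have "\<dots> = (1 + y) * (\<Sum>n<N. ?Z a0 n) + (1 + y) * (\<Sum>n<N. ?Z a1 n)
      + (?M * (\<Sum>n<N. ?B a0 n) + ?M * (\<Sum>n<N. ?B a1 n))"
    by (simp only: sum.distrib sum_distrib_left)
  also have "\<dots> \<le> (1 + y) * 1 + (1 + y) * 1 + (?M * (real N * zeta54 * y powr (-1/4) + sqrt (of_int X))
      + ?M * (real N * zeta54 * y powr (-1/4) + sqrt (of_int X)))"
    using y X by (intro add_mono mult_left_mono zero sq) auto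
  finally show ?thesis by (simp only: mult_1_right) (simp add: algebra_simps)
qed

section \<open>The singular product as a sum over squarefree numbers\<close>

lemma abs_sieve_term_le:
  assumes "finite T" "\<forall>q\<in>T. prime q"
  shows "\<bar>sieve_term T\<bar> \<le> 2 ^ card T / (real (\<Prod>T))\<^sup>2"
proof -
  have "\<bar>sieve_term T\<bar> = (\<Prod>q\<in>T. real (rho s a0 a1 q) / real q ^ s)"
    by (simp add: sieve_term_def abs_mult power_abs abs_prod)
  also have "\<dots> \<le> (\<Prod>q\<in>T. 2 / (real q)\<^sup>2)"
  proof (intro prod_mono conjI frac_le)
    fix q assume "q \<in> T"
    then have q: "q \<ge> 1" using assms(2) prime_ge_1_nat by blast
    then show "(real q)\<^sup>2 \<le> real q ^ s" using s by (intro power_increasing) auto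
    show "0 < (real q)\<^sup>2" using q by simp
  qed (use rho_le in auto)
  also have "\<dots> = 2 ^ card T / (real (\<Prod>T))\<^sup>2"
    by (simp add: prod_dividef prod_power_distrib)
  finally show ?thesis .
qed

text \<open>The partial product over primes up to \<open>N\<close> is the sum over all their
  subsets, which for \<open>N \<ge> y\<close> include all sieve sets. The rest have product above
  \<open>y\<close>, and their contribution is bounded uniformly in \<open>N\<close>, so the bound
  survives the limit.\<close>

lemma sieve_series:
  assumes K: "K \<ge> 1" "\<And>T :: nat set. finite T \<Longrightarrow> \<forall>q\<in>T. prime q \<Longrightarrow> 2 ^ card T \<le> K * real (\<Prod>T) powr (1/2)"
    and y: "y \<ge> 1"
  shows "\<bar>singular_product s a0 a1 - (\<Sum>T\<in>sieve_sets y. sieve_term T)\<bar> \<le> K * zeta54 * y powr (-1/4)"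
proof -
  let ?S = "\<Sum>T\<in>sieve_sets y. sieve_term T"
  have fin: "\<bar>(\<Prod>i\<le>N. singular_factor s a0 a1 i) - ?S\<bar> \<le> K * zeta54 * y powr (-1/4)"
    if N: "real N \<ge> y" for N
  proof -
    define P where "P = {q. prime q \<and> q \<le> N}"
    have P: "finite P" "\<forall>q\<in>P. prime q" by (auto simp: P_def)
    have "(\<Prod>i\<le>N. singular_factor s a0 a1 i) = (\<Prod>q\<in>P. singular_factor s a0 a1 q)"
      by (rule prod.mono_neutral_right) (auto simp: P_def singular_factor_def)
    also have "\<dots> = (\<Prod>q\<in>P. 1 - real (rho s a0 a1 q) / real q ^ s)"
      using P by (intro prod.cong refl) (simp add: singular_factor_def)
    also have "\<dots> = (\<Sum>T\<in>Pow P. sieve_term T)"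
      unfolding sieve_term_def by (rule prod_diff_subsets[OF P(1)])
    finally have prod: "(\<Prod>i\<le>N. singular_factor s a0 a1 i) = (\<Sum>T\<in>Pow P. sieve_term T)" .
    have sub: "sieve_sets y \<subseteq> Pow P"
    proof
      fix T assume "T \<in> sieve_sets y"
      then have T: "finite T" "\<forall>q\<in>T. prime q" "real (\<Prod>T) \<le> y" by (auto simp: sieve_sets_def)
      have "q \<le> N" if "q \<in> T" for q
      proof -
        have "\<Prod>T > 0" using prod_primes_ge_1[OF T(2)] by linarith
        then have "q \<le> \<Prod>T" using dvd_prodI[OF T(1) that, of "\<lambda>x. x"] by (rule dvd_imp_le[rotated])
        then have "real q \<le> real N" using T(3) N by linarith
        then show ?thesis by simp
      qed
      then show "T \<in> Pow P" using T by (auto simp: P_def)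
    qed
    let ?D = "Pow P - sieve_sets y"
    have "(\<Prod>i\<le>N. singular_factor s a0 a1 i) - ?S = (\<Sum>T\<in>?D. sieve_term T)"
      unfolding prod using sub P by (simp add: sum_diff)
    also have "\<bar>\<dots>\<bar> \<le> (\<Sum>T\<in>?D. K * y powr (-1/4) * real (\<Prod>T) powr (-5/4))"
    proof (rule order_trans[OF sum_abs], rule sum_mono)
      fix T assume TD: "T \<in> ?D"
      then have T: "finite T" "\<forall>q\<in>T. prime q" using P by (auto intro: finite_subset)
      let ?e = "real (\<Prod>T)"
      have e: "?e > y" using TD T by (auto simp: sieve_sets_def)
      then have e0: "?e > 0" using y by linarith
      have "\<bar>sieve_term T\<bar> \<le> 2 ^ card T / ?e\<^sup>2" by (rule abs_sieve_term_le[OF T])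
      also have "\<dots> \<le> K * ?e powr (1/2) / ?e\<^sup>2" by (rule divide_right_mono[OF K(2)[OF T]]) simp
      also have "\<dots> = K * (?e powr (1/2) * ?e powr (-2))"
      proof -
        have "?e powr (-2) = inverse (?e\<^sup>2)"
          using e0 by (subst powr_minus, subst powr_numeral) auto
        then show ?thesis by (simp only: divide_inverse mult.assoc)
      qed
      \<comment> \<open>The total exponent -3/2 splits into -5/4, which is summable, and -1/4, which
        becomes the decay in \<open>y\<close>.\<close>
      also have "?e powr (1/2) * ?e powr (-2) = ?e powr (-1/4) * ?e powr (-5/4)"
        unfolding powr_add[symmetric] by simp
      also have "K * (?e powr (-1/4) * ?e powr (-5/4)) \<le> K * (y powr (-1/4) * ?e powr (-5/4))"
        using e y K(1) by (intro mult_left_mono mult_right_mono powr_mono2') auto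
      finally show "\<bar>sieve_term T\<bar> \<le> K * y powr (-1/4) * ?e powr (-5/4)" by (simp only: mult.assoc)
    qed
    also have "\<dots> = K * y powr (-1/4) * (\<Sum>T\<in>?D. real (\<Prod>T) powr (-5/4))"
      by (simp only: sum_distrib_left)
    also have "(\<Sum>T\<in>?D. real (\<Prod>T) powr (-5/4)) = (\<Sum>e\<in>(\<lambda>T. \<Prod>T) ` ?D. real e powr (-5/4))"
    proof (subst sum.reindex)
      show "inj_on (\<lambda>T. \<Prod>T) ?D"
        by (rule inj_on_subset[OF inj_on_prod_primes]) (use P in \<open>auto intro: finite_subset\<close>)
    qed (simp add: o_def)
    also have "K * y powr (-1/4) * (\<Sum>e\<in>(\<lambda>T. \<Prod>T) ` ?D. real e powr (-5/4)) \<le> K * y powr (-1/4) * zeta54"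
      using P K(1) by (intro mult_left_mono sum_powr_le_zeta54) auto
    finally show ?thesis by (simp only: mult_ac)
  qed
  have "(\<lambda>N. \<bar>(\<Prod>i\<le>N. singular_factor s a0 a1 i) - ?S\<bar>) \<longlonglongrightarrow> \<bar>singular_product s a0 a1 - ?S\<bar>"
    unfolding singular_product_def
    by (rule tendsto_rabs, rule tendsto_diff[OF _ tendsto_const], rule convergent_prod_LIMSEQ,
        rule abs_convergent_prod_imp_convergent_prod, rule abs_convergent_singular_product, rule s)
  moreover have "\<forall>\<^sub>F N in sequentially. \<bar>(\<Prod>i\<le>N. singular_factor s a0 a1 i) - ?S\<bar> \<le> K * zeta54 * y powr (-1/4)"
    using eventually_ge_at_top[of "nat \<lceil>y\<rceil>"] by eventually_elim (rule fin, linarith)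
  ultimately show ?thesis by (rule tendsto_upperbound) simp
qed

text \<open>As \<open>q ^ s \<ge> 4\<close> and \<open>rho\<close> is at most 2, every factor is at
  least 1/2. A convergent product without zero factors is nonzero, and a limit of positive partial
  products is nonnegative.\<close>

lemma singular_product_pos: "singular_product s a0 a1 > 0"
proof -
  have pos: "singular_factor s a0 a1 q > 0" for q
  proof (cases "prime q")
    case True
    then have "(2::real) \<le> real q" using prime_ge_2_nat by simp
    then have "(2::real) ^ 2 \<le> real q ^ 2" by (rule power_mono) simp
    also have "\<dots> \<le> real q ^ s" using \<open>2 \<le> real q\<close> s by (intro power_increasing) auto
    finally have "real (rho s a0 a1 q) / real q ^ s \<le> 2 / 4"
      using rho_le by (intro frac_le) auto
    then have "real (rho s a0 a1 q) / real q ^ s < 1" by (rule le_less_trans) simp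
    then show ?thesis using True by (simp add: singular_factor_def)
  qed (simp add: singular_factor_def)
  have conv: "convergent_prod (singular_factor s a0 a1)"
    by (intro abs_convergent_prod_imp_convergent_prod abs_convergent_singular_product s)
  have "singular_product s a0 a1 \<noteq> 0"
    unfolding singular_product_def using pos by (intro prodinf_nonzero conv) (metis less_irrefl)
  moreover have "singular_product s a0 a1 \<ge> 0"
    unfolding singular_product_def
    by (rule LIMSEQ_le_const[OF convergent_prod_LIMSEQ[OF conv]])
       (auto intro!: prod_nonneg less_imp_le[OF pos])
  ultimately show ?thesis by linarith
qed

end

section \<open>The asymptotic formula\<close>

lemma square_two_power: "(2 ^ k)\<^sup>2 = (4::real) ^ k"
  by (simp add: power2_eq_square flip: power_mult_distrib)

lemma powr_square: "(x powr a)\<^sup>2 = x powr (2 * a)" for x :: real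
  by (simp add: power2_eq_square flip: powr_add)

lemma eventually_less_powr:
  fixes a c :: real
  assumes "a > 0"
  shows "\<forall>\<^sub>F n in at_top. c < real n powr a"
  using eventually_ge_at_top[of "nat \<lceil>(\<bar>c\<bar> + 1) powr (1 / a)\<rceil>"]
proof eventually_elim
  case (elim n)
  then have "(\<bar>c\<bar> + 1) powr (1 / a) \<le> real n" by linarith
  then have "((\<bar>c\<bar> + 1) powr (1 / a)) powr a \<le> real n powr a"
    using assms by (intro powr_mono2) auto
  moreover have "((\<bar>c\<bar> + 1) powr (1 / a)) powr a = \<bar>c\<bar> + 1"
    using assms by (simp add: powr_powr)
  ultimately show ?case by linarith
qed

lemma N_pairs_eq_sum:
  assumes "prime_modulus p"
  shows "real (N_pairs s a0 a1 p) = (\<Sum>n\<in>{0..<p}. of_bool (mu_free s (int n + a0) = 1 \<and> mu_free s (int n + a1) = 1) *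
    (prime_modulus.primroot p (int n + a0) * prime_modulus.primroot p (int n + a1)))"
proof -
  interpret prime_modulus p by fact
  have "real (N_pairs s a0 a1 p) = (\<Sum>n\<in>{0..<p}. of_bool (\<forall>a\<in>{a0, a1}. ord_Fp p (int n + a) = p - 1 \<and> mu_free s (int n + a) = 1))"
    unfolding N_pairs_def primroot_pairs_def of_bool_def
    by (subst sum.inter_filter[symmetric]) auto
  also have "\<dots> = (\<Sum>n\<in>{0..<p}. of_bool (mu_free s (int n + a0) = 1 \<and> mu_free s (int n + a1) = 1) *
    (primroot (int n + a0) * primroot (int n + a1)))"
    unfolding primroot_def of_bool_conj[symmetric]
    by (intro sum.cong refl arg_cong[where f = of_bool]) auto
  finally show ?thesis .
qed

text \<open>In the last bound every factor 1 - 1/q is at least 1/2. It limits how far the main term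
  can shrink when \<open>n = p - 1\<close> has many small prime factors.\<close>

lemma totient_ratio_bounds:
  assumes "n > 0"
  shows "0 \<le> real (totient n) / real n" "real (totient n) / real n \<le> 1"
    "1 \<le> 2 ^ card (prime_factors n) * (real (totient n) / real n)"
proof -
  show "0 \<le> real (totient n) / real n" by simp
  show "real (totient n) / real n \<le> 1" using totient_le[of n] assms by simp
  have "(1::real) = (\<Prod>q\<in>prime_factors n. 2 * (1 / 2))" by simp
  also have "\<dots> \<le> (\<Prod>q\<in>prime_factors n. 2 * (1 - 1 / real q))"
  proof (intro prod_mono conjI mult_left_mono)
    fix q assume "q \<in> prime_factors n"
    then have "real q \<ge> 2" using prime_ge_2_nat by auto
    then have "1 / real q \<le> 1 / 2" by (intro divide_left_mono) auto
    then show "1 / 2 \<le> 1 - 1 / real q" by simp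
  qed auto
  also have "\<dots> = 2 ^ card (prime_factors n) * (\<Prod>q\<in>prime_factors n. 1 - 1 / real q)"
    by (simp only: prod.distrib prod_constant)
  also have "(\<Prod>q\<in>prime_factors n. 1 - 1 / real q) = real (totient n) / real n"
    using totient_formula2[of n] assms by simp
  finally show "1 \<le> 2 ^ card (prime_factors n) * (real (totient n) / real n)" .
qed

section \<open>Explicit error terms and the choice of parameters\<close>

context power_pair
begin

text \<open>The bound of \<open>sieve_total_error\<close> at \<open>N = p\<close> and
  \<open>X = 2 * p\<close>; the latter is admissible once both shifts are at most \<open>p\<close>
  in absolute value.\<close>

definition sieve_err :: "real \<Rightarrow> real \<Rightarrow> real \<Rightarrow> nat \<Rightarrow> real" where
  "sieve_err K \<epsilon> y p = 2 * (1 + y) +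
     2 * (K * (2 * real p) powr \<epsilon>)\<^sup>2 * (real p * zeta54 * y powr (-1/4) + sqrt (2 * real p))"

text \<open>The sieve error enters twice: in each character sum weighted by
  \<open>both_free\<close>, and in the plain count of power-free pairs. The smallness of
  \<open>a0 - a1\<close> against \<open>p\<close> keeps the two shifts distinct modulo
  \<open>p\<close>.\<close>

lemma N_pairs_explicit:
  assumes K: "K \<ge> 1" "\<And>T :: nat set. finite T \<Longrightarrow> \<forall>q\<in>T. prime q \<Longrightarrow> 2 ^ card T \<le> K * real (\<Prod>T) powr \<epsilon>"
    and L: "L \<ge> 1" "\<And>T :: nat set. finite T \<Longrightarrow> \<forall>q\<in>T. prime q \<Longrightarrow> 2 ^ card T \<le> L * real (\<Prod>T) powr (1/2)"
    and \<epsilon>: "\<epsilon> > 0" and y: "y \<ge> 1" "y ^ s < real p"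
    and p: "prime p" "\<bar>a0\<bar> \<le> int p" "\<bar>a1\<bar> \<le> int p" "\<bar>a0 - a1\<bar> < int p"
  shows "\<bar>real (N_pairs s a0 a1 p)
            - singular_product s a0 a1 * (real (totient (p - 1)) / real (p - 1))\<^sup>2 * real p\<bar>
    \<le> 4 ^ card (prime_factors (p - 1)) *
        (sieve_err K \<epsilon> y p + y * y ^ s * (3 * real p powr (3/4) * (3 + 2 * ln (real p))) + 2)
      + (sieve_err K \<epsilon> y p + y * y ^ s + real p * (L * zeta54 * y powr (-1/4)))"
proof -
  interpret prime_modulus p using p(1) by unfold_locales
  define E where "E = sieve_err K \<epsilon> y p"
  define G where "G = 3 * real p powr (3/4) * (3 + 2 * ln (real p))"
  define \<tau> where "\<tau> = real (totient (p - 1)) / real (p - 1)"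
  define S where "S = (\<Sum>T\<in>sieve_sets y. sieve_term T)"
  define F where "F = (\<Sum>n<p. both_free n)"
  have ln0: "0 \<le> ln (real p)" using p_gt_1 by simp
  then have G0: "G \<ge> 0" unfolding G_def by (intro mult_nonneg_nonneg add_nonneg_nonneg) auto
  have err: "(\<Sum>n<p. \<bar>both_free n - truncated_sieve y n\<bar>) \<le> E"
  proof -
    have "\<bar>int n + a0\<bar> \<le> 2 * int p \<and> \<bar>int n + a1\<bar> \<le> 2 * int p" if "n < p" for n
      using p(2,3) that by linarith
    from sieve_total_error[OF K \<epsilon> y(1) _ this] show ?thesis
      unfolding E_def sieve_err_def by simp
  qed
  have E0: "E \<ge> 0" by (rule order_trans[OF _ err]) (simp add: sum_nonneg)
  have N: "real (N_pairs s a0 a1 p) = (\<Sum>n\<in>{0..<p}. both_free n * (primroot (int n + a0) * primroot (int n + a1)))"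
    unfolding N_pairs_eq_sum[OF prime_modulus_axioms] mu_free_eq ..
  have char_err: "norm (\<Sum>n\<in>{0..<p}. of_real (both_free n) * (\<phi> (int n + a0) * \<psi> (int n + a1))) \<le> E + y * y ^ s * G"
    if \<phi>: "mchar \<phi>" and \<psi>: "mchar \<psi>" and nt: "nontrivial \<phi> \<or> nontrivial \<psi>" for \<phi> \<psi>
  proof -
    let ?H = "\<lambda>n. \<phi> (int n + a0) * \<psi> (int n + a1)"
    have H1: "norm (?H n) \<le> 1" for n
      using mchar_norm[OF \<phi>] mchar_norm[OF \<psi>] by (simp add: norm_mult)
    have nd: "\<not> int p dvd a0 - a1"
    proof
      assume "int p dvd a0 - a1"
      then have "int p \<le> \<bar>a0 - a1\<bar>" using neq by (intro zdvd_imp_le) auto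
      then show False using p(4) by simp
    qed
    \<comment> \<open>Products of characters are bounded by 1, so exchanging
      \<open>both_free\<close> for the truncated sieve costs no more than the total sieve
      error.\<close>
    have "(\<Sum>n\<in>{0..<p}. of_real (both_free n) * ?H n)
        = (\<Sum>n<p. of_real (truncated_sieve y n) * ?H n) + (\<Sum>n<p. of_real (both_free n - truncated_sieve y n) * ?H n)"
      unfolding atLeast0LessThan by (simp add: left_diff_distrib sum_subtractf)
    also have "norm \<dots> \<le> y * y ^ s * G + E"
    proof (rule order_trans[OF norm_triangle_ineq], rule add_mono)
      show "norm (\<Sum>n<p. of_real (truncated_sieve y n) * ?H n) \<le> y * y ^ s * G"
      proof (rule sum_truncated_sieve_twisted[OF y])
        fix q c :: nat assume "0 < q" "q < p"
        from progression_sum_bound[OF \<phi> \<psi> nt nd this, of c]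
        show "norm (\<Sum>n\<in>{n\<in>{..<p}. n mod q = c}. ?H n) \<le> G"
          unfolding G_def atLeast0LessThan .
      qed
      have "norm (\<Sum>n<p. of_real (both_free n - truncated_sieve y n) * ?H n) \<le> (\<Sum>n<p. \<bar>both_free n - truncated_sieve y n\<bar>)"
      proof (intro sum_norm_le)
        fix n
        show "norm (of_real (both_free n - truncated_sieve y n) * ?H n) \<le> \<bar>both_free n - truncated_sieve y n\<bar>"
          unfolding norm_mult[of "of_real _"] norm_of_real using H1[of n] by (intro mult_left_le) auto
      qed
      then show "norm (\<Sum>n<p. of_real (both_free n - truncated_sieve y n) * ?H n) \<le> E" using err by linarith
    qed
    finally show ?thesis by (simp add: add.commute)
  qed
  have main: "\<bar>real (N_pairs s a0 a1 p) - \<tau>\<^sup>2 * F\<bar> \<le> 4 ^ card (prime_factors (p - 1)) * (E + y * y ^ s * G + 2)"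
    unfolding N \<tau>_def F_def atLeast0LessThan[symmetric]
  proof (rule primroot_correlation)
    show "\<bar>both_free n\<bar> \<le> 1" for n by (simp add: both_free_def)
    show "0 \<le> E + y * y ^ s * G" using E0 G0 y by simp
  qed (rule char_err)
  have "\<bar>F - real p * S\<bar> \<le> E + y * y ^ s"
  proof -
    have "\<bar>F - (\<Sum>n<p. truncated_sieve y n)\<bar> \<le> E"
      unfolding F_def sum_subtractf[symmetric] by (rule order_trans[OF sum_abs err])
    then show ?thesis using sum_truncated_sieve[OF y(1), of p] unfolding S_def by linarith
  qed
  moreover have "\<bar>real p * S - real p * singular_product s a0 a1\<bar> \<le> real p * (L * zeta54 * y powr (-1/4))"
    using sieve_series[OF L y(1)] unfolding S_def right_diff_distrib[symmetric] abs_mult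
    by (simp add: abs_minus_commute mult_left_mono)
  ultimately have density: "\<bar>F - real p * singular_product s a0 a1\<bar> \<le> E + y * y ^ s + real p * (L * zeta54 * y powr (-1/4))"
    (is "_ \<le> ?D") by linarith
  have "p - 1 > 0" using p_gt_1 by simp
  then have \<tau>: "0 \<le> \<tau>" "\<tau> \<le> 1"
    unfolding \<tau>_def by (rule totient_ratio_bounds)+
  have "\<tau>\<^sup>2 * F - singular_product s a0 a1 * \<tau>\<^sup>2 * real p = \<tau>\<^sup>2 * (F - real p * singular_product s a0 a1)"
    by (simp add: algebra_simps)
  also have "\<bar>\<dots>\<bar> \<le> 1 * ?D"
    unfolding abs_mult using \<tau> density by (intro mult_mono) (auto simp: power_le_one)
  finally have fin: "\<bar>\<tau>\<^sup>2 * F - singular_product s a0 a1 * \<tau>\<^sup>2 * real p\<bar> \<le> ?D" by simp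
  have "\<bar>real (N_pairs s a0 a1 p) - singular_product s a0 a1 * \<tau>\<^sup>2 * real p\<bar>
      \<le> \<bar>real (N_pairs s a0 a1 p) - \<tau>\<^sup>2 * F\<bar> + \<bar>\<tau>\<^sup>2 * F - singular_product s a0 a1 * \<tau>\<^sup>2 * real p\<bar>"
    using abs_triangle_ineq[of "real (N_pairs s a0 a1 p) - \<tau>\<^sup>2 * F" "\<tau>\<^sup>2 * F - singular_product s a0 a1 * \<tau>\<^sup>2 * real p"]
    by simp
  then show ?thesis
    unfolding E_def[symmetric] G_def[symmetric] \<tau>_def[symmetric]
    by (rule order_trans) (rule add_mono[OF main fin])
qed

text \<open>For the sieve truncated at \<open>y = p powr \<delta>\<close> there are at most \<open>y ^ (s + 1) = p powr (1/8)\<close> progressions,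
  so that the incomplete character sums contribute \<open>O(p powr (7/8) * ln p)\<close> in total.\<close>
definition \<delta> :: real where "\<delta> = 1 / (8 * (real s + 1))"

lemma delta: "0 < \<delta>" "\<delta> \<le> 1 / 24" "\<delta> * (real s + 1) = 1 / 8"
  using s by (auto simp: \<delta>_def field_simps)

text \<open>The bound on \<open>4 ^ card\<close> is exported together with the error term because
  existence later needs it to bound the totient ratio from below.\<close>

lemma N_pairs_power_saving:
  obtains K C where "K \<ge> 1" "C \<ge> 0"
    "\<And>p. prime p \<Longrightarrow> 4 ^ card (prime_factors (p - 1)) \<le> K * real p powr (\<delta> / 32)"
    "\<And>p. prime p \<Longrightarrow> \<bar>a0\<bar> \<le> int p \<Longrightarrow> \<bar>a1\<bar> \<le> int p \<Longrightarrow> \<bar>a0 - a1\<bar> < int p \<Longrightarrow>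
       \<bar>real (N_pairs s a0 a1 p)
            - singular_product s a0 a1 * (real (totient (p - 1)) / real (p - 1))\<^sup>2 * real p\<bar>
       \<le> C * real p powr (1 - 3 * \<delta> / 16)"
proof -
  \<comment> \<open>The divisor bound is squared once in the sieve error and once in
    \<open>4 ^ card\<close>, a loss of \<open>p powr (4 * \<epsilon>)\<close>. With this choice the
    loss is \<delta>/16, and \<delta>/4 - \<delta>/16 = 3\<delta>/16 of the saving remains.\<close>
  define \<epsilon> where "\<epsilon> = \<delta> / 64"
  have \<epsilon>: "\<epsilon> > 0" using delta by (simp add: \<epsilon>_def)
  obtain K where K: "K \<ge> 1" "\<And>T :: nat set. finite T \<Longrightarrow> \<forall>q\<in>T. prime q \<Longrightarrow> 2 ^ card T \<le> K * real (\<Prod>T) powr \<epsilon>"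
    by (rule two_power_card_primes_le[OF \<epsilon>]) (rule that)
  obtain L where L: "L \<ge> 1" "\<And>T :: nat set. finite T \<Longrightarrow> \<forall>q\<in>T. prime q \<Longrightarrow> 2 ^ card T \<le> L * real (\<Prod>T) powr (1/2)"
    by (rule two_power_card_primes_le[of "1/2"], simp) (rule that)
  define C1 where "C1 = 4 + 8 * K\<^sup>2 * (zeta54 + 2)"
  \<comment> \<open>Here 107 is 105 from the character sums plus the 2 from vanishing characters;
    the second bracket collects the sieve error, \<open>y * y ^ s\<close> and the tail of the
    singular product.\<close>
  define C where "C = K\<^sup>2 * (C1 + 107) + (C1 + 1 + L * zeta54)"
  have C1: "C1 \<ge> 0" using zeta54_nonneg K(1) by (simp add: C1_def)
  have C: "C \<ge> 0" using C1 zeta54_nonneg L(1) by (simp add: C_def)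
  have omega: "4 ^ card (prime_factors (p - 1)) \<le> K\<^sup>2 * real p powr (2 * \<epsilon>)" if p: "prime p" for p
  proof -
    interpret prime_modulus p using p by unfold_locales
    have "(2::real) ^ card (prime_factors (p - 1)) \<le> K * real (\<Prod>(prime_factors (p - 1))) powr \<epsilon>"
      by (rule K(2)) auto
    also have "\<dots> \<le> K * real p powr \<epsilon>"
    proof (intro mult_left_mono powr_mono2)
      have "\<Prod>(prime_factors (p - 1)) \<le> p - 1"
        using p_gt_1 by (intro dvd_imp_le prod_prime_factors_dvd) auto
      then show "real (\<Prod>(prime_factors (p - 1))) \<le> real p" by linarith
    qed (use \<epsilon> K(1) in \<open>auto intro!: prod_nonneg\<close>)
    finally have "(2 ^ card (prime_factors (p - 1)))\<^sup>2 \<le> (K * real p powr \<epsilon>)\<^sup>2"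
      by (rule power_mono) simp
    then show ?thesis unfolding square_two_power power_mult_distrib powr_square .
  qed
  show ?thesis
  proof (rule that[of "K\<^sup>2" C])
    show "1 \<le> K\<^sup>2" using K(1) by simp
    show "0 \<le> C" by (rule C)
    show "4 ^ card (prime_factors (p - 1)) \<le> K\<^sup>2 * real p powr (\<delta> / 32)" if "prime p" for p
      using omega[OF that] by (simp add: \<epsilon>_def)
    fix p :: nat
    assume p: "prime p" "\<bar>a0\<bar> \<le> int p" "\<bar>a1\<bar> \<le> int p" "\<bar>a0 - a1\<bar> < int p"
    define x where "x = real p"
    have x: "x > 1" using prime_gt_1_nat[OF p(1)] by (simp add: x_def)
    define y where "y = x powr \<delta>"
    \<comment> \<open>The sieve tail \<open>x * y powr (-1/4)\<close> is the dominant term; all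
      others are compared with it.\<close>
    define U where "U = x powr (1 - \<delta> / 4)"
    define A where "A = x powr (2 * \<epsilon>)"
    have mono: "x powr a \<le> x powr b" if "a \<le> b" for a b using x that by (simp add: powr_mono)
    have y1: "y \<ge> 1" using x delta by (simp add: y_def ge_one_powr_ge_zero)
    have A1: "A \<ge> 1" using x \<epsilon> by (simp add: A_def ge_one_powr_ge_zero)
    have U1: "U \<ge> 1" using x delta by (simp add: U_def ge_one_powr_ge_zero)
    have yU: "y \<le> U" unfolding y_def U_def using delta by (intro mono) simp
    have ys: "y ^ s = x powr (\<delta> * real s)" 
      unfolding y_def using x by (subst powr_realpow[symmetric]) (auto simp: powr_powr)
    have d: "\<delta> + \<delta> * real s = 1 / 8"
      unfolding delta(3)[symmetric] by (simp only: distrib_left mult_1_right add.commute)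
    have yys: "y * y ^ s = x powr (1/8)"
      unfolding ys unfolding y_def powr_add[symmetric] d ..
    have yysU: "y * y ^ s \<le> U" unfolding yys U_def using delta by (intro mono) simp
    have ysp: "y ^ s < real p"
    proof -
      have "y ^ s \<le> y * y ^ s" using y1 by simp
      also have "\<dots> < x powr 1" unfolding yys using x by (intro powr_less_mono) simp_all
      also have "x powr 1 = real p" using x unfolding x_def by (intro powr_one) simp
      finally show ?thesis .
    qed
    have y4: "x * y powr (-1/4) = U"
    proof -
      have "x * y powr (-1/4) = x powr 1 * x powr (\<delta> * (-1/4))"
        unfolding y_def powr_powr using x by (simp only: powr_one)
      also have "\<dots> = x powr (1 - \<delta> / 4)" unfolding powr_add[symmetric] by simp
      finally show ?thesis by (simp only: U_def)
    qed
    have sq: "sqrt (2 * x) \<le> 2 * U"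
    proof -
      have "sqrt (2 * x) = sqrt 2 * x powr (1/2)" using x by (simp add: real_sqrt_mult powr_half_sqrt)
      also have "\<dots> \<le> 2 * U"
        unfolding U_def using delta by (intro mult_mono mono) (auto simp: real_le_lsqrt)
      finally show ?thesis .
    qed
    have two: "((2 * x) powr \<epsilon>)\<^sup>2 \<le> 4 * A"
    proof -
      have "((2 * x) powr \<epsilon>)\<^sup>2 = (2 powr \<epsilon>)\<^sup>2 * A"
        using x by (simp add: powr_mult power_mult_distrib A_def powr_square)
      also have "(2 powr \<epsilon>)\<^sup>2 \<le> ((2::real) powr 1)\<^sup>2"
        using delta \<epsilon> by (intro power_mono powr_mono) (auto simp: \<epsilon>_def)
      finally show ?thesis using A1 by (simp add: mult_right_mono)
    qed
    \<comment> \<open>The exponents 1/8 from the progressions, 3/4 from the sums and 1/16 from the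
      logarithm make 15/16, at most 1 - \<delta>/4. The constant is 105 = 3 (3 + 2 * 16).\<close>
    have lnb: "y * y ^ s * (3 * x powr (3/4) * (3 + 2 * ln x)) \<le> 105 * U"
    proof -
      have "ln x \<le> x powr (1/16) / (1/16)" using x by (intro ln_powr_bound) auto
      moreover have "1 \<le> x powr (1/16)" using x by (simp add: ge_one_powr_ge_zero)
      ultimately have "3 + 2 * ln x \<le> 35 * x powr (1/16)" by simp
      then have "y * y ^ s * (3 * x powr (3/4) * (3 + 2 * ln x)) \<le> x powr (1/8) * (3 * x powr (3/4) * (35 * x powr (1/16)))"
        unfolding yys by (intro mult_left_mono) auto
      also have "\<dots> = 105 * (x powr (1/8) * x powr (3/4) * x powr (1/16))" by simp
      also have "x powr (1/8) * x powr (3/4) * x powr (1/16) = x powr (15/16)"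
        unfolding powr_add[symmetric] by simp
      also have "\<dots> \<le> U" unfolding U_def using delta by (intro mono) simp
      finally show ?thesis by simp
    qed
    have AU: "U \<le> A * U" using A1 U1 by simp
    have E: "sieve_err K \<epsilon> y p \<le> C1 * (A * U)"
    proof -
      have "sieve_err K \<epsilon> y p = 2 * (1 + y) + 2 * K\<^sup>2 * ((2 * x) powr \<epsilon>)\<^sup>2 * (zeta54 * (x * y powr (-1/4)) + sqrt (2 * x))"
        by (simp only: sieve_err_def x_def power_mult_distrib mult_ac)
      also have "\<dots> \<le> 2 * (U + U) + 2 * K\<^sup>2 * (4 * A) * (zeta54 * U + 2 * U)"
        unfolding y4
      proof (rule add_mono, use U1 yU in simp, rule mult_mono)
        show "2 * K\<^sup>2 * ((2 * x) powr \<epsilon>)\<^sup>2 \<le> 2 * K\<^sup>2 * (4 * A)"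
          by (rule mult_left_mono[OF two]) simp
        show "zeta54 * U + sqrt (2 * x) \<le> zeta54 * U + 2 * U" using sq by simp
        show "0 \<le> 2 * K\<^sup>2 * (4 * A)" using A1 by simp
        show "0 \<le> zeta54 * U + sqrt (2 * x)" using zeta54_nonneg U1 x by simp
      qed
      also have "\<dots> = 4 * U + (8 * K\<^sup>2 * (zeta54 + 2)) * (A * U)" by (simp add: algebra_simps)
      also have "\<dots> \<le> C1 * (A * U)" using AU by (simp add: C1_def distrib_right)
      finally show ?thesis .
    qed
    have "\<bar>real (N_pairs s a0 a1 p)
            - singular_product s a0 a1 * (real (totient (p - 1)) / real (p - 1))\<^sup>2 * real p\<bar>
      \<le> 4 ^ card (prime_factors (p - 1)) *
        (sieve_err K \<epsilon> y p + y * y ^ s * (3 * x powr (3/4) * (3 + 2 * ln x)) + 2)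
      + (sieve_err K \<epsilon> y p + y * y ^ s + L * zeta54 * (x * y powr (-1/4)))"
    proof -
      have "real p * (L * zeta54 * y powr (-1/4)) = L * zeta54 * (x * y powr (-1/4))"
        by (simp only: x_def mult_ac)
      then show ?thesis
        using N_pairs_explicit[OF K L \<epsilon> y1 ysp p] by (simp only: x_def)
    qed
    also have "\<dots> \<le> K\<^sup>2 * A * ((C1 + 107) * (A * U)) + (C1 + 1 + L * zeta54) * (A * U)"
    proof (rule add_mono)
      have "0 \<le> sieve_err K \<epsilon> y p"
        using y1 zeta54_nonneg by (simp add: sieve_err_def)
      moreover have "0 \<le> y * y ^ s * (3 * x powr (3/4) * (3 + 2 * ln x))"
        using y1 x by simp
      moreover have "sieve_err K \<epsilon> y p + y * y ^ s * (3 * x powr (3/4) * (3 + 2 * ln x)) + 2 \<le> (C1 + 107) * (A * U)"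
        using E lnb U1 AU by (simp only: distrib_right)
      ultimately show "4 ^ card (prime_factors (p - 1)) *
        (sieve_err K \<epsilon> y p + y * y ^ s * (3 * x powr (3/4) * (3 + 2 * ln x)) + 2) \<le> K\<^sup>2 * A * ((C1 + 107) * (A * U))"
        using omega[OF p(1)] A1 unfolding A_def x_def by (intro mult_mono) auto
      have "L * zeta54 * U \<le> L * zeta54 * (A * U)"
        using AU L(1) zeta54_nonneg by (intro mult_left_mono) auto
      then show "sieve_err K \<epsilon> y p + y * y ^ s + L * zeta54 * (x * y powr (-1/4)) \<le> (C1 + 1 + L * zeta54) * (A * U)"
        unfolding y4 distrib_right using E yysU AU by linarith
    qed
    also have "\<dots> \<le> K\<^sup>2 * A * ((C1 + 107) * (A * U)) + (C1 + 1 + L * zeta54) * (A * (A * U))"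
      using A1 U1 C1 L(1) zeta54_nonneg by (intro add_left_mono mult_left_mono) auto
    also have "\<dots> = C * (A * (A * U))" by (simp add: C_def algebra_simps)
    also have "A * (A * U) = x powr (1 - 3 * \<delta> / 16)"
      unfolding A_def U_def powr_add[symmetric] by (simp add: \<epsilon>_def)
    finally show "\<bar>real (N_pairs s a0 a1 p)
            - singular_product s a0 a1 * (real (totient (p - 1)) / real (p - 1))\<^sup>2 * real p\<bar>
       \<le> C * real p powr (1 - 3 * \<delta> / 16)" by (simp add: x_def)
  qed
qed

end

theorem theorem1p5:
  fixes s :: nat and a0 a1 :: int
  assumes "s \<ge> 2" and "a0 \<noteq> a1"
  shows "(\<forall>\<^sub>F p in primes_at_top. \<exists>n. n \<in> primroot_pairs s a0 a1 p) \<and>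
    (\<exists>\<epsilon>0 > 0. \<forall>\<epsilon>. 0 < \<epsilon> \<and> \<epsilon> < \<epsilon>0 \<longrightarrow>
      (\<lambda>p. real (N_pairs s a0 a1 p) -
            singular_product s a0 a1 * (real (totient (p - 1)) / real (p - 1)) ^ 2 * real p)
        \<in> O[primes_at_top](\<lambda>p. real p powr (1 - \<epsilon>)))"
proof -
  interpret power_pair s a0 a1 using assms by unfold_locales
  obtain K C where K: "K \<ge> 1" and C: "C \<ge> 0"
    and omega: "\<And>p. prime p \<Longrightarrow> 4 ^ card (prime_factors (p - 1)) \<le> K * real p powr (\<delta> / 32)"
    and bound: "\<And>p. prime p \<Longrightarrow> \<bar>a0\<bar> \<le> int p \<Longrightarrow> \<bar>a1\<bar> \<le> int p \<Longrightarrow> \<bar>a0 - a1\<bar> < int p \<Longrightarrow>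
       \<bar>real (N_pairs s a0 a1 p)
            - singular_product s a0 a1 * (real (totient (p - 1)) / real (p - 1))\<^sup>2 * real p\<bar>
       \<le> C * real p powr (1 - 3 * \<delta> / 16)"
    by (rule N_pairs_power_saving) (rule that)
  have large: "\<forall>\<^sub>F p in at_top. \<bar>a0\<bar> \<le> int p \<and> \<bar>a1\<bar> \<le> int p \<and> \<bar>a0 - a1\<bar> < int p"
    using eventually_ge_at_top[of "nat (\<bar>a0\<bar> + \<bar>a1\<bar> + 1)"] by eventually_elim linarith
  let ?S = "singular_product s a0 a1"
  \<comment> \<open>The exponent is the saving 3\<delta>/16 less the loss \<delta>/32 from the
    squared totient ratio; at this point the main term overtakes the error.\<close>
  have "\<forall>\<^sub>F p in at_top. C * K / ?S < real p powr (5 * \<delta> / 32)"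
    using delta by (intro eventually_less_powr) simp
  with large have "\<forall>\<^sub>F p in at_top. prime p \<longrightarrow> (\<exists>n. n \<in> primroot_pairs s a0 a1 p)"
  proof eventually_elim
    case (elim p)
    show ?case
    proof
      assume p: "prime p"
      let ?x = "real p"
      let ?\<tau> = "real (totient (p - 1)) / real (p - 1)"
      have x: "?x > 1" using prime_gt_1_nat[OF p] by simp
      have "1 \<le> (2 ^ card (prime_factors (p - 1)) * ?\<tau>)\<^sup>2"
        using prime_gt_1_nat[OF p] totient_ratio_bounds(3)[of "p - 1"] by (intro one_le_power) simp
      also have "\<dots> = 4 ^ card (prime_factors (p - 1)) * ?\<tau>\<^sup>2"
        by (simp only: power_mult_distrib square_two_power)
      also have "\<dots> \<le> K * ?x powr (\<delta> / 32) * ?\<tau>\<^sup>2"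
        by (intro mult_right_mono omega p) simp
      finally have tau: "1 \<le> K * ?x powr (\<delta> / 32) * ?\<tau>\<^sup>2" .
      have e1: "?x powr (1 - 3 * \<delta> / 16) * ?x powr (\<delta> / 32) = ?x powr (1 - 5 * \<delta> / 32)"
        unfolding powr_add[symmetric] by simp
      have e2: "?x powr (5 * \<delta> / 32) * ?x powr (1 - 5 * \<delta> / 32) = ?x"
        unfolding powr_add[symmetric] using x by simp
      have "(K * ?x powr (\<delta> / 32)) * (C * ?x powr (1 - 3 * \<delta> / 16)) = C * K * ?x powr (1 - 5 * \<delta> / 32)"
        unfolding e1[symmetric] by (simp only: mult_ac)
      also have "\<dots> < ?S * ?x powr (5 * \<delta> / 32) * ?x powr (1 - 5 * \<delta> / 32)"
      proof (rule mult_strict_right_mono)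
        have "C * K / ?S < ?x powr (5 * \<delta> / 32)" using elim by blast
        then show "C * K < ?S * ?x powr (5 * \<delta> / 32)"
          using singular_product_pos by (simp only: pos_divide_less_eq mult.commute)
      qed (use x in simp)
      also have "\<dots> = ?S * ?x" unfolding mult.assoc e2 ..
      also have "\<dots> = ?S * ?x * 1" by simp
      also have "\<dots> \<le> ?S * ?x * (K * ?x powr (\<delta> / 32) * ?\<tau>\<^sup>2)"
        using singular_product_pos x by (intro mult_left_mono tau) simp
      finally have "(K * ?x powr (\<delta> / 32)) * (C * ?x powr (1 - 3 * \<delta> / 16)) < (K * ?x powr (\<delta> / 32)) * (?S * ?\<tau>\<^sup>2 * ?x)"
        by (simp only: mult_ac)
      moreover have "K * ?x powr (\<delta> / 32) > 0" using K x by simp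
      ultimately have "C * ?x powr (1 - 3 * \<delta> / 16) < ?S * ?\<tau>\<^sup>2 * ?x"
        by (simp only: mult_less_cancel_left_pos)
      moreover have "?S * ?\<tau>\<^sup>2 * ?x - real (N_pairs s a0 a1 p) \<le> C * ?x powr (1 - 3 * \<delta> / 16)"
        using bound[OF p] elim by (simp only: abs_le_iff minus_diff_eq)
      ultimately have "real (N_pairs s a0 a1 p) > 0" by linarith
      then have "primroot_pairs s a0 a1 p \<noteq> {}" by (auto simp: N_pairs_def)
      then show "\<exists>n. n \<in> primroot_pairs s a0 a1 p" by blast
    qed
  qed
  then have exist: "\<forall>\<^sub>F p in primes_at_top. \<exists>n. n \<in> primroot_pairs s a0 a1 p"
    unfolding primes_at_top_def eventually_inf_principal by simp
  \<comment> \<open>The saving 3\<delta>/16, which depends only on \<open>s\<close>, serves as the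
    threshold: a smaller \<epsilon> only enlarges the comparison function, so one constant works for
    all of them.\<close>
  have "(\<lambda>p. real (N_pairs s a0 a1 p) - ?S * (real (totient (p - 1)) / real (p - 1)) ^ 2 * real p)
        \<in> O[primes_at_top](\<lambda>p. real p powr (1 - \<epsilon>))" if "0 < \<epsilon>" "\<epsilon> < 3 * \<delta> / 16" for \<epsilon>
  proof (rule bigoI[where c = C])
    have "\<forall>\<^sub>F p in at_top. prime p \<longrightarrow> norm (real (N_pairs s a0 a1 p) - ?S * (real (totient (p - 1)) / real (p - 1)) ^ 2 * real p)
        \<le> C * norm (real p powr (1 - \<epsilon>))"
      using large
    proof eventually_elim
      case (elim p)
      show ?case
      proof
        assume p: "prime p"
        have "real p powr (1 - 3 * \<delta> / 16) \<le> real p powr (1 - \<epsilon>)"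
          using that prime_gt_1_nat[OF p] by (intro powr_mono) auto
        then have "C * real p powr (1 - 3 * \<delta> / 16) \<le> C * real p powr (1 - \<epsilon>)"
          using C by (rule mult_left_mono)
        then show "norm (real (N_pairs s a0 a1 p) - ?S * (real (totient (p - 1)) / real (p - 1)) ^ 2 * real p)
            \<le> C * norm (real p powr (1 - \<epsilon>))"
          using order_trans[OF bound[OF p]] elim by (simp only: real_norm_def abs_of_nonneg[OF powr_ge_zero])
      qed
    qed
    then show "\<forall>\<^sub>F p in primes_at_top. norm (real (N_pairs s a0 a1 p) - ?S * (real (totient (p - 1)) / real (p - 1)) ^ 2 * real p)
        \<le> C * norm (real p powr (1 - \<epsilon>))"
      unfolding primes_at_top_def eventually_inf_principal by simp
  qed
  moreover have "3 * \<delta> / 16 > 0" using delta by simp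
  ultimately show ?thesis
    using exist by (intro conjI exI[of _ "3 * \<delta> / 16"] allI impI) auto
qed

end
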